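(* Let $\{\mathcal F,\mathcal G\}$ be a minimal and regular Hilbert C*-system whose fixed point algebra $\mathcal A$ satisfies Property B, let $\mathcal Z$ be the center of $\mathcal A$, and let $\mathcal T$ be the category of all canonical endomorphisms of $\{\mathcal F,\mathcal G\}$. Then $\mathcal T$ contains a DR-subcategory $\mathcal T_{\mathbb C}$ with the same objects, $\mathrm{Ob}\,\mathcal T_{\mathbb C}=\mathrm{Ob}\,\mathcal T$, and arrows $(\sigma,\tau)_{\mathbb C}\subseteq(\sigma,\tau)$, such that for all $\sigma,\tau\in\mathrm{Ob}\,\mathcal T$ $$(\sigma,\tau)=(\sigma,\tau)_{\mathbb C}\,\sigma(\mathcal Z)=\tau(\mathcal Z)\,(\sigma,\tau)_{\mathbb C}\,\sigma(\mathcal Z).$$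
   Context: C*-algebras are unital. An algebraic Hilbert space in $\mathcal F$ is a finite-dimensional subspace $\mathcal H\subset\mathcal F$ with $A^*B\in\mathbb C\mathbf 1$ for $A,B\in\mathcal H$, with scalar product $\langle A,B\rangle\mathbf 1=A^*B$; its support is $\sum_j\Phi_j\Phi_j^*$ for any orthonormal basis $\{\Phi_j\}$. All algebraic Hilbert spaces are assumed to have support $\mathbf 1$. Let $\mathcal G$ be a compact group acting on $\mathcal F$ by a pointwise norm-continuous homomorphism $\alpha:\mathcal G\to\mathrm{Aut}\,\mathcal F$. For $D\in\widehat{\mathcal G}$ (the set of equivalence classes of irreducible unitary representations) put $\Pi_D(F)=\int_{\mathcal G}\overline{\chi_D(g)}\,\alpha_g(F)\,dg$ with $\chi_D(g)=\dim D\cdot\mathrm{Tr}\,\pi(g)$, $\pi\in D$, $dg$ normalized Haar measure. The system is a Hilbert C*-system if for each $D\in\widehat{\mathcal G}$ there is an algebraic Hilbert space $\mathcal H_D\subset\Pi_D\mathcal F$ which is $\alpha_{\mathcal G}$-invariant and carries a unitary representation of class $D$. Then $\alpha$ is faithful, and one identifies $\mathcal G$ with $\alpha_{\mathcal G}\subset\mathrm{Aut}\,\mathcal F$ and writes $\{\mathcal F,\mathcal G\}$. $\mathcal A$ denotes the fixed point algebra and $\mathcal Z=\mathcal A'\cap\mathcal A$. Minimal: $\mathcal A'\cap\mathcal F=\mathcal Z$. Property B: $\mathcal A$ contains isometries $V,W$ with $VV^*+WW^*=\mathbf 1$. Canonical endomorphisms: for a $\mathcal G$-invariant algebraic Hilbert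 space $\mathcal H\subset\mathcal F$ with orthonormal basis $\{\Phi_j\}$, $\rho_{\mathcal H}(F)=\sum_j\Phi_jF\Phi_j^*$, restricted to $\mathcal A$. The category $\mathcal T$ has the canonical endomorphisms as objects and arrows $(\sigma,\tau)=\{X\in\mathcal A: X\sigma(A)=\tau(A)X\ \forall A\in\mathcal A\}$; the tensor product of objects is composition, that of arrows $A\in(\sigma,\sigma')$, $B\in(\tau,\tau')$ is $A\times B=A\sigma(B)$; the unit is $\iota=\mathrm{id}$. $\mathcal G$-invariant algebraic Hilbert spaces are the objects of a category $\mathcal T_{\mathcal G}$. The product $\mathcal H\cdot\mathcal K=\mathrm{span}\{\Phi\Psi\mid\Phi\in\mathcal H,\Psi\in\mathcal K\}$ is again such a space. Regular: there is an assignment $\mathrm{Ob}\,\mathcal T\ni\sigma\mapsto\mathcal H_\sigma\in\mathrm{Ob}\,\mathcal T_{\mathcal G}$ such that $\sigma$ is the canonical endomorphism of $\mathcal H_\sigma$ and $\mathcal H_{\sigma\circ\tau}=\mathcal H_\sigma\cdot\mathcal H_\tau$. A DR-category is a tensor C*-category with $(\iota,\iota)=\mathbb C\mathbf 1$, closed under direct sums (for objects $\sigma,\tau$ there are an object $\rho$ and isometries $V\in(\sigma,\rho)$, $W\in(\tau,\rho)$ with $VV^*+WW^*=\mathbf 1$) and subobjects (for each nonzero projection $E\in(\sigma,\sigma)$ there are an object $\tau$ and an isometry $V\in(\tau,\sigma)$ with $VV^*=E$), with a permutation structure and a conjugation structure. For categories of endomorphisms: a permutation structure is a family of unitaries $\epsilon(\sigma,\tau)\in(\sigma\tau,\tau\sigma)$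 with $\epsilon(\sigma,\tau)\epsilon(\tau,\sigma)=\mathbf 1$, $\epsilon(\iota,\sigma)=\epsilon(\sigma,\iota)=\mathbf 1$, $\epsilon(\sigma_1\sigma_2,\sigma_3)=\epsilon(\sigma_1,\sigma_3)\,\sigma_1(\epsilon(\sigma_2,\sigma_3))$ and $\epsilon(\sigma',\tau')\,(A\times B)=(B\times A)\,\epsilon(\sigma,\tau)$ for arrows $A\in(\sigma,\sigma')$, $B\in(\tau,\tau')$; a conjugation structure assigns to each $\sigma$ an object $\overline\sigma$ and $R_\sigma\in(\iota,\overline\sigma\sigma)$ such that, with $S_\sigma=\epsilon(\overline\sigma,\sigma)R_\sigma$, $S_\sigma^*\sigma(R_\sigma)=\mathbf 1$ and $R_\sigma^*\overline\sigma(S_\sigma)=\mathbf 1$. For the subcategory $\mathcal T_{\mathbb C}$ all of these arrows are taken in the spaces $(\cdot,\cdot)_{\mathbb C}$. Products of sets such as $(\sigma,\tau)_{\mathbb C}\,\sigma(\mathcal Z)$ denote linear spans of products. *)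

theory Defs
  imports
    "HOL-Analysis.Analysis"
    "HOL-Algebra.Group"
    "Jordan_Normal_Form.Schur_Decomposition"
begin

text \<open>Unital complex C*-algebras as a type class. As in \<^class>\<open>real_normed_algebra_1\<close>,
  the zero algebra is excluded.\<close>

class cstar_algebra = real_normed_algebra_1 + banach +
  fixes scaleC :: "complex \<Rightarrow> 'a \<Rightarrow> 'a"  (infixr "*\<^sub>C" 75)
    and star :: "'a \<Rightarrow> 'a"  ("_\<^sup>\<star>" [1000] 999)
  assumes scaleC_add_right: "a *\<^sub>C (x + y) = a *\<^sub>C x + a *\<^sub>C y"
    and scaleC_add_left: "(a + b) *\<^sub>C x = a *\<^sub>C x + b *\<^sub>C x"
    and scaleC_scaleC: "a *\<^sub>C b *\<^sub>C x = (a * b) *\<^sub>C x"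
    and scaleC_one: "1 *\<^sub>C x = x"
    and scaleC_of_real: "complex_of_real r *\<^sub>C x = r *\<^sub>R x"
    and mult_scaleC_left: "(a *\<^sub>C x) * y = a *\<^sub>C (x * y)"
    and mult_scaleC_right: "x * (a *\<^sub>C y) = a *\<^sub>C (x * y)"
    and norm_scaleC: "norm (a *\<^sub>C x) = cmod a * norm x"
    and star_star: "(x\<^sup>\<star>)\<^sup>\<star> = x"
    and star_add: "(x + y)\<^sup>\<star> = x\<^sup>\<star> + y\<^sup>\<star>"
    and star_scaleC: "(a *\<^sub>C x)\<^sup>\<star> = cnj a *\<^sub>C x\<^sup>\<star>"
    and star_mult: "(x * y)\<^sup>\<star> = y\<^sup>\<star> * x\<^sup>\<star>"
    and cstar_identity: "norm (x\<^sup>\<star> * x) = (norm x)\<^sup>2"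

global_interpretation complex_vector:
  vector_space "scaleC :: complex \<Rightarrow> 'a \<Rightarrow> 'a::cstar_algebra"
  by unfold_locales
    (simp_all add: scaleC_add_right scaleC_add_left scaleC_scaleC scaleC_one)

abbreviation csubspace :: "'a::cstar_algebra set \<Rightarrow> bool"
  where "csubspace \<equiv> complex_vector.subspace"

abbreviation cspan :: "'a::cstar_algebra set \<Rightarrow> 'a set"
  where "cspan \<equiv> complex_vector.span"

definition is_unitary :: "'a::cstar_algebra \<Rightarrow> bool"
  where "is_unitary U \<longleftrightarrow> U\<^sup>\<star> * U = 1 \<and> U * U\<^sup>\<star> = 1"

definition is_isometry :: "'a::cstar_algebra \<Rightarrow> bool"
  where "is_isometry V \<longleftrightarrow> V\<^sup>\<star> * V = 1"

definition is_projection :: "'a::cstar_algebra \<Rightarrow> bool"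
  where "is_projection E \<longleftrightarrow> E\<^sup>\<star> = E \<and> E * E = E"

definition commutant :: "'a::cstar_algebra set \<Rightarrow> 'a set"
  where "commutant S = {F. \<forall>A\<in>S. F * A = A * F}"

definition center :: "'a::cstar_algebra set \<Rightarrow> 'a set"
  where "center \<A> = commutant \<A> \<inter> \<A>"

definition property_B :: "'a::cstar_algebra set \<Rightarrow> bool"
  where "property_B \<A> \<longleftrightarrow>
    (\<exists>V\<in>\<A>. \<exists>W\<in>\<A>. is_isometry V \<and> is_isometry W \<and> V * V\<^sup>\<star> + W * W\<^sup>\<star> = 1)"

definition star_automorphism :: "('a::cstar_algebra \<Rightarrow> 'a) \<Rightarrow> bool"
  where "star_automorphism \<theta> \<longleftrightarrow> bij \<theta> \<and>
    (\<forall>x y. \<theta> (x + y) = \<theta> x + \<theta> y) \<and> (\<forall>c x. \<theta> (c *\<^sub>C x) = c *\<^sub>C \<theta> x) \<and>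
    (\<forall>x y. \<theta> (x * y) = \<theta> x * \<theta> y) \<and> (\<forall>x. \<theta> (x\<^sup>\<star>) = (\<theta> x)\<^sup>\<star>)"


section \<open>Compact groups, Haar measure and unitary representations\<close>

definition compact_group :: "('g, 'b) monoid_scheme \<Rightarrow> 'g topology \<Rightarrow> bool"
  where "compact_group G T \<longleftrightarrow> Group.group G \<and> topspace T = carrier G \<and>
    continuous_map (prod_topology T T) T (\<lambda>(g, h). g \<otimes>\<^bsub>G\<^esub> h) \<and>
    continuous_map T T (\<lambda>g. inv\<^bsub>G\<^esub> g) \<and>
    compact_space T \<and> Hausdorff_space T"

definition normalized_haar_measure ::
    "('g, 'b) monoid_scheme \<Rightarrow> 'g topology \<Rightarrow> 'g measure \<Rightarrow> bool"
  where "normalized_haar_measure G T \<mu> \<longleftrightarrow>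
    space \<mu> = topspace T \<and> sets \<mu> = sigma_sets (topspace T) {U. openin T U} \<and>
    emeasure \<mu> (space \<mu>) = 1 \<and>
    (\<forall>g\<in>carrier G. \<forall>E\<in>sets \<mu>. emeasure \<mu> ((\<lambda>h. g \<otimes>\<^bsub>G\<^esub> h) ` E) = emeasure \<mu> E) \<and>
    (\<forall>E\<in>sets \<mu>. emeasure \<mu> E = (SUP K\<in>{K. compactin T K \<and> K \<subseteq> E}. emeasure \<mu> K))"

text \<open>The Bochner integral of the library needs a second countable range, which C*-algebras
  need not have. The integral of a function into the algebra is therefore the weak one: it is
  the vector on which every bounded (real-linear) functional takes the expected value. For
  continuous functions on a compact group it exists and is unique.\<close>

definition has_weak_integral :: "'g measure \<Rightarrow> ('g \<Rightarrow> 'a::real_normed_vector) \<Rightarrow> 'a \<Rightarrow> bool"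
  where "has_weak_integral \<mu> f y \<longleftrightarrow>
    (\<forall>\<phi> :: 'a \<Rightarrow> real. bounded_linear \<phi> \<longrightarrow> has_bochner_integral \<mu> (\<lambda>g. \<phi> (f g)) (\<phi> y))"

definition weak_integral :: "'g measure \<Rightarrow> ('g \<Rightarrow> 'a::real_normed_vector) \<Rightarrow> 'a"
  where "weak_integral \<mu> f = (THE y. has_weak_integral \<mu> f y)"

text \<open>Finite-dimensional unitary representations are written as unitary matrices, i.e. with
  respect to an orthonormal basis of the representation space; irreducible unitary
  representations of compact groups are finite-dimensional.\<close>

definition unitary_rep ::
    "('g, 'b) monoid_scheme \<Rightarrow> 'g topology \<Rightarrow> nat \<Rightarrow> ('g \<Rightarrow> complex mat) \<Rightarrow> bool"
  where "unitary_rep G T n \<pi> \<longleftrightarrow>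
    (\<forall>g\<in>carrier G. \<pi> g \<in> carrier_mat n n \<and>
       mat_adjoint (\<pi> g) * \<pi> g = 1\<^sub>m n \<and> \<pi> g * mat_adjoint (\<pi> g) = 1\<^sub>m n) \<and>
    (\<forall>g\<in>carrier G. \<forall>h\<in>carrier G. \<pi> (g \<otimes>\<^bsub>G\<^esub> h) = \<pi> g * \<pi> h) \<and>
    (\<forall>i<n. \<forall>j<n. continuous_map T euclidean (\<lambda>g. \<pi> g $$ (i, j)))"

definition irreducible_rep ::
    "('g, 'b) monoid_scheme \<Rightarrow> 'g topology \<Rightarrow> nat \<Rightarrow> ('g \<Rightarrow> complex mat) \<Rightarrow> bool"
  where "irreducible_rep G T n \<pi> \<longleftrightarrow> unitary_rep G T n \<pi> \<and> 0 < n \<and>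
    (\<forall>W \<subseteq> carrier_vec n.
       0\<^sub>v n \<in> W \<and> (\<forall>v\<in>W. \<forall>w\<in>W. v + w \<in> W) \<and> (\<forall>c. \<forall>v\<in>W. c \<cdot>\<^sub>v v \<in> W) \<and>
       (\<forall>g\<in>carrier G. \<forall>v\<in>W. \<pi> g *\<^sub>v v \<in> W)
       \<longrightarrow> W = {0\<^sub>v n} \<or> W = carrier_vec n)"

text \<open>Not the plain character: it carries the factor \<open>dim D\<close>.\<close>

definition normalized_char :: "nat \<Rightarrow> ('g \<Rightarrow> complex mat) \<Rightarrow> 'g \<Rightarrow> complex"
  where "normalized_char n \<pi> g = of_nat n * (\<Sum>i<n. \<pi> g $$ (i, i))"

definition spectral_projection ::
    "'g measure \<Rightarrow> ('g \<Rightarrow> 'a \<Rightarrow> 'a) \<Rightarrow> nat \<Rightarrow> ('g \<Rightarrow> complex mat) \<Rightarrow> 'a::cstar_algebra \<Rightarrow> 'a"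
  where "spectral_projection \<mu> \<alpha> n \<pi> F =
    weak_integral \<mu> (\<lambda>g. cnj (normalized_char n \<pi> g) *\<^sub>C \<alpha> g F)"


section \<open>Algebraic Hilbert spaces\<close>

text \<open>Orthonormality with respect to the scalar product given by \<open>\<langle>A, B\<rangle> 1 = A\<^sup>\<star> B\<close>.\<close>

definition orthonormal_basis :: "'a::cstar_algebra set \<Rightarrow> nat \<Rightarrow> (nat \<Rightarrow> 'a) \<Rightarrow> bool"
  where "orthonormal_basis H n \<Phi> \<longleftrightarrow> cspan (\<Phi> ` {..<n}) = H \<and>
    (\<forall>i<n. \<forall>j<n. (\<Phi> i)\<^sup>\<star> * \<Phi> j = (if i = j then 1 else 0))"

text \<open>The support does not depend on the orthonormal basis. Support 1 is part of the
  definition, since all algebraic Hilbert spaces are assumed to have it.\<close>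

definition has_support :: "'a::cstar_algebra set \<Rightarrow> 'a \<Rightarrow> bool"
  where "has_support H P \<longleftrightarrow>
    (\<exists>n \<Phi>. orthonormal_basis H n \<Phi> \<and> P = (\<Sum>j<n. \<Phi> j * (\<Phi> j)\<^sup>\<star>))"

definition algebraic_hilbert_space :: "'a::cstar_algebra set \<Rightarrow> bool"
  where "algebraic_hilbert_space H \<longleftrightarrow>
    csubspace H \<and> (\<exists>B. finite B \<and> cspan B = H) \<and>
    (\<forall>A\<in>H. \<forall>B\<in>H. \<exists>c. A\<^sup>\<star> * B = c *\<^sub>C 1) \<and> has_support H 1"

definition hs_product :: "'a::cstar_algebra set \<Rightarrow> 'a set \<Rightarrow> 'a set"
  where "hs_product H K = cspan {\<Phi> * \<Psi> | \<Phi> \<Psi>. \<Phi> \<in> H \<and> \<Psi> \<in> K}"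

definition invariant_hilbert_space ::
    "('g, 'b) monoid_scheme \<Rightarrow> ('g \<Rightarrow> 'a \<Rightarrow> 'a) \<Rightarrow> 'a::cstar_algebra set \<Rightarrow> bool"
  where "invariant_hilbert_space G \<alpha> H \<longleftrightarrow>
    algebraic_hilbert_space H \<and> (\<forall>g\<in>carrier G. \<alpha> g ` H \<subseteq> H)"

text \<open>The restriction of \<open>\<alpha>\<close> to \<open>H\<close> is unitarily equivalent to \<open>\<pi>\<close>: its matrix in some
  orthonormal basis is \<open>\<pi>\<close>.\<close>

definition carries_rep ::
    "('g, 'b) monoid_scheme \<Rightarrow> ('g \<Rightarrow> 'a \<Rightarrow> 'a) \<Rightarrow> 'a::cstar_algebra set \<Rightarrow>
     nat \<Rightarrow> ('g \<Rightarrow> complex mat) \<Rightarrow> bool"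
  where "carries_rep G \<alpha> H n \<pi> \<longleftrightarrow>
    (\<exists>\<Phi>. orthonormal_basis H n \<Phi> \<and>
      (\<forall>g\<in>carrier G. \<forall>j<n. \<alpha> g (\<Phi> j) = (\<Sum>i<n. \<pi> g $$ (i, j) *\<^sub>C \<Phi> i)))"


section \<open>Hilbert C*-systems\<close>

text \<open>The last condition ranges over irreducible representations instead of their
  equivalence classes; it depends on the class of \<open>\<pi>\<close> only.\<close>

definition hilbert_cstar_system ::
    "('g, 'b) monoid_scheme \<Rightarrow> 'g topology \<Rightarrow> 'g measure \<Rightarrow>
     ('g \<Rightarrow> 'a \<Rightarrow> 'a::cstar_algebra) \<Rightarrow> bool"
  where "hilbert_cstar_system G T \<mu> \<alpha> \<longleftrightarrow>
    compact_group G T \<and> normalized_haar_measure G T \<mu> \<and>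
    (\<forall>g\<in>carrier G. star_automorphism (\<alpha> g)) \<and>
    (\<forall>g\<in>carrier G. \<forall>h\<in>carrier G. \<alpha> (g \<otimes>\<^bsub>G\<^esub> h) = \<alpha> g \<circ> \<alpha> h) \<and>
    (\<forall>F. continuous_map T euclidean (\<lambda>g. \<alpha> g F)) \<and>
    (\<forall>n \<pi>. irreducible_rep G T n \<pi> \<longrightarrow>
       (\<exists>H. invariant_hilbert_space G \<alpha> H \<and>
            H \<subseteq> range (spectral_projection \<mu> \<alpha> n \<pi>) \<and> carries_rep G \<alpha> H n \<pi>))"

definition fixed_algebra ::
    "('g, 'b) monoid_scheme \<Rightarrow> ('g \<Rightarrow> 'a \<Rightarrow> 'a) \<Rightarrow> 'a::cstar_algebra set"
  where "fixed_algebra G \<alpha> = {F. \<forall>g\<in>carrier G. \<alpha> g F = F}"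

definition minimal_system ::
    "('g, 'b) monoid_scheme \<Rightarrow> ('g \<Rightarrow> 'a \<Rightarrow> 'a::cstar_algebra) \<Rightarrow> bool"
  where "minimal_system G \<alpha> \<longleftrightarrow> commutant (fixed_algebra G \<alpha>) = center (fixed_algebra G \<alpha>)"

text \<open>Endomorphisms of a subalgebra \<open>\<A>\<close> are extensional functions on \<open>\<A>\<close> (undefined
  outside), so that equality is equality on \<open>\<A>\<close>; composition is \<open>compose \<A>\<close> and the
  identity is \<open>restrict id \<A>\<close>. In particular, different Hilbert spaces may give the same
  canonical endomorphism.\<close>

definition canonical_endo_of ::
    "'a::cstar_algebra set \<Rightarrow> 'a set \<Rightarrow> ('a \<Rightarrow> 'a) \<Rightarrow> bool"
  where "canonical_endo_of \<A> H \<sigma> \<longleftrightarrow>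
    (\<exists>n \<Phi>. orthonormal_basis H n \<Phi> \<and> \<sigma> = (\<lambda>F\<in>\<A>. \<Sum>j<n. \<Phi> j * F * (\<Phi> j)\<^sup>\<star>))"

definition canonical_endos ::
    "('g, 'b) monoid_scheme \<Rightarrow> ('g \<Rightarrow> 'a \<Rightarrow> 'a) \<Rightarrow> ('a::cstar_algebra \<Rightarrow> 'a) set"
  where "canonical_endos G \<alpha> =
    {\<sigma>. \<exists>H. invariant_hilbert_space G \<alpha> H \<and> canonical_endo_of (fixed_algebra G \<alpha>) H \<sigma>}"

definition regular_system ::
    "('g, 'b) monoid_scheme \<Rightarrow> ('g \<Rightarrow> 'a \<Rightarrow> 'a::cstar_algebra) \<Rightarrow> bool"
  where "regular_system G \<alpha> \<longleftrightarrow>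
    (\<exists>H :: ('a \<Rightarrow> 'a) \<Rightarrow> 'a set.
      (\<forall>\<sigma>\<in>canonical_endos G \<alpha>. invariant_hilbert_space G \<alpha> (H \<sigma>) \<and>
         canonical_endo_of (fixed_algebra G \<alpha>) (H \<sigma>) \<sigma>) \<and>
      (\<forall>\<sigma>\<in>canonical_endos G \<alpha>. \<forall>\<tau>\<in>canonical_endos G \<alpha>.
         H (compose (fixed_algebra G \<alpha>) \<sigma> \<tau>) = hs_product (H \<sigma>) (H \<tau>)))"


section \<open>Categories of endomorphisms\<close>

definition intertwiners ::
    "'a::cstar_algebra set \<Rightarrow> ('a \<Rightarrow> 'a) \<Rightarrow> ('a \<Rightarrow> 'a) \<Rightarrow> 'a set"
  where "intertwiners \<A> \<sigma> \<tau> = {X\<in>\<A>. \<forall>A\<in>\<A>. X * \<sigma> A = \<tau> A * X}"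

definition star_endomorphism :: "'a::cstar_algebra set \<Rightarrow> ('a \<Rightarrow> 'a) \<Rightarrow> bool"
  where "star_endomorphism \<A> \<sigma> \<longleftrightarrow>
    \<sigma> \<in> extensional \<A> \<and> \<sigma> ` \<A> \<subseteq> \<A> \<and> \<sigma> 1 = 1 \<and>
    (\<forall>x\<in>\<A>. \<forall>y\<in>\<A>. \<sigma> (x + y) = \<sigma> x + \<sigma> y \<and> \<sigma> (x * y) = \<sigma> x * \<sigma> y) \<and>
    (\<forall>x\<in>\<A>. \<sigma> (x\<^sup>\<star>) = (\<sigma> x)\<^sup>\<star> \<and> (\<forall>c. \<sigma> (c *\<^sub>C x) = c *\<^sub>C \<sigma> x))"

text \<open>A category with objects \<open>Ob\<close> (endomorphisms of \<open>\<A>\<close>) and arrow spaces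
  \<open>Hom \<sigma> \<tau>\<close> contained in the full intertwiner spaces. Composition of arrows, involution, norm
  and the tensor product \<open>A \<times> B = A \<sigma>(B)\<close> are those of \<open>\<A>\<close>. Hence the algebraic axioms of a
  tensor C*-category (associativity, interchange law, C*-property, ...) hold automatically and
  the conditions below say that the arrow spaces are complete and closed under the operations.\<close>

definition tensor_cstar_category ::
    "'a::cstar_algebra set \<Rightarrow> ('a \<Rightarrow> 'a) set \<Rightarrow> (('a \<Rightarrow> 'a) \<Rightarrow> ('a \<Rightarrow> 'a) \<Rightarrow> 'a set) \<Rightarrow> bool"
  where "tensor_cstar_category \<A> Ob Hom \<longleftrightarrow>
    (\<forall>\<sigma>\<in>Ob. star_endomorphism \<A> \<sigma>) \<and>
    restrict id \<A> \<in> Ob \<and> (\<forall>\<sigma>\<in>Ob. \<forall>\<tau>\<in>Ob. compose \<A> \<sigma> \<tau> \<in> Ob) \<and>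
    (\<forall>\<sigma>\<in>Ob. \<forall>\<tau>\<in>Ob. Hom \<sigma> \<tau> \<subseteq> intertwiners \<A> \<sigma> \<tau> \<and>
       csubspace (Hom \<sigma> \<tau>) \<and> closed (Hom \<sigma> \<tau>)) \<and>
    (\<forall>\<sigma>\<in>Ob. 1 \<in> Hom \<sigma> \<sigma>) \<and>
    (\<forall>\<sigma>\<in>Ob. \<forall>\<tau>\<in>Ob. \<forall>\<upsilon>\<in>Ob. \<forall>X\<in>Hom \<sigma> \<tau>. \<forall>Y\<in>Hom \<tau> \<upsilon>. Y * X \<in> Hom \<sigma> \<upsilon>) \<and>
    (\<forall>\<sigma>\<in>Ob. \<forall>\<tau>\<in>Ob. \<forall>X\<in>Hom \<sigma> \<tau>. X\<^sup>\<star> \<in> Hom \<tau> \<sigma>) \<and>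
    (\<forall>\<sigma>\<in>Ob. \<forall>\<sigma>'\<in>Ob. \<forall>\<tau>\<in>Ob. \<forall>\<tau>'\<in>Ob. \<forall>A\<in>Hom \<sigma> \<sigma>'. \<forall>B\<in>Hom \<tau> \<tau>'.
       A * \<sigma> B \<in> Hom (compose \<A> \<sigma> \<tau>) (compose \<A> \<sigma>' \<tau>'))"

definition permutation_structure ::
    "'a::cstar_algebra set \<Rightarrow> ('a \<Rightarrow> 'a) set \<Rightarrow> (('a \<Rightarrow> 'a) \<Rightarrow> ('a \<Rightarrow> 'a) \<Rightarrow> 'a set) \<Rightarrow>
     (('a \<Rightarrow> 'a) \<Rightarrow> ('a \<Rightarrow> 'a) \<Rightarrow> 'a) \<Rightarrow> bool"
  where "permutation_structure \<A> Ob Hom \<epsilon> \<longleftrightarrow>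
    (\<forall>\<sigma>\<in>Ob. \<forall>\<tau>\<in>Ob. is_unitary (\<epsilon> \<sigma> \<tau>) \<and>
       \<epsilon> \<sigma> \<tau> \<in> Hom (compose \<A> \<sigma> \<tau>) (compose \<A> \<tau> \<sigma>) \<and> \<epsilon> \<sigma> \<tau> * \<epsilon> \<tau> \<sigma> = 1) \<and>
    (\<forall>\<sigma>\<in>Ob. \<epsilon> (restrict id \<A>) \<sigma> = 1 \<and> \<epsilon> \<sigma> (restrict id \<A>) = 1) \<and>
    (\<forall>\<sigma>\<^sub>1\<in>Ob. \<forall>\<sigma>\<^sub>2\<in>Ob. \<forall>\<sigma>\<^sub>3\<in>Ob.
       \<epsilon> (compose \<A> \<sigma>\<^sub>1 \<sigma>\<^sub>2) \<sigma>\<^sub>3 = \<epsilon> \<sigma>\<^sub>1 \<sigma>\<^sub>3 * \<sigma>\<^sub>1 (\<epsilon> \<sigma>\<^sub>2 \<sigma>\<^sub>3)) \<and>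
    (\<forall>\<sigma>\<in>Ob. \<forall>\<sigma>'\<in>Ob. \<forall>\<tau>\<in>Ob. \<forall>\<tau>'\<in>Ob. \<forall>A\<in>Hom \<sigma> \<sigma>'. \<forall>B\<in>Hom \<tau> \<tau>'.
       \<epsilon> \<sigma>' \<tau>' * (A * \<sigma> B) = (B * \<tau> A) * \<epsilon> \<sigma> \<tau>)"

definition conjugation_structure ::
    "'a::cstar_algebra set \<Rightarrow> ('a \<Rightarrow> 'a) set \<Rightarrow> (('a \<Rightarrow> 'a) \<Rightarrow> ('a \<Rightarrow> 'a) \<Rightarrow> 'a set) \<Rightarrow>
     (('a \<Rightarrow> 'a) \<Rightarrow> ('a \<Rightarrow> 'a) \<Rightarrow> 'a) \<Rightarrow> (('a \<Rightarrow> 'a) \<Rightarrow> ('a \<Rightarrow> 'a)) \<Rightarrow> (('a \<Rightarrow> 'a) \<Rightarrow> 'a) \<Rightarrow> bool"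
  where "conjugation_structure \<A> Ob Hom \<epsilon> bar R \<longleftrightarrow>
    (\<forall>\<sigma>\<in>Ob. bar \<sigma> \<in> Ob \<and> R \<sigma> \<in> Hom (restrict id \<A>) (compose \<A> (bar \<sigma>) \<sigma>) \<and>
      (let S = \<epsilon> (bar \<sigma>) \<sigma> * R \<sigma>
       in S\<^sup>\<star> * \<sigma> (R \<sigma>) = 1 \<and> (R \<sigma>)\<^sup>\<star> * bar \<sigma> S = 1))"

definition has_direct_sums ::
    "('a \<Rightarrow> 'a) set \<Rightarrow> (('a \<Rightarrow> 'a) \<Rightarrow> ('a \<Rightarrow> 'a) \<Rightarrow> 'a::cstar_algebra set) \<Rightarrow> bool"
  where "has_direct_sums Ob Hom \<longleftrightarrow>
    (\<forall>\<sigma>\<in>Ob. \<forall>\<tau>\<in>Ob. \<exists>\<rho>\<in>Ob. \<exists>V\<in>Hom \<sigma> \<rho>. \<exists>W\<in>Hom \<tau> \<rho>.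
       is_isometry V \<and> is_isometry W \<and> V * V\<^sup>\<star> + W * W\<^sup>\<star> = 1)"

definition has_subobjects ::
    "('a \<Rightarrow> 'a) set \<Rightarrow> (('a \<Rightarrow> 'a) \<Rightarrow> ('a \<Rightarrow> 'a) \<Rightarrow> 'a::cstar_algebra set) \<Rightarrow> bool"
  where "has_subobjects Ob Hom \<longleftrightarrow>
    (\<forall>\<sigma>\<in>Ob. \<forall>E\<in>Hom \<sigma> \<sigma>. is_projection E \<and> E \<noteq> 0 \<longrightarrow>
       (\<exists>\<tau>\<in>Ob. \<exists>V\<in>Hom \<tau> \<sigma>. is_isometry V \<and> V * V\<^sup>\<star> = E))"

definition DR_category ::
    "'a::cstar_algebra set \<Rightarrow> ('a \<Rightarrow> 'a) set \<Rightarrow> (('a \<Rightarrow> 'a) \<Rightarrow> ('a \<Rightarrow> 'a) \<Rightarrow> 'a set) \<Rightarrow> bool"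
  where "DR_category \<A> Ob Hom \<longleftrightarrow>
    tensor_cstar_category \<A> Ob Hom \<and>
    Hom (restrict id \<A>) (restrict id \<A>) = range (\<lambda>c. c *\<^sub>C 1) \<and>
    has_direct_sums Ob Hom \<and> has_subobjects Ob Hom \<and>
    (\<exists>\<epsilon>. permutation_structure \<A> Ob Hom \<epsilon> \<and>
      (\<exists>bar R. conjugation_structure \<A> Ob Hom \<epsilon> bar R))"

end

theory Submission
  imports Defs "Jordan_Normal_Form.Spectral_Radius"
begin

text \<open>
  Let \<open>H\<^sub>\<sigma>\<close> be the Hilbert spaces of a regular assignment. The arrows of the subcategory are the
  invariant elements that map \<open>H\<^sub>\<sigma>\<close> into \<open>H\<^sub>\<tau>\<close>, and the symmetry is the flip
  \<open>\<Phi> \<Psi> \<mapsto> \<Psi> \<Phi>\<close>. By minimality the matrix entries of any intertwiner lie in the centre, and a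
  linearly independent expansion of the entries gives \<open>(\<sigma>, \<tau>) = (\<sigma>, \<tau>)\<^sub>C \<sigma>(Z)\<close>.

  Subobjects and conjugates need objects that carry a prescribed unitary representation. A Hilbert
  space in \<open>F\<close> with this representation is built from irreducible ones by the isometries of
  Property B; its canonical endomorphism \<open>\<tau>\<close>, however, is assigned a possibly different space
  \<open>H\<^sub>\<tau>\<close>. Two invariant Hilbert spaces with the same canonical endomorphism are nevertheless
  unitarily equivalent through an invariant element: a maximal partial isometry between them has
  defects separated by a central projection of the algebra of self-intertwiners of \<open>\<tau>\<close>, and
  the trace of this algebra, with values in the centre, forces the defects to vanish.
\<close>

section \<open>Scalars and orthonormal families\<close>

text \<open>Two invariant Hilbert spaces with the same canonical endomorphism differ by a unitary
  matrix over \<open>\<Z>\<close> that intertwines their representations; a character of the centre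
  would make it scalar. The proof finds a scalar intertwiner without characters. Both spaces share
  one algebra of self-intertwiners, whose elements are matrices over a commutative ring, so that it
  has a trace. A projection that maps a Hilbert space into itself has scalar entries, so a vanishing
  trace kills it. The product rule of the assignment is what makes the subcategory a tensor
  category: it lets \<open>A * \<sigma> B\<close> act as the tensor product of two linear maps
  between the assigned spaces, gives the flip its composition law, and forces the space of the unit
  to be the scalars. Throughout, support 1 plays the part of completeness: equations are checked on
  the vectors of a Hilbert space, and membership in it by inner products.\<close>

lemma star_zero [simp]: "(0::'a::cstar_algebra)\<^sup>\<star> = 0"
  using star_add[of "0::'a" 0] by simp

lemma star_one [simp]: "(1::'a::cstar_algebra)\<^sup>\<star> = 1"
  by (metis mult.left_neutral mult.right_neutral star_mult star_star)

lemma star_minus: "(- x)\<^sup>\<star> = - (x::'a::cstar_algebra)\<^sup>\<star>"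
  by (metis add.right_inverse add_eq_0_iff star_add star_zero)

lemma star_diff: "(x - y)\<^sup>\<star> = (x::'a::cstar_algebra)\<^sup>\<star> - y\<^sup>\<star>"
  by (metis diff_conv_add_uminus star_add star_minus)

lemma star_sum: "(\<Sum>i\<in>I. f i)\<^sup>\<star> = (\<Sum>i\<in>I. (f i :: 'a::cstar_algebra)\<^sup>\<star>)"
  by (induction I rule: infinite_finite_induct) (simp_all add: star_add)

lemmas scaleC_simps = mult_scaleC_left mult_scaleC_right scaleC_scaleC scaleC_one
lemmas star_simps = star_add star_diff star_sum star_mult star_scaleC star_star

lemma star_mult_self_eq_0 [simp]: "x\<^sup>\<star> * x = 0 \<longleftrightarrow> (x::'a::cstar_algebra) = 0"
  using cstar_identity[of x] by auto

lemma scaleC_zero_left [simp]: "0 *\<^sub>C (x::'a::cstar_algebra) = 0"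
  by simp

lemma scaleC_one_cancel [simp]: "a *\<^sub>C (1::'a::cstar_algebra) = b *\<^sub>C 1 \<longleftrightarrow> a = b"
  by simp

definition scalars :: "'a::cstar_algebra set"
  where "scalars = range (\<lambda>c. c *\<^sub>C 1)"

text \<open>Meaningful only on \<open>scalars\<close>: elsewhere no \<open>c\<close> fits the
  description and the value is arbitrary.\<close>

definition coef :: "'a::cstar_algebra \<Rightarrow> complex"
  where "coef x = (THE c. x = c *\<^sub>C 1)"

lemma coef_scaleC_one [simp]: "coef (c *\<^sub>C (1::'a::cstar_algebra)) = c"
  unfolding coef_def by simp

lemma scaleC_coef: "x \<in> scalars \<Longrightarrow> coef x *\<^sub>C 1 = x"
  by (auto simp: scalars_def)

lemma scalars_iff: "x \<in> scalars \<longleftrightarrow> (\<exists>c. x = c *\<^sub>C 1)"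
  by (auto simp: scalars_def)

lemma scalars_scaleC_one [simp]: "c *\<^sub>C 1 \<in> scalars"
  by (auto simp: scalars_def)

lemma scalars_0 [simp]: "0 \<in> scalars"
  using scalars_scaleC_one[of 0] by simp

lemma scalars_1 [simp]: "1 \<in> scalars"
  using scalars_scaleC_one[of 1] by (simp add: scaleC_one)

lemma scalars_scaleC: "x \<in> scalars \<Longrightarrow> c *\<^sub>C x \<in> scalars"
  by (auto simp: scalars_iff scaleC_simps)

lemma scalars_add: "x \<in> scalars \<Longrightarrow> y \<in> scalars \<Longrightarrow> x + y \<in> scalars"
  by (auto simp: scalars_iff simp flip: scaleC_add_left)

lemma scalars_diff: "x \<in> scalars \<Longrightarrow> y \<in> scalars \<Longrightarrow> x - y \<in> scalars"
  by (auto simp: scalars_iff simp flip: complex_vector.scale_left_diff_distrib)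

lemma scalars_sum: "(\<And>i. i \<in> I \<Longrightarrow> f i \<in> scalars) \<Longrightarrow> sum f I \<in> scalars"
  by (induction I rule: infinite_finite_induct) (simp_all add: scalars_add)

lemma scalars_mult: "x \<in> scalars \<Longrightarrow> y \<in> scalars \<Longrightarrow> x * y \<in> scalars"
  by (auto simp: scalars_iff scaleC_simps)

lemma scalars_star: "x \<in> scalars \<Longrightarrow> x\<^sup>\<star> \<in> scalars"
  by (auto simp: scalars_iff star_simps)

lemma scalars_commute: "x \<in> scalars \<Longrightarrow> x * y = y * x"
  by (auto simp: scalars_iff scaleC_simps)

lemma scalars_mult_left: "x \<in> scalars \<Longrightarrow> x * y = coef x *\<^sub>C y"
  by (auto simp: scalars_iff scaleC_simps)

lemma scalars_mult_right: "x \<in> scalars \<Longrightarrow> y * x = coef x *\<^sub>C y"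
  by (auto simp: scalars_iff scaleC_simps)

lemma norm_scaleC_one [simp]: "norm (c *\<^sub>C (1::'a::cstar_algebra)) = cmod c"
  by (simp add: norm_scaleC)

text \<open>The map from complex numbers to multiples of 1 is isometric, so its range is
  complete.\<close>

lemma closed_scalars: "closed (scalars :: 'a::cstar_algebra set)"
proof -
  have "bounded_linear (\<lambda>c. c *\<^sub>C (1::'a))"
    by (rule bounded_linear_intro[of _ 1])
       (simp_all add: scaleC_add_left scaleC_scaleC scaleR_conv_of_real[where 'a = complex] flip: scaleC_of_real)
  hence "complete (range (\<lambda>c. c *\<^sub>C (1::'a)))"
    by (intro complete_isometric_image[of 1]) (auto simp: complete_UNIV)
  thus ?thesis unfolding scalars_def by (rule complete_imp_closed)
qed

text \<open>Index sets are arbitrary so that bases of products and of direct sums can be indexed by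
  pairs and by disjoint unions, before \<open>orthonormal_reindex\<close> turns them into
  sequences.\<close>

definition orthonormal :: "'i set \<Rightarrow> ('i \<Rightarrow> 'a::cstar_algebra) \<Rightarrow> bool"
  where "orthonormal I \<Phi> \<longleftrightarrow> (\<forall>i\<in>I. \<forall>j\<in>I. (\<Phi> i)\<^sup>\<star> * \<Phi> j = (if i = j then 1 else 0))"

lemma orthonormalD:
  "orthonormal I \<Phi> \<Longrightarrow> i \<in> I \<Longrightarrow> j \<in> I \<Longrightarrow> (\<Phi> i)\<^sup>\<star> * \<Phi> j = (if i = j then 1 else 0)"
  by (simp add: orthonormal_def)

lemma orthonormal_basis_iff:
  "orthonormal_basis H n \<Phi> \<longleftrightarrow> cspan (\<Phi> ` {..<n}) = H \<and> orthonormal {..<n} \<Phi>"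
  by (auto simp: orthonormal_basis_def orthonormal_def)

text \<open>The vectors with both properties form a subspace, and orthonormality puts every
  \<open>\<Phi> i\<close> into it.\<close>

lemma orthonormal_expansion:
  assumes "finite I" "orthonormal I \<Phi>" "x \<in> cspan (\<Phi> ` I)"
  shows orthonormal_expand: "(\<Sum>i\<in>I. \<Phi> i * ((\<Phi> i)\<^sup>\<star> * x)) = x"
    and orthonormal_coef: "i \<in> I \<Longrightarrow> (\<Phi> i)\<^sup>\<star> * x \<in> scalars"
proof -
  let ?S = "{x. (\<Sum>i\<in>I. \<Phi> i * ((\<Phi> i)\<^sup>\<star> * x)) = x \<and> (\<forall>i\<in>I. (\<Phi> i)\<^sup>\<star> * x \<in> scalars)}"
  have "csubspace ?S"
    unfolding complex_vector.subspace_def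
    by (auto simp: distrib_left sum.distrib scaleC_simps scalars_add scalars_scaleC
        simp flip: complex_vector.scale_sum_right)
  moreover have "\<Phi> ` I \<subseteq> ?S"
  proof
    fix y assume "y \<in> \<Phi> ` I"
    then obtain j where j: "j \<in> I" "y = \<Phi> j" by auto
    have "(\<Sum>i\<in>I. \<Phi> i * ((\<Phi> i)\<^sup>\<star> * y)) = (\<Sum>i\<in>I. if i = j then \<Phi> i else 0)"
      using assms(2) j by (intro sum.cong) (auto simp: orthonormalD)
    thus "y \<in> ?S"
      using assms j by (auto simp: orthonormalD)
  qed
  ultimately have "x \<in> ?S"
    using complex_vector.span_minimal assms(3) by blast
  thus "(\<Sum>i\<in>I. \<Phi> i * ((\<Phi> i)\<^sup>\<star> * x)) = x" "i \<in> I \<Longrightarrow> (\<Phi> i)\<^sup>\<star> * x \<in> scalars" by auto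
qed

lemma orthonormal_scaleC_sum_eq_0:
  assumes "finite I" "orthonormal I \<Phi>" "(\<Sum>i\<in>I. c i *\<^sub>C \<Phi> i) = 0" "j \<in> I"
  shows "c j = 0"
proof -
  have "0 = (\<Phi> j)\<^sup>\<star> * (\<Sum>i\<in>I. c i *\<^sub>C \<Phi> i)" using assms(3) by simp
  also have "\<dots> = (\<Sum>i\<in>I. if j = i then c i *\<^sub>C 1 else 0)"
    unfolding sum_distrib_left using assms
    by (intro sum.cong) (auto simp: scaleC_simps orthonormalD)
  also have "\<dots> = c j *\<^sub>C 1" using assms by simp
  finally show ?thesis by simp
qed

lemma orthonormal_inj_on: "orthonormal I \<Phi> \<Longrightarrow> inj_on \<Phi> I"
  unfolding inj_on_def orthonormal_def by (metis zero_neq_one)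

lemma orthonormal_independent:
  assumes "finite I" "orthonormal I \<Phi>"
  shows "complex_vector.independent (\<Phi> ` I)"
proof (rule complex_vector.independent_if_scalars_zero)
  show "finite (\<Phi> ` I)" using assms by simp
  fix f x assume *: "(\<Sum>x\<in>\<Phi> ` I. f x *\<^sub>C x) = 0" "x \<in> \<Phi> ` I"
  then obtain j where j: "j \<in> I" "x = \<Phi> j" by auto
  have "(\<Sum>i\<in>I. f (\<Phi> i) *\<^sub>C \<Phi> i) = 0"
    using * by (simp add: sum.reindex[OF orthonormal_inj_on[OF assms(2)]])
  thus "f x = 0"
    using orthonormal_scaleC_sum_eq_0[OF assms, of "\<lambda>i. f (\<Phi> i)"] j by blast
qed

lemma orthonormal_card_le:
  assumes "finite I" "orthonormal I \<Phi>" "finite B" "\<Phi> ` I \<subseteq> cspan B"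
  shows "card I \<le> card B"
  using complex_vector.independent_span_bound[OF assms(3) orthonormal_independent[OF assms(1,2)] assms(4)]
  by (simp add: card_image orthonormal_inj_on[OF assms(2)])

text \<open>The second conclusion carries the support (\<open>F = 1\<close>) and the canonical
  endomorphism over to the new enumeration.\<close>

lemma orthonormal_reindex:
  assumes "finite I" "orthonormal I \<Phi>"
  obtains \<Psi> where "orthonormal_basis (cspan (\<Phi> ` I)) (card I) \<Psi>"
    "\<And>F. (\<Sum>k<card I. \<Psi> k * F * (\<Psi> k)\<^sup>\<star>) = (\<Sum>i\<in>I. \<Phi> i * F * (\<Phi> i)\<^sup>\<star>)"
proof -
  obtain h where h: "bij_betw h {..<card I} I"
    using ex_bij_betw_nat_finite[OF assms(1)] by (auto simp: atLeast0LessThan)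
  show ?thesis
  proof
    show "orthonormal_basis (cspan (\<Phi> ` I)) (card I) (\<Phi> \<circ> h)"
      unfolding orthonormal_basis_iff
    proof
      show "cspan ((\<Phi> \<circ> h) ` {..<card I}) = cspan (\<Phi> ` I)"
        using h by (metis bij_betw_imp_surj_on image_comp)
      have "h i \<in> I" if "i < card I" for i
        using h that by (auto simp: bij_betw_def)
      moreover have "h i = h j \<longleftrightarrow> i = j" if "i < card I" "j < card I" for i j
        using h that by (auto simp: bij_betw_def inj_on_def)
      ultimately show "orthonormal {..<card I} (\<Phi> \<circ> h)"
        using assms(2) by (auto simp: orthonormal_def)
    qed
    show "(\<Sum>k<card I. (\<Phi> \<circ> h) k * F * ((\<Phi> \<circ> h) k)\<^sup>\<star>) = (\<Sum>i\<in>I. \<Phi> i * F * (\<Phi> i)\<^sup>\<star>)" for F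
      using sum.reindex_bij_betw[OF h, of "\<lambda>i. \<Phi> i * F * (\<Phi> i)\<^sup>\<star>"] by simp
  qed
qed

text \<open>Support 1 is not demanded, unlike in \<open>algebraic_hilbert_space\<close>:
  eigenspaces, kernels and ranges of projections inside such spaces have to be covered.\<close>

definition hilbert_subspace :: "'a::cstar_algebra set \<Rightarrow> bool"
  where "hilbert_subspace L \<longleftrightarrow> (\<exists>n \<Phi>. orthonormal_basis L n \<Phi>)"

lemma onb_expand: "orthonormal_basis H n \<Phi> \<Longrightarrow> x \<in> H \<Longrightarrow> (\<Sum>i<n. \<Phi> i * ((\<Phi> i)\<^sup>\<star> * x)) = x"
  by (rule orthonormal_expand) (auto simp: orthonormal_basis_iff)

lemma onb_coef: "orthonormal_basis H n \<Phi> \<Longrightarrow> x \<in> H \<Longrightarrow> i < n \<Longrightarrow> (\<Phi> i)\<^sup>\<star> * x \<in> scalars"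
  by (rule orthonormal_coef[of "{..<n}"]) (auto simp: orthonormal_basis_iff)

lemma onb_mem: "orthonormal_basis H n \<Phi> \<Longrightarrow> i < n \<Longrightarrow> \<Phi> i \<in> H"
  using complex_vector.span_base[of "\<Phi> i" "\<Phi> ` {..<n}"] by (auto simp: orthonormal_basis_iff)

lemma onb_subspace: "orthonormal_basis H n \<Phi> \<Longrightarrow> csubspace H"
  by (auto simp: orthonormal_basis_iff)

lemma onb_delta:
  "orthonormal_basis H n \<Phi> \<Longrightarrow> i < n \<Longrightarrow> j < n \<Longrightarrow> (\<Phi> i)\<^sup>\<star> * \<Phi> j = (if i = j then 1 else 0)"
  by (auto simp: orthonormal_basis_def)

lemma hilbert_subspace_csubspace: "hilbert_subspace H \<Longrightarrow> csubspace H"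
  by (auto simp: hilbert_subspace_def onb_subspace)

lemma subspace_mult_scalar: "csubspace H \<Longrightarrow> x \<in> H \<Longrightarrow> c \<in> scalars \<Longrightarrow> x * c \<in> H"
  by (simp add: scalars_mult_right complex_vector.subspace_scale)

lemma subspace_sum_mult_scalar:
  assumes "csubspace H" "\<And>i. i \<in> I \<Longrightarrow> f i \<in> H" "\<And>i. i \<in> I \<Longrightarrow> c i \<in> scalars"
  shows "(\<Sum>i\<in>I. f i * c i) \<in> H"
  using assms by (blast intro: complex_vector.subspace_sum subspace_mult_scalar)

text \<open>Parseval: \<open>r\<close> is the sum of the squared moduli of the coordinates.\<close>

lemma hilbert_subspace_star_self:
  assumes "hilbert_subspace H" "x \<in> H"
  obtains r where "r \<ge> 0" "x\<^sup>\<star> * x = complex_of_real r *\<^sub>C 1"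
proof -
  obtain n \<Phi> where \<Phi>: "orthonormal_basis H n \<Phi>" using assms by (auto simp: hilbert_subspace_def)
  let ?c = "\<lambda>i. coef ((\<Phi> i)\<^sup>\<star> * x)"
  have c: "(\<Phi> i)\<^sup>\<star> * x = ?c i *\<^sub>C 1" if "i < n" for i
    using scaleC_coef[OF onb_coef[OF \<Phi> assms(2) that]] by simp
  have "x\<^sup>\<star> * x = x\<^sup>\<star> * (\<Sum>i<n. \<Phi> i * ((\<Phi> i)\<^sup>\<star> * x))"
    using onb_expand[OF \<Phi> assms(2)] by simp
  also have "\<dots> = (\<Sum>i<n. ((\<Phi> i)\<^sup>\<star> * x)\<^sup>\<star> * ((\<Phi> i)\<^sup>\<star> * x))"
    by (simp add: sum_distrib_left star_simps mult.assoc)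
  also have "\<dots> = (\<Sum>i<n. complex_of_real ((cmod (?c i))\<^sup>2) *\<^sub>C 1)"
  proof (intro sum.cong refl)
    fix i assume "i \<in> {..<n}"
    hence "((\<Phi> i)\<^sup>\<star> * x)\<^sup>\<star> * ((\<Phi> i)\<^sup>\<star> * x) = (?c i *\<^sub>C 1)\<^sup>\<star> * (?c i *\<^sub>C 1)" using c by simp
    also have "\<dots> = (?c i * cnj (?c i)) *\<^sub>C 1" by (simp add: star_simps scaleC_simps mult.commute)
    finally show "((\<Phi> i)\<^sup>\<star> * x)\<^sup>\<star> * ((\<Phi> i)\<^sup>\<star> * x) = complex_of_real ((cmod (?c i))\<^sup>2) *\<^sub>C 1"
      by (simp only: complex_norm_square)
  qed
  also have "\<dots> = complex_of_real (\<Sum>i<n. (cmod (?c i))\<^sup>2) *\<^sub>C 1"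
    by (simp only: of_real_sum complex_vector.scale_sum_left)
  finally show ?thesis by (rule that[rotated]) (simp add: sum_nonneg)
qed

lemma hilbert_subspace_inner:
  assumes "hilbert_subspace H" "x \<in> H" "y \<in> H"
  shows "x\<^sup>\<star> * y \<in> scalars"
proof -
  obtain n \<Phi> where \<Phi>: "orthonormal_basis H n \<Phi>" using assms by (auto simp: hilbert_subspace_def)
  have "x\<^sup>\<star> * y = x\<^sup>\<star> * (\<Sum>i<n. \<Phi> i * ((\<Phi> i)\<^sup>\<star> * y))"
    using onb_expand[OF \<Phi> assms(3)] by simp
  also have "\<dots> = (\<Sum>i<n. ((\<Phi> i)\<^sup>\<star> * x)\<^sup>\<star> * ((\<Phi> i)\<^sup>\<star> * y))"
    by (simp add: sum_distrib_left star_simps mult.assoc)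
  finally show ?thesis
    using onb_coef[OF \<Phi> assms(2)] onb_coef[OF \<Phi> assms(3)]
    by (metis (no_types, lifting) scalars_sum scalars_mult scalars_star lessThan_iff)
qed

lemma hilbert_subspace_normalize:
  assumes "hilbert_subspace H" "x \<in> H" "x \<noteq> 0"
  obtains c where "c \<noteq> 0" "(c *\<^sub>C x)\<^sup>\<star> * (c *\<^sub>C x) = 1"
proof -
  obtain r where r: "r \<ge> 0" "x\<^sup>\<star> * x = complex_of_real r *\<^sub>C 1"
    using hilbert_subspace_star_self[OF assms(1,2)] .
  hence "r > 0" using assms(3) star_mult_self_eq_0[of x] by (cases "r = 0") auto
  moreover have "complex_of_real (inverse (sqrt r)) * complex_of_real (inverse (sqrt r)) * complex_of_real r = 1"
    using \<open>r > 0\<close> by (simp flip: of_real_mult add: field_simps)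
  ultimately show ?thesis
    by (intro that[of "complex_of_real (inverse (sqrt r))"])
       (simp_all add: star_simps scaleC_simps r(2) mult.assoc)
qed

text \<open>One Gram-Schmidt step. The new vector can be normalized because it lies in
  \<open>H\<close>, where squares are known to be scalar.\<close>

lemma orthonormal_extend:
  assumes H: "hilbert_subspace H" and L: "csubspace L" "L \<subseteq> H"
    and \<Psi>: "orthonormal {..<m} \<Psi>" "\<Psi> ` {..<m} \<subseteq> L" "cspan (\<Psi> ` {..<m}) \<noteq> L"
  obtains \<Psi>' where "orthonormal {..<Suc m} \<Psi>'" "\<Psi>' ` {..<Suc m} \<subseteq> L"
proof -
  have "cspan (\<Psi> ` {..<m}) \<subseteq> L" using L \<Psi> complex_vector.span_minimal by blast
  then obtain v where v: "v \<in> L" "v \<notin> cspan (\<Psi> ` {..<m})" using \<Psi>(3) by blast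
  have s: "(\<Psi> i)\<^sup>\<star> * v \<in> scalars" if "i < m" for i
    using hilbert_subspace_inner[OF H] v L \<Psi>(2) that by blast
  let ?u = "\<Sum>i<m. \<Psi> i * ((\<Psi> i)\<^sup>\<star> * v)"
  have u: "?u \<in> cspan (\<Psi> ` {..<m})"
    using s by (intro subspace_sum_mult_scalar complex_vector.subspace_span)
      (simp_all add: complex_vector.span_base)
  define w where "w = v - ?u"
  have "w \<noteq> 0" using u v by (auto simp: w_def)
  have "w \<in> L"
    unfolding w_def using u v L \<open>cspan (\<Psi> ` {..<m}) \<subseteq> L\<close>
    by (intro complex_vector.subspace_diff) auto
  have orth: "(\<Psi> j)\<^sup>\<star> * w = 0" if "j < m" for j
  proof -
    have "(\<Psi> j)\<^sup>\<star> * ?u = (\<Sum>i<m. if j = i then (\<Psi> i)\<^sup>\<star> * v else 0)"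
      unfolding sum_distrib_left mult.assoc[symmetric] using that \<Psi>(1)
      by (intro sum.cong) (auto simp: orthonormalD)
    thus ?thesis using that by (simp add: w_def right_diff_distrib)
  qed
  obtain c where c: "c \<noteq> 0" "(c *\<^sub>C w)\<^sup>\<star> * (c *\<^sub>C w) = 1"
    using hilbert_subspace_normalize[OF H _ \<open>w \<noteq> 0\<close>] \<open>w \<in> L\<close> L by blast
  have orth': "(\<Psi> j)\<^sup>\<star> * (c *\<^sub>C w) = 0" "(c *\<^sub>C w)\<^sup>\<star> * \<Psi> j = 0" if "j < m" for j
  proof -
    show *: "(\<Psi> j)\<^sup>\<star> * (c *\<^sub>C w) = 0" using orth[OF that] by (simp add: scaleC_simps)
    show "(c *\<^sub>C w)\<^sup>\<star> * \<Psi> j = 0" using arg_cong[OF *, of star] by (simp add: star_mult star_star)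
  qed
  show ?thesis
  proof
    show "orthonormal {..<Suc m} (\<Psi>(m := c *\<^sub>C w))"
      using \<Psi>(1) c orth' by (auto simp: orthonormal_def less_Suc_eq)
    show "(\<Psi>(m := c *\<^sub>C w)) ` {..<Suc m} \<subseteq> L"
      using \<Psi>(2) \<open>w \<in> L\<close> L by (auto simp: less_Suc_eq complex_vector.subspace_scale)
  qed
qed

lemma onb_card_le:
  assumes "orthonormal_basis H n \<Phi>" "orthonormal {..<m} \<Psi>" "\<Psi> ` {..<m} \<subseteq> H"
  shows "m \<le> n"
proof -
  have "card {..<m} \<le> card (\<Phi> ` {..<n})"
    using assms by (intro orthonormal_card_le[OF _ assms(2)]) (auto simp: orthonormal_basis_iff)
  also have "\<dots> \<le> card {..<n}" by (rule card_image_le) simp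
  finally show ?thesis by simp
qed

text \<open>A longest orthonormal family in \<open>L\<close> spans \<open>L\<close>, since otherwise
  it could be extended. If \<open>L\<close> is proper, the family can still be extended within
  \<open>H\<close>, which gives the strict bound that drives the later inductions on
  dimension.\<close>

lemma onb_subspace_exists:
  assumes \<Phi>: "orthonormal_basis H n \<Phi>" and L: "csubspace L" "L \<subseteq> H"
  obtains m \<Psi> where "orthonormal_basis L m \<Psi>" "m \<le> n" "L \<noteq> H \<Longrightarrow> m < n"
proof -
  have H: "hilbert_subspace H" using \<Phi> by (auto simp: hilbert_subspace_def)
  let ?P = "\<lambda>m::nat. \<exists>\<Psi>. orthonormal {..<m} \<Psi> \<and> \<Psi> ` {..<m} \<subseteq> L"
  have bd: "m \<le> n" if "?P m" for m
    using that onb_card_le[OF \<Phi>] L by blast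
  have P0: "?P 0" by (simp add: orthonormal_def)
  define m where "m = Greatest ?P"
  have m: "?P m" "\<And>k. ?P k \<Longrightarrow> k \<le> m"
    unfolding m_def using GreatestI_nat[where P = ?P, OF P0 bd]
      Greatest_le_nat[where P = ?P, OF _ bd] by simp_all
  then obtain \<Psi> where \<Psi>: "orthonormal {..<m} \<Psi>" "\<Psi> ` {..<m} \<subseteq> L" by blast
  have "cspan (\<Psi> ` {..<m}) = L"
  proof (rule ccontr)
    assume "cspan (\<Psi> ` {..<m}) \<noteq> L"
    from orthonormal_extend[OF H L \<Psi> this] have "?P (Suc m)" by metis
    with m(2) show False by fastforce
  qed
  hence onb: "orthonormal_basis L m \<Psi>" using \<Psi> by (simp add: orthonormal_basis_iff)
  moreover have "m < n" if "L \<noteq> H"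
  proof -
    have "orthonormal {..<m} \<Psi>" "\<Psi> ` {..<m} \<subseteq> H" "cspan (\<Psi> ` {..<m}) \<noteq> H"
      using \<Psi> L that \<open>cspan (\<Psi> ` {..<m}) = L\<close> by auto
    from orthonormal_extend[OF H onb_subspace[OF \<Phi>] order_refl this]
    obtain \<Psi>' where "orthonormal {..<Suc m} \<Psi>'" "\<Psi>' ` {..<Suc m} \<subseteq> H" .
    from onb_card_le[OF \<Phi> this] show ?thesis by simp
  qed
  ultimately show ?thesis using that bd m(1) by blast
qed

lemma hilbert_subspace_subset:
  "hilbert_subspace H \<Longrightarrow> csubspace L \<Longrightarrow> L \<subseteq> H \<Longrightarrow> hilbert_subspace L"
  unfolding hilbert_subspace_def by (metis onb_subspace_exists)

text \<open>The coefficients of the change of basis are scalars, so they slide past \<open>F\<close>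
  and recombine to the other basis. Hence support and canonical endomorphism depend on the space
  alone.\<close>

lemma onb_sum_unique:
  assumes "orthonormal_basis H n \<Phi>" "orthonormal_basis H m \<Psi>"
  shows "(\<Sum>j<n. \<Phi> j * F * (\<Phi> j)\<^sup>\<star>) = (\<Sum>j<m. \<Psi> j * F * (\<Psi> j)\<^sup>\<star>)"
proof -
  have s: "(\<Psi> k)\<^sup>\<star> * \<Phi> j \<in> scalars" if "j < n" "k < m" for j k
    using onb_coef[OF assms(2) onb_mem[OF assms(1)]] that .
  have "(\<Sum>j<n. \<Phi> j * F * (\<Phi> j)\<^sup>\<star>) = (\<Sum>j<n. (\<Sum>k<m. \<Psi> k * ((\<Psi> k)\<^sup>\<star> * \<Phi> j)) * F * (\<Phi> j)\<^sup>\<star>)"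
    using onb_expand[OF assms(2) onb_mem[OF assms(1)]] by simp
  also have "\<dots> = (\<Sum>j<n. \<Sum>k<m. \<Psi> k * F * (\<Phi> j * ((\<Phi> j)\<^sup>\<star> * \<Psi> k))\<^sup>\<star>)"
    unfolding sum_distrib_right
  proof (intro sum.cong refl)
    fix j k assume "j \<in> {..<n}" "k \<in> {..<m}"
    hence "((\<Psi> k)\<^sup>\<star> * \<Phi> j) * F = F * ((\<Psi> k)\<^sup>\<star> * \<Phi> j)"
      using s by (intro scalars_commute) auto
    thus "\<Psi> k * ((\<Psi> k)\<^sup>\<star> * \<Phi> j) * F * (\<Phi> j)\<^sup>\<star> = \<Psi> k * F * (\<Phi> j * ((\<Phi> j)\<^sup>\<star> * \<Psi> k))\<^sup>\<star>"
      by (simp add: star_simps) (metis mult.assoc)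
  qed
  also have "\<dots> = (\<Sum>k<m. \<Psi> k * F * (\<Sum>j<n. \<Phi> j * ((\<Phi> j)\<^sup>\<star> * \<Psi> k))\<^sup>\<star>)"
    unfolding star_sum sum_distrib_left by (rule sum.swap)
  also have "\<dots> = (\<Sum>k<m. \<Psi> k * F * (\<Psi> k)\<^sup>\<star>)"
    using onb_expand[OF assms(1) onb_mem[OF assms(2)]] by simp
  finally show ?thesis .
qed

section \<open>Supports as orthogonal projections\<close>

lemma has_support_onb:
  assumes "has_support H P" "orthonormal_basis H n \<Phi>"
  shows "P = (\<Sum>j<n. \<Phi> j * (\<Phi> j)\<^sup>\<star>)"
  using assms(1) onb_sum_unique[OF _ assms(2), of _ _ 1] by (auto simp: has_support_def)

lemma has_support_exists: "hilbert_subspace L \<Longrightarrow> \<exists>P. has_support L P"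
  by (auto simp: hilbert_subspace_def has_support_def)

lemma has_support_hilbert_subspace: "has_support L P \<Longrightarrow> hilbert_subspace L"
  by (auto simp: hilbert_subspace_def has_support_def)

lemma has_support_star: "has_support L P \<Longrightarrow> P\<^sup>\<star> = P"
  by (auto simp: has_support_def star_simps)

lemma has_support_fix:
  assumes "has_support L P" "x \<in> L"
  shows "P * x = x"
  using assms onb_expand by (fastforce simp: has_support_def sum_distrib_right mult.assoc)

lemma has_support_range:
  assumes "has_support L P" "hilbert_subspace H" "L \<subseteq> H" "x \<in> H"
  shows "P * x \<in> L"
proof -
  obtain n \<Phi> where \<Phi>: "orthonormal_basis L n \<Phi>" "P = (\<Sum>j<n. \<Phi> j * (\<Phi> j)\<^sup>\<star>)"
    using assms(1) by (auto simp: has_support_def)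
  have "P * x = (\<Sum>j<n. \<Phi> j * ((\<Phi> j)\<^sup>\<star> * x))" by (simp add: \<Phi>(2) sum_distrib_right mult.assoc)
  also have "\<dots> \<in> L"
    using assms \<Phi>(1) onb_mem[OF \<Phi>(1)]
    by (intro subspace_sum_mult_scalar onb_subspace[OF \<Phi>(1)]
        hilbert_subspace_inner[OF assms(2)]) auto
  finally show ?thesis .
qed

text \<open>\<open>P\<close> is a sum of products whose left factors lie in \<open>L\<close>. This
  turns statements about vectors into equations in the algebra.\<close>

lemma has_support_mult_cong:
  assumes "has_support L P" "\<And>x. x \<in> L \<Longrightarrow> Y * x = Z * x"
  shows "Y * P = Z * P"
proof -
  obtain n \<Phi> where \<Phi>: "orthonormal_basis L n \<Phi>" "P = (\<Sum>j<n. \<Phi> j * (\<Phi> j)\<^sup>\<star>)"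
    using assms(1) by (auto simp: has_support_def)
  show ?thesis
    unfolding \<Phi>(2) sum_distrib_left mult.assoc[symmetric] using assms(2) onb_mem[OF \<Phi>(1)] by simp
qed

lemma has_support_idem: "has_support L P \<Longrightarrow> P * P = P"
  using has_support_mult_cong[of L P P 1] has_support_fix[of L P] by simp

lemma algebraic_hilbert_space_iff: "algebraic_hilbert_space H \<longleftrightarrow> has_support H 1"
proof
  assume *: "has_support H 1"
  then obtain n \<Phi> where \<Phi>: "orthonormal_basis H n \<Phi>" by (auto simp: has_support_def)
  hence "hilbert_subspace H" by (auto simp: hilbert_subspace_def)
  thus "algebraic_hilbert_space H"
    unfolding algebraic_hilbert_space_def
    using * \<Phi> onb_subspace[OF \<Phi>] hilbert_subspace_inner[of H]
    by (auto simp: scalars_iff orthonormal_basis_iff intro!: exI[of _ "\<Phi> ` {..<n}"])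
qed (simp add: algebraic_hilbert_space_def)

lemma onb_support_one: "has_support H 1 \<Longrightarrow> orthonormal_basis H n \<Phi> \<Longrightarrow> (\<Sum>j<n. \<Phi> j * (\<Phi> j)\<^sup>\<star>) = 1"
  using has_support_onb by metis

lemma support_one_cong: "has_support H 1 \<Longrightarrow> (\<And>x. x \<in> H \<Longrightarrow> Y * x = Z * x) \<Longrightarrow> Y = Z"
  using has_support_mult_cong[of H 1 Y Z] by simp

text \<open>Support 1 writes \<open>y\<close> as the sum of the
  \<open>\<Phi> j * ((\<Phi> j)\<^sup>\<star> * y)\<close>, a combination of basis vectors with
  scalar coefficients.\<close>

lemma support_one_memI:
  assumes "has_support H 1" "\<And>x. x \<in> H \<Longrightarrow> x\<^sup>\<star> * y \<in> scalars"
  shows "y \<in> H"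
proof -
  obtain n \<Phi> where \<Phi>: "orthonormal_basis H n \<Phi>" "1 = (\<Sum>j<n. \<Phi> j * (\<Phi> j)\<^sup>\<star>)"
    using assms(1) by (auto simp: has_support_def)
  have "y = (\<Sum>j<n. \<Phi> j * (\<Phi> j)\<^sup>\<star>) * y" using \<Phi>(2) by simp
  also have "\<dots> = (\<Sum>j<n. \<Phi> j * ((\<Phi> j)\<^sup>\<star> * y))" by (simp add: sum_distrib_right mult.assoc)
  also have "\<dots> \<in> H"
    using assms(2) onb_mem[OF \<Phi>(1)]
    by (intro subspace_sum_mult_scalar onb_subspace[OF \<Phi>(1)]) auto
  finally show ?thesis .
qed

section \<open>Products of Hilbert subspaces\<close>

lemma hs_product_mult: "x \<in> H \<Longrightarrow> y \<in> K \<Longrightarrow> x * y \<in> hs_product H K"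
  unfolding hs_product_def by (rule complex_vector.span_base) auto

lemma hs_product_minimal:
  assumes "csubspace S" "\<And>x y. x \<in> H \<Longrightarrow> y \<in> K \<Longrightarrow> x * y \<in> S"
  shows "hs_product H K \<subseteq> S"
  unfolding hs_product_def by (rule complex_vector.span_minimal) (use assms in auto)

lemma csubspace_vimage_mult: "csubspace S \<Longrightarrow> csubspace {x. a * x * b \<in> S}"
  by (auto simp: complex_vector.subspace_def distrib_left distrib_right scaleC_simps)

lemma span_mult_mem:
  assumes "csubspace S" "\<And>x. x \<in> B \<Longrightarrow> a * x * b \<in> S" "y \<in> cspan B"
  shows "a * y * b \<in> S"
  using complex_vector.span_minimal[of B "{x. a * x * b \<in> S}"] assms csubspace_vimage_mult by blast

text \<open>The basis consists of the \<open>\<Phi> i * \<Psi> j\<close>. The formula for the sums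
  is the reason why products of Hilbert spaces correspond to compositions of endomorphisms.\<close>

lemma hs_product_onb:
  assumes \<Phi>: "orthonormal_basis H n \<Phi>" and \<Psi>: "orthonormal_basis K m \<Psi>"
  obtains \<xi> where "orthonormal_basis (hs_product H K) (n * m) \<xi>"
    "\<And>F. (\<Sum>k<n*m. \<xi> k * F * (\<xi> k)\<^sup>\<star>) = (\<Sum>i<n. \<Phi> i * (\<Sum>j<m. \<Psi> j * F * (\<Psi> j)\<^sup>\<star>) * (\<Phi> i)\<^sup>\<star>)"
proof -
  let ?I = "{..<n} \<times> {..<m}" and ?\<xi> = "\<lambda>(i, j). \<Phi> i * \<Psi> j"
  have on: "orthonormal ?I ?\<xi>"
  proof (unfold orthonormal_def, safe)
    fix i j k l assume *: "i < n" "j < m" "k < n" "l < m"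
    have "(\<Phi> i * \<Psi> j)\<^sup>\<star> * (\<Phi> k * \<Psi> l) = (\<Psi> j)\<^sup>\<star> * ((\<Phi> i)\<^sup>\<star> * \<Phi> k) * \<Psi> l"
      by (simp add: star_simps mult.assoc)
    thus "(\<Phi> i * \<Psi> j)\<^sup>\<star> * (\<Phi> k * \<Psi> l) = (if (i, j) = (k, l) then 1 else 0)"
      using onb_delta[OF \<Phi>, of i k] onb_delta[OF \<Psi>, of j l] * by auto
  qed
  have span: "cspan (?\<xi> ` ?I) = hs_product H K"
  proof (rule antisym)
    show "cspan (?\<xi> ` ?I) \<subseteq> hs_product H K"
      unfolding hs_product_def using onb_mem[OF \<Phi>] onb_mem[OF \<Psi>]
      by (intro complex_vector.span_mono) auto
    show "hs_product H K \<subseteq> cspan (?\<xi> ` ?I)" (is "_ \<subseteq> ?S")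
    proof (rule hs_product_minimal)
      fix x y assume xy: "x \<in> H" "y \<in> K"
      have basis: "\<Phi> i * \<Psi> j * 1 \<in> ?S" if "i < n" "j < m" for i j
        unfolding mult_1_right by (rule complex_vector.span_base) (use that in force)
      have left: "\<Phi> i * y * 1 \<in> ?S" if "i < n" for i
        by (rule span_mult_mem[of _ "\<Psi> ` {..<m}"])
           (use that \<Psi> xy basis in \<open>auto simp: orthonormal_basis_iff\<close>)
      have "1 * x * y \<in> ?S"
        by (rule span_mult_mem[of _ "\<Phi> ` {..<n}"])
           (use \<Phi> xy left in \<open>auto simp: orthonormal_basis_iff\<close>)
      thus "x * y \<in> ?S" by simp
    qed simp
  qed
  obtain \<xi> where \<xi>: "orthonormal_basis (cspan (?\<xi> ` ?I)) (card ?I) \<xi>"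
    "\<And>F. (\<Sum>k<card ?I. \<xi> k * F * (\<xi> k)\<^sup>\<star>) = (\<Sum>i\<in>?I. ?\<xi> i * F * (?\<xi> i)\<^sup>\<star>)"
    using orthonormal_reindex[OF finite_cartesian_product[OF finite_lessThan finite_lessThan] on]
    by blast
  show ?thesis
  proof
    show "orthonormal_basis (hs_product H K) (n * m) \<xi>"
      using \<xi>(1) by (simp add: span)
    show "(\<Sum>k<n*m. \<xi> k * F * (\<xi> k)\<^sup>\<star>)
        = (\<Sum>i<n. \<Phi> i * (\<Sum>j<m. \<Psi> j * F * (\<Psi> j)\<^sup>\<star>) * (\<Phi> i)\<^sup>\<star>)" for F
      using \<xi>(2)[of F]
      by (simp add: sum.cartesian_product sum_distrib_left sum_distrib_right star_mult mult.assoc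
          case_prod_unfold)
  qed
qed

section \<open>Group actions by automorphisms\<close>

locale star_action =
  fixes G :: "('g, 'b) monoid_scheme" and \<alpha> :: "'g \<Rightarrow> 'f::cstar_algebra \<Rightarrow> 'f"
  assumes group: "Group.group G"
    and automorphism: "g \<in> carrier G \<Longrightarrow> star_automorphism (\<alpha> g)"
    and act_hom: "g \<in> carrier G \<Longrightarrow> h \<in> carrier G \<Longrightarrow> \<alpha> (g \<otimes>\<^bsub>G\<^esub> h) = \<alpha> g \<circ> \<alpha> h"
begin

abbreviation \<A> :: "'f set" where "\<A> \<equiv> fixed_algebra G \<alpha>"

lemma fixedD: "A \<in> \<A> \<Longrightarrow> g \<in> carrier G \<Longrightarrow> \<alpha> g A = A"
  by (simp add: fixed_algebra_def)

lemma fixedI: "(\<And>g. g \<in> carrier G \<Longrightarrow> \<alpha> g A = A) \<Longrightarrow> A \<in> \<A>"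
  by (simp add: fixed_algebra_def)

context
  fixes g assumes g: "g \<in> carrier G"
begin

lemma act_add: "\<alpha> g (x + y) = \<alpha> g x + \<alpha> g y"
  and act_scaleC: "\<alpha> g (c *\<^sub>C x) = c *\<^sub>C \<alpha> g x"
  and act_mult: "\<alpha> g (x * y) = \<alpha> g x * \<alpha> g y"
  and act_star: "\<alpha> g (x\<^sup>\<star>) = (\<alpha> g x)\<^sup>\<star>"
  using automorphism[OF g] by (auto simp: star_automorphism_def)

lemma act_bij: "bij (\<alpha> g)"
  using automorphism[OF g] by (auto simp: star_automorphism_def)

lemma act_zero: "\<alpha> g 0 = 0"
  using act_add[of 0 0] by simp

lemma act_sum: "\<alpha> g (sum f I) = (\<Sum>i\<in>I. \<alpha> g (f i))"
  by (induction I rule: infinite_finite_induct) (auto simp: act_zero act_add)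

lemma act_one: "\<alpha> g 1 = 1"
proof -
  obtain x where "\<alpha> g x = 1" using act_bij by (metis bij_pointE)
  thus ?thesis using act_mult[of x 1] by simp
qed

lemma act_scalar: "x \<in> scalars \<Longrightarrow> \<alpha> g x = x"
  by (auto simp: scalars_iff act_scaleC act_one)

lemma act_inverse: "\<alpha> g (\<alpha> (inv\<^bsub>G\<^esub> g) x) = x"
proof -
  interpret Group.group G by (rule group)
  \<comment> \<open>The unit element acts by an idempotent injective map, hence as the
    identity.\<close>
  have "\<alpha> \<one>\<^bsub>G\<^esub> (\<alpha> \<one>\<^bsub>G\<^esub> x) = \<alpha> \<one>\<^bsub>G\<^esub> x"
    using act_hom[of "\<one>\<^bsub>G\<^esub>" "\<one>\<^bsub>G\<^esub>"] by (simp add: fun_eq_iff)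
  hence "\<alpha> \<one>\<^bsub>G\<^esub> x = x"
    using automorphism[of "\<one>\<^bsub>G\<^esub>"] by (auto simp: star_automorphism_def bij_def inj_def)
  thus ?thesis using act_hom[of g "inv\<^bsub>G\<^esub> g"] g by (simp add: fun_eq_iff)
qed

lemma act_span: "\<alpha> g ` cspan S = cspan (\<alpha> g ` S)"
proof (rule antisym)
  have "csubspace (\<alpha> g -` cspan (\<alpha> g ` S))"
    unfolding complex_vector.subspace_def
    by (auto simp: act_zero act_add act_scaleC complex_vector.span_zero complex_vector.span_add complex_vector.span_scale)
  moreover have "S \<subseteq> \<alpha> g -` cspan (\<alpha> g ` S)" by (auto intro: complex_vector.span_base)
  ultimately show "\<alpha> g ` cspan S \<subseteq> cspan (\<alpha> g ` S)"
    using complex_vector.span_minimal[of S "\<alpha> g -` cspan (\<alpha> g ` S)"] by blast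
  have "csubspace (\<alpha> g ` cspan S)"
    unfolding complex_vector.subspace_def
  proof (safe)
    show "0 \<in> \<alpha> g ` cspan S" using act_zero complex_vector.span_zero by (metis imageI)
  next
    fix x y assume "x \<in> cspan S" "y \<in> cspan S"
    thus "\<alpha> g x + \<alpha> g y \<in> \<alpha> g ` cspan S" using act_add complex_vector.span_add by (metis imageI)
  next
    fix c x assume "x \<in> cspan S"
    thus "c *\<^sub>C \<alpha> g x \<in> \<alpha> g ` cspan S" using act_scaleC complex_vector.span_scale by (metis imageI)
  qed
  thus "cspan (\<alpha> g ` S) \<subseteq> \<alpha> g ` cspan S"
    by (rule complex_vector.span_minimal[rotated]) (auto intro: complex_vector.span_base)
qed

end

lemmas act_simps = act_add act_scaleC act_mult act_star act_zero act_sum act_one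

lemma fixed_add: "A \<in> \<A> \<Longrightarrow> B \<in> \<A> \<Longrightarrow> A + B \<in> \<A>"
  and fixed_scaleC: "A \<in> \<A> \<Longrightarrow> c *\<^sub>C A \<in> \<A>"
  and fixed_mult: "A \<in> \<A> \<Longrightarrow> B \<in> \<A> \<Longrightarrow> A * B \<in> \<A>"
  and fixed_star: "A \<in> \<A> \<Longrightarrow> A\<^sup>\<star> \<in> \<A>"
  and fixed_zero: "0 \<in> \<A>"
  and fixed_one: "1 \<in> \<A>"
  by (auto intro!: fixedI simp: act_simps fixedD)

lemma fixed_sum: "(\<And>i. i \<in> I \<Longrightarrow> f i \<in> \<A>) \<Longrightarrow> sum f I \<in> \<A>"
  by (auto intro!: fixedI simp: act_simps fixedD)

lemma fixed_scalars: "x \<in> scalars \<Longrightarrow> x \<in> \<A>"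
  by (auto simp: scalars_iff fixed_one fixed_scaleC)

lemma csubspace_fixed: "csubspace \<A>"
  by (simp add: complex_vector.subspace_def fixed_zero fixed_add fixed_scaleC)

definition invariant :: "'f set \<Rightarrow> bool"
  where "invariant L \<longleftrightarrow> (\<forall>g\<in>carrier G. \<alpha> g ` L \<subseteq> L)"

lemma invariantD: "invariant L \<Longrightarrow> g \<in> carrier G \<Longrightarrow> x \<in> L \<Longrightarrow> \<alpha> g x \<in> L"
  by (auto simp: invariant_def)

lemma invariant_image: "invariant L \<Longrightarrow> g \<in> carrier G \<Longrightarrow> \<alpha> g ` L = L"
proof (intro antisym subsetI)
  fix x assume *: "invariant L" "g \<in> carrier G" "x \<in> L"
  have "\<alpha> (inv\<^bsub>G\<^esub> g) x \<in> L"
    using * invariantD group.inv_closed[OF group] by blast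
  thus "x \<in> \<alpha> g ` L" using act_inverse[OF *(2), of x] by (metis imageI)
qed (auto dest: invariantD)

lemma invariant_onb:
  assumes "invariant L" "g \<in> carrier G" "orthonormal_basis L n \<Phi>"
  shows "orthonormal_basis L n (\<lambda>i. \<alpha> g (\<Phi> i))"
proof -
  have "cspan ((\<lambda>i. \<alpha> g (\<Phi> i)) ` {..<n}) = \<alpha> g ` L"
    using assms(3) act_span[OF assms(2), of "\<Phi> ` {..<n}"]
    by (simp add: image_image orthonormal_basis_iff)
  moreover have "(\<alpha> g (\<Phi> i))\<^sup>\<star> * \<alpha> g (\<Phi> j) = (if i = j then 1 else 0)" if "i < n" "j < n" for i j
    using arg_cong[OF onb_delta[OF assms(3) that], of "\<alpha> g"] assms(2)
    by (simp add: act_simps split: if_splits)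
  ultimately show ?thesis
    using invariant_image[OF assms(1,2)] by (simp add: orthonormal_basis_def)
qed

text \<open>\<open>\<alpha> g\<close> turns the basis into another basis of \<open>L\<close>, and
  the sum does not depend on the basis.\<close>

lemma invariant_onb_sum_fixed:
  assumes "invariant L" "orthonormal_basis L n \<Phi>" "A \<in> \<A>"
  shows "(\<Sum>j<n. \<Phi> j * A * (\<Phi> j)\<^sup>\<star>) \<in> \<A>"
proof (rule fixedI)
  fix g assume g: "g \<in> carrier G"
  show "\<alpha> g (\<Sum>j<n. \<Phi> j * A * (\<Phi> j)\<^sup>\<star>) = (\<Sum>j<n. \<Phi> j * A * (\<Phi> j)\<^sup>\<star>)"
    using onb_sum_unique[OF invariant_onb[OF assms(1) g assms(2)] assms(2), of A] g
    by (simp add: act_simps fixedD[OF assms(3)])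
qed

lemma has_support_fixed: "invariant L \<Longrightarrow> has_support L P \<Longrightarrow> P \<in> \<A>"
  using invariant_onb_sum_fixed[OF _ _ fixed_one] by (auto simp: has_support_def)

section \<open>Canonical endomorphisms and their Hilbert spaces\<close>

definition canonical :: "'f set \<Rightarrow> ('f \<Rightarrow> 'f) \<Rightarrow> bool"
  where "canonical H \<sigma> \<longleftrightarrow> invariant_hilbert_space G \<alpha> H \<and> canonical_endo_of \<A> H \<sigma>"

lemma invariant_hilbert_space_iff:
  "invariant_hilbert_space G \<alpha> H \<longleftrightarrow> has_support H 1 \<and> invariant H"
  by (simp add: invariant_hilbert_space_def algebraic_hilbert_space_iff invariant_def)

lemma canonical_endos_iff: "\<sigma> \<in> canonical_endos G \<alpha> \<longleftrightarrow> (\<exists>H. canonical H \<sigma>)"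
  by (simp add: canonical_endos_def canonical_def)

lemma canonical_exists: "has_support H 1 \<Longrightarrow> invariant H \<Longrightarrow> \<exists>\<sigma>. canonical H \<sigma>"
  by (auto simp: canonical_def invariant_hilbert_space_iff canonical_endo_of_def has_support_def)

context
  fixes H \<sigma> assumes canonical: "canonical H \<sigma>"
begin

lemma canonical_support: "has_support H 1"
  and canonical_invariant: "invariant H"
  and canonical_hilbert_subspace: "hilbert_subspace H"
  and canonical_csubspace: "csubspace H"
  using canonical
  by (auto simp: canonical_def invariant_hilbert_space_iff has_support_hilbert_subspace
      hilbert_subspace_csubspace)

lemma canonical_eq:
  assumes "orthonormal_basis H n \<Phi>" "A \<in> \<A>"
  shows "\<sigma> A = (\<Sum>j<n. \<Phi> j * A * (\<Phi> j)\<^sup>\<star>)"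
  using canonical onb_sum_unique[OF _ assms(1)] assms(2)
  by (auto simp: canonical_def canonical_endo_of_def)

text \<open>The scalar coordinates of \<open>x\<close> commute with \<open>A\<close>. Since the
  vectors of \<open>H\<close> separate, this relation determines \<open>\<sigma> A\<close>; most
  later arguments use it in place of the sum over a basis.\<close>

lemma canonical_mult:
  assumes "A \<in> \<A>" "x \<in> H"
  shows "\<sigma> A * x = x * A"
proof -
  obtain n \<Phi> where \<Phi>: "orthonormal_basis H n \<Phi>"
    using canonical_support by (auto simp: has_support_def)
  have "\<sigma> A * x = (\<Sum>j<n. \<Phi> j * (A * ((\<Phi> j)\<^sup>\<star> * x)))"
    by (simp add: canonical_eq[OF \<Phi> assms(1)] sum_distrib_right mult.assoc)
  also have "\<dots> = (\<Sum>j<n. \<Phi> j * ((\<Phi> j)\<^sup>\<star> * x)) * A"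
    unfolding sum_distrib_right mult.assoc
  proof (intro sum.cong refl)
    fix j assume "j \<in> {..<n}"
    hence "(\<Phi> j)\<^sup>\<star> * x * A = A * ((\<Phi> j)\<^sup>\<star> * x)"
      using onb_coef[OF \<Phi> assms(2)] scalars_commute by blast
    thus "\<Phi> j * (A * ((\<Phi> j)\<^sup>\<star> * x)) = \<Phi> j * ((\<Phi> j)\<^sup>\<star> * (x * A))"
      by (simp add: mult.assoc)
  qed
  finally show ?thesis using onb_expand[OF \<Phi> assms(2)] by simp
qed

lemma canonical_ext: "(\<And>x. x \<in> H \<Longrightarrow> Y * x = Z * x) \<Longrightarrow> Y = Z"
  by (rule support_one_cong[OF canonical_support])

lemma canonical_unique: "A \<in> \<A> \<Longrightarrow> (\<And>x. x \<in> H \<Longrightarrow> Y * x = x * A) \<Longrightarrow> Y = \<sigma> A"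
  by (rule canonical_ext) (simp add: canonical_mult)

lemma canonical_fixed: "A \<in> \<A> \<Longrightarrow> \<sigma> A \<in> \<A>"
proof -
  assume A: "A \<in> \<A>"
  obtain n \<Phi> where \<Phi>: "orthonormal_basis H n \<Phi>"
    using canonical_support by (auto simp: has_support_def)
  show ?thesis
    using invariant_onb_sum_fixed[OF canonical_invariant \<Phi> A] by (simp add: canonical_eq[OF \<Phi> A])
qed

lemma canonical_one: "\<sigma> 1 = 1"
  using canonical_unique[OF fixed_one, of 1] by simp

lemma canonical_add: "A \<in> \<A> \<Longrightarrow> B \<in> \<A> \<Longrightarrow> \<sigma> (A + B) = \<sigma> A + \<sigma> B"
  by (rule canonical_unique[symmetric])
     (simp_all add: fixed_add distrib_left distrib_right canonical_mult)

lemma canonical_times: "A \<in> \<A> \<Longrightarrow> B \<in> \<A> \<Longrightarrow> \<sigma> (A * B) = \<sigma> A * \<sigma> B"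
  by (rule canonical_unique[symmetric])
     (simp_all add: fixed_mult mult.assoc canonical_mult, simp add: canonical_mult flip: mult.assoc)

lemma canonical_scaleC: "A \<in> \<A> \<Longrightarrow> \<sigma> (c *\<^sub>C A) = c *\<^sub>C \<sigma> A"
  by (rule canonical_unique[symmetric]) (simp_all add: fixed_scaleC scaleC_simps canonical_mult)

lemma canonical_star: "A \<in> \<A> \<Longrightarrow> \<sigma> (A\<^sup>\<star>) = (\<sigma> A)\<^sup>\<star>"
proof -
  assume A: "A \<in> \<A>"
  obtain n \<Phi> where \<Phi>: "orthonormal_basis H n \<Phi>"
    using canonical_support by (auto simp: has_support_def)
  show ?thesis
    by (simp add: canonical_eq[OF \<Phi> A] canonical_eq[OF \<Phi> fixed_star[OF A]] star_simps mult.assoc)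
qed

lemma canonical_star_mult:
  assumes "A \<in> \<A>" "x \<in> H"
  shows "x\<^sup>\<star> * \<sigma> A = A * x\<^sup>\<star>"
  using arg_cong[OF canonical_mult[OF fixed_star[OF assms(1)] assms(2)], of star] assms(1)
  by (simp add: canonical_star star_simps)

lemma canonical_star_endomorphism: "star_endomorphism \<A> \<sigma>"
proof -
  have "\<sigma> \<in> extensional \<A>"
    using canonical by (auto simp: canonical_def canonical_endo_of_def)
  thus ?thesis
    unfolding star_endomorphism_def
    using canonical_fixed canonical_one canonical_add canonical_times canonical_scaleC canonical_star
    by auto
qed

end

lemma canonical_product:
  assumes "canonical H \<sigma>" "canonical K \<tau>"
  shows "canonical (hs_product H K) (compose \<A> \<sigma> \<tau>)"
proof -
  obtain n \<Phi> where \<Phi>: "orthonormal_basis H n \<Phi>"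
    using canonical_support[OF assms(1)] by (auto simp: has_support_def)
  obtain m \<Psi> where \<Psi>: "orthonormal_basis K m \<Psi>"
    using canonical_support[OF assms(2)] by (auto simp: has_support_def)
  obtain \<xi> where \<xi>: "orthonormal_basis (hs_product H K) (n * m) \<xi>"
    "\<And>F. (\<Sum>k<n*m. \<xi> k * F * (\<xi> k)\<^sup>\<star>) = (\<Sum>i<n. \<Phi> i * (\<Sum>j<m. \<Psi> j * F * (\<Psi> j)\<^sup>\<star>) * (\<Phi> i)\<^sup>\<star>)"
    using hs_product_onb[OF \<Phi> \<Psi>] by blast
  have "(\<Sum>k<n*m. \<xi> k * (\<xi> k)\<^sup>\<star>) = 1"
    using \<xi>(2)[of 1] onb_support_one[OF canonical_support[OF assms(1)] \<Phi>]
      onb_support_one[OF canonical_support[OF assms(2)] \<Psi>] by simp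
  hence "has_support (hs_product H K) 1" using \<xi>(1) by (auto simp: has_support_def)
  moreover have "invariant (hs_product H K)"
    unfolding invariant_def
  proof safe
    fix g x assume g: "g \<in> carrier G" and x: "x \<in> hs_product H K"
    have "csubspace (\<alpha> g -` hs_product H K)"
      using onb_subspace[OF \<xi>(1)] g by (auto simp: complex_vector.subspace_def act_simps)
    hence "hs_product H K \<subseteq> \<alpha> g -` hs_product H K"
      by (rule hs_product_minimal)
         (use assms g in \<open>auto simp: act_simps intro!: hs_product_mult dest: canonical_invariant invariantD\<close>)
    thus "\<alpha> g x \<in> hs_product H K" using x by auto
  qed
  moreover have "compose \<A> \<sigma> \<tau> = (\<lambda>F\<in>\<A>. \<Sum>k<n*m. \<xi> k * F * (\<xi> k)\<^sup>\<star>)"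
    unfolding compose_def
  proof (rule restrict_ext)
    fix F assume F: "F \<in> \<A>"
    show "\<sigma> (\<tau> F) = (\<Sum>k<n*m. \<xi> k * F * (\<xi> k)\<^sup>\<star>)"
      unfolding \<xi>(2) canonical_eq[OF assms(2) \<Psi> F, symmetric]
      by (rule canonical_eq[OF assms(1) \<Phi> canonical_fixed[OF assms(2) F]])
  qed
  ultimately show ?thesis
    using \<xi>(1) by (auto simp: canonical_def invariant_hilbert_space_iff canonical_endo_of_def)
qed

lemma scalars_onb: "orthonormal_basis (scalars :: 'f set) 1 (\<lambda>_. 1)"
proof -
  have "(\<lambda>_. 1) ` {..<1::nat} = {1::'f}" by auto
  thus ?thesis by (simp add: orthonormal_basis_def scalars_def complex_vector.span_singleton)
qed

lemma canonical_scalars: "canonical scalars (restrict id \<A>)"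
proof -
  have "has_support (scalars :: 'f set) 1"
    unfolding has_support_def using scalars_onb by (intro exI[of _ 1] exI[of _ "\<lambda>_. 1"]) simp
  moreover have "canonical_endo_of \<A> scalars (restrict id \<A>)"
    unfolding canonical_endo_of_def using scalars_onb
    by (intro exI[of _ 1] exI[of _ "\<lambda>_. 1"]) (auto intro: restrict_ext)
  ultimately show ?thesis
    by (auto simp: canonical_def invariant_hilbert_space_iff invariant_def act_scalar)
qed

text \<open>For invariant \<open>H\<close> and \<open>K\<close> of support 1, left multiplication
  identifies these elements with the \<open>G\<close>-equivariant linear maps from \<open>H\<close>
  to \<open>K\<close>. They become the arrows of the subcategory.\<close>

definition hs_hom :: "'f set \<Rightarrow> 'f set \<Rightarrow> 'f set"
  where "hs_hom H K = {X \<in> \<A>. \<forall>x\<in>H. X * x \<in> K}"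

lemma hs_homI: "X \<in> \<A> \<Longrightarrow> (\<And>x. x \<in> H \<Longrightarrow> X * x \<in> K) \<Longrightarrow> X \<in> hs_hom H K"
  by (simp add: hs_hom_def)

lemma hs_hom_fixed: "X \<in> hs_hom H K \<Longrightarrow> X \<in> \<A>"
  and hs_hom_mem: "X \<in> hs_hom H K \<Longrightarrow> x \<in> H \<Longrightarrow> X * x \<in> K"
  by (auto simp: hs_hom_def)

lemma hs_hom_one: "1 \<in> hs_hom H H"
  by (simp add: hs_hom_def fixed_one)

lemma hs_hom_csubspace: "csubspace K \<Longrightarrow> csubspace (hs_hom H K)"
  using csubspace_fixed
  by (auto simp: complex_vector.subspace_def hs_hom_def distrib_right scaleC_simps)

lemma hs_hom_mult: "X \<in> hs_hom H K \<Longrightarrow> Y \<in> hs_hom K L \<Longrightarrow> Y * X \<in> hs_hom H L"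
  by (auto simp: hs_hom_def fixed_mult mult.assoc)

text \<open>\<open>x\<^sup>\<star> * (X\<^sup>\<star> * y)\<close> is the inner product of
  \<open>X * x\<close> and \<open>y\<close> in \<open>K\<close>, and by support 1 an element with
  scalar inner products against all of \<open>H\<close> belongs to \<open>H\<close>.\<close>

lemma hs_hom_star:
  assumes "has_support H 1" "hilbert_subspace K" "X \<in> hs_hom H K"
  shows "X\<^sup>\<star> \<in> hs_hom K H"
proof (rule hs_homI)
  show "X\<^sup>\<star> \<in> \<A>" using assms(3) by (intro fixed_star hs_hom_fixed)
  fix y assume y: "y \<in> K"
  have "x\<^sup>\<star> * (X\<^sup>\<star> * y) \<in> scalars" if "x \<in> H" for x
    using hilbert_subspace_inner[OF assms(2) hs_hom_mem[OF assms(3) that] y]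
    by (simp add: star_mult mult.assoc)
  thus "X\<^sup>\<star> * y \<in> H" by (rule support_one_memI[OF assms(1)])
qed

text \<open>Since \<open>\<sigma> B * x = x * B\<close>, the element \<open>A * \<sigma> B\<close>
  sends \<open>x * y\<close> to \<open>(A * x) * (B * y)\<close>: it acts as the tensor product of
  the two maps.\<close>

lemma hs_hom_tensor:
  assumes "canonical H \<sigma>" "canonical H' \<sigma>'" "canonical K' \<tau>'"
    and "A \<in> hs_hom H H'" "B \<in> hs_hom K K'"
  shows "A * \<sigma> B \<in> hs_hom (hs_product H K) (hs_product H' K')"
proof (rule hs_homI)
  show "A * \<sigma> B \<in> \<A>"
    using assms by (auto intro: fixed_mult canonical_fixed hs_hom_fixed)
  have "csubspace {x. (A * \<sigma> B) * x * 1 \<in> hs_product H' K'}"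
    by (intro csubspace_vimage_mult) (simp add: hs_product_def)
  moreover have "(A * \<sigma> B) * (x * y) * 1 \<in> hs_product H' K'" if "x \<in> H" "y \<in> K" for x y
  proof -
    have "(A * \<sigma> B) * (x * y) = A * (\<sigma> B * x) * y" by (simp add: mult.assoc)
    also have "\<dots> = (A * x) * (B * y)"
      using that assms by (simp add: canonical_mult hs_hom_fixed mult.assoc)
    finally show ?thesis
      using hs_product_mult[OF hs_hom_mem[OF assms(4) that(1)] hs_hom_mem[OF assms(5) that(2)]] by simp
  qed
  ultimately have "hs_product H K \<subseteq> {x. (A * \<sigma> B) * x * 1 \<in> hs_product H' K'}"
    by (intro hs_product_minimal) auto
  thus "A * \<sigma> B * x \<in> hs_product H' K'" if "x \<in> hs_product H K" for x
    using that by auto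
qed

text \<open>Both \<open>X * \<sigma> A\<close> and \<open>\<tau> A * X\<close> send \<open>x\<close>
  in \<open>H\<close> to \<open>X * x * A\<close>, and the vectors of \<open>H\<close>
  separate.\<close>

lemma hs_hom_intertwiners:
  assumes "canonical H \<sigma>" "canonical K \<tau>" "X \<in> hs_hom H K"
  shows "X \<in> intertwiners \<A> \<sigma> \<tau>"
proof -
  have "X * \<sigma> A = \<tau> A * X" if A: "A \<in> \<A>" for A
  proof (rule canonical_ext[OF assms(1)])
    fix x assume x: "x \<in> H"
    have "X * \<sigma> A * x = X * x * A" using canonical_mult[OF assms(1) A x] by (simp add: mult.assoc)
    also have "\<dots> = \<tau> A * X * x"
      using canonical_mult[OF assms(2) A hs_hom_mem[OF assms(3) x]] by (simp add: mult.assoc)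
    finally show "X * \<sigma> A * x = \<tau> A * X * x" .
  qed
  thus ?thesis using hs_hom_fixed[OF assms(3)] by (simp add: intertwiners_def)
qed

lemma closed_hs_hom:
  assumes "canonical H \<sigma>" "canonical K \<tau>"
  shows "closed (hs_hom H K)"
proof -
  obtain n \<Phi> where \<Phi>: "orthonormal_basis H n \<Phi>"
    using canonical_support[OF assms(1)] by (auto simp: has_support_def)
  obtain m \<Psi> where \<Psi>: "orthonormal_basis K m \<Psi>"
    using canonical_support[OF assms(2)] by (auto simp: has_support_def)
  have 1: "(\<Sum>j<n. \<Phi> j * (\<Phi> j)\<^sup>\<star>) = 1" "(\<Sum>i<m. \<Psi> i * (\<Psi> i)\<^sup>\<star>) = 1"
    using onb_support_one[OF canonical_support \<Phi>] onb_support_one[OF canonical_support \<Psi>] assms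
    by auto
  have expand: "X = (\<Sum>i<m. \<Sum>j<n. \<Psi> i * ((\<Psi> i)\<^sup>\<star> * X * \<Phi> j) * (\<Phi> j)\<^sup>\<star>)" for X
  proof -
    have "X = (\<Sum>i<m. \<Psi> i * (\<Psi> i)\<^sup>\<star>) * X * (\<Sum>j<n. \<Phi> j * (\<Phi> j)\<^sup>\<star>)" by (simp add: 1)
    thus ?thesis
      by (subst sum.swap) (simp add: sum_distrib_left sum_distrib_right mult.assoc)
  qed
  \<comment> \<open>The automorphisms are not assumed to be continuous, but on the finite-dimensional span of
    the \<open>\<Psi>\<^sub>i \<Phi>\<^sub>j\<^sup>\<star>\<close> their fixed points are cut out by explicit continuous equations.\<close>
  let ?C = "\<lambda>i j. {X. (\<Psi> i)\<^sup>\<star> * X * \<Phi> j \<in> scalars}"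
  let ?D = "\<lambda>g. {X. (\<Sum>i<m. \<Sum>j<n. \<alpha> g (\<Psi> i) * ((\<Psi> i)\<^sup>\<star> * X * \<Phi> j) * (\<alpha> g (\<Phi> j))\<^sup>\<star>) = X}"
  have "hs_hom H K = (\<Inter>i\<in>{..<m}. \<Inter>j\<in>{..<n}. ?C i j) \<inter> (\<Inter>g\<in>carrier G. ?D g)"
  proof (rule Set.set_eqI)
    fix X
    have act: "\<alpha> g X = (\<Sum>i<m. \<Sum>j<n. \<alpha> g (\<Psi> i) * ((\<Psi> i)\<^sup>\<star> * X * \<Phi> j) * (\<alpha> g (\<Phi> j))\<^sup>\<star>)"
      if s: "\<And>i j. i < m \<Longrightarrow> j < n \<Longrightarrow> (\<Psi> i)\<^sup>\<star> * X * \<Phi> j \<in> scalars" and g: "g \<in> carrier G" for g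
    proof -
      have "\<alpha> g X = \<alpha> g (\<Sum>i<m. \<Sum>j<n. \<Psi> i * ((\<Psi> i)\<^sup>\<star> * X * \<Phi> j) * (\<Phi> j)\<^sup>\<star>)"
        using expand[of X] by simp
      also have "\<dots> = (\<Sum>i<m. \<Sum>j<n. \<alpha> g (\<Psi> i) * \<alpha> g ((\<Psi> i)\<^sup>\<star> * X * \<Phi> j) * (\<alpha> g (\<Phi> j))\<^sup>\<star>)"
        by (simp add: act_sum[OF g] act_mult[OF g] act_star[OF g])
      finally show ?thesis
        using act_scalar[OF g s] by simp
    qed
    show "X \<in> hs_hom H K \<longleftrightarrow> X \<in> (\<Inter>i\<in>{..<m}. \<Inter>j\<in>{..<n}. ?C i j) \<inter> (\<Inter>g\<in>carrier G. ?D g)"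
    proof
      assume X: "X \<in> hs_hom H K"
      hence s: "(\<Psi> i)\<^sup>\<star> * X * \<Phi> j \<in> scalars" if "i < m" "j < n" for i j
        using that onb_coef[OF \<Psi> hs_hom_mem[OF X onb_mem[OF \<Phi>]]] by (simp add: mult.assoc)
      with X act[OF s] show "X \<in> (\<Inter>i\<in>{..<m}. \<Inter>j\<in>{..<n}. ?C i j) \<inter> (\<Inter>g\<in>carrier G. ?D g)"
        by (auto simp: fixedD hs_hom_fixed)
    next
      assume X: "X \<in> (\<Inter>i\<in>{..<m}. \<Inter>j\<in>{..<n}. ?C i j) \<inter> (\<Inter>g\<in>carrier G. ?D g)"
      hence s: "(\<Psi> i)\<^sup>\<star> * X * \<Phi> j \<in> scalars" if "i < m" "j < n" for i j
        using that by auto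
      have "X \<in> \<A>" using X act[OF s] by (intro fixedI) auto
      moreover have "X * \<Phi> j \<in> K" if "j < n" for j
      proof -
        have "X * \<Phi> j = (\<Sum>i<m. \<Psi> i * (\<Psi> i)\<^sup>\<star>) * (X * \<Phi> j)" using 1 by simp
        also have "\<dots> = (\<Sum>i<m. \<Psi> i * ((\<Psi> i)\<^sup>\<star> * X * \<Phi> j))"
          by (simp add: sum_distrib_right mult.assoc)
        also have "\<dots> \<in> K"
          using s that by (intro subspace_sum_mult_scalar onb_subspace[OF \<Psi>] onb_mem[OF \<Psi>]) auto
        finally show ?thesis .
      qed
      hence "cspan (\<Phi> ` {..<n}) \<subseteq> {x. X * x * 1 \<in> K}"
        by (intro complex_vector.span_minimal csubspace_vimage_mult onb_subspace[OF \<Psi>]) auto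
      ultimately show "X \<in> hs_hom H K"
        using \<Phi> by (auto simp: hs_hom_def orthonormal_basis_iff)
    qed
  qed
  moreover have "closed (?C i j)" for i j
    using closed_vimage[OF closed_scalars, of "\<lambda>X. (\<Psi> i)\<^sup>\<star> * X * \<Phi> j"]
    by (simp add: vimage_def continuous_intros)
  moreover have "closed (?D g)" for g
    by (intro closed_Collect_eq continuous_intros)
  ultimately show ?thesis by (auto intro!: closed_Int closed_INT)
qed

end

section \<open>Intertwiners over the centre\<close>

lemma (in star_action) intertwinersD:
  assumes "X \<in> intertwiners \<A> \<sigma> \<tau>"
  shows "X \<in> \<A>" "A \<in> \<A> \<Longrightarrow> X * \<sigma> A = \<tau> A * X"
  using assms by (auto simp: intertwiners_def)

lemma (in star_action) intertwiners_mult: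
  assumes "X \<in> intertwiners \<A> \<sigma> \<tau>" "Y \<in> intertwiners \<A> \<tau> \<upsilon>"
  shows "Y * X \<in> intertwiners \<A> \<sigma> \<upsilon>"
proof -
  have "Y * X * \<sigma> A = \<upsilon> A * (Y * X)" if "A \<in> \<A>" for A
    using intertwinersD(2)[OF assms(1) that] intertwinersD(2)[OF assms(2) that]
    by (metis mult.assoc)
  thus ?thesis using assms by (simp add: intertwiners_def fixed_mult)
qed

locale minimal_action = star_action G \<alpha>
  for G :: "('g, 'b) monoid_scheme" and \<alpha> :: "'g \<Rightarrow> 'f::cstar_algebra \<Rightarrow> 'f" +
  assumes minimal: "minimal_system G \<alpha>"
begin

abbreviation \<Z> :: "'f set" where "\<Z> \<equiv> center \<A>"

lemma center_commute: "z \<in> \<Z> \<Longrightarrow> A \<in> \<A> \<Longrightarrow> z * A = A * z"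
  and center_fixed: "z \<in> \<Z> \<Longrightarrow> z \<in> \<A>"
  by (auto simp: center_def commutant_def)

text \<open>This is where minimality enters: an element of the whole algebra that commutes with
  \<open>\<A>\<close> is automatically fixed by the group.\<close>

lemma centerI: "(\<And>A. A \<in> \<A> \<Longrightarrow> z * A = A * z) \<Longrightarrow> z \<in> \<Z>"
proof -
  assume "\<And>A. A \<in> \<A> \<Longrightarrow> z * A = A * z"
  hence "z \<in> commutant \<A>" by (simp add: commutant_def)
  thus ?thesis using minimal by (simp add: minimal_system_def)
qed

lemma center_mult: "y \<in> \<Z> \<Longrightarrow> z \<in> \<Z> \<Longrightarrow> y * z \<in> \<Z>"
  by (rule centerI) (metis center_commute mult.assoc)

lemma center_one: "1 \<in> \<Z>"
  by (rule centerI) simp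

text \<open>\<open>A\<close> can be carried from right to left: it becomes \<open>\<sigma> A\<close>
  before \<open>x\<close>, \<open>\<tau> A\<close> before \<open>X\<close>, and \<open>A\<close>
  again before \<open>y\<^sup>\<star>\<close>.\<close>

lemma intertwiner_matrix_center:
  assumes "canonical H \<sigma>" "canonical K \<tau>" "X \<in> intertwiners \<A> \<sigma> \<tau>" "x \<in> H" "y \<in> K"
  shows "y\<^sup>\<star> * X * x \<in> \<Z>"
proof (rule centerI)
  fix A assume A: "A \<in> \<A>"
  have "y\<^sup>\<star> * X * x * A = y\<^sup>\<star> * (X * \<sigma> A) * x"
    using canonical_mult[OF assms(1) A assms(4)] by (simp add: mult.assoc)
  also have "\<dots> = A * (y\<^sup>\<star> * X * x)"
    using intertwinersD(2)[OF assms(3) A] canonical_star_mult[OF assms(2) A assms(5)]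
    by (metis mult.assoc)
  finally show "y\<^sup>\<star> * X * x * A = A * (y\<^sup>\<star> * X * x)" .
qed

lemma canonical_center_intertwiner:
  assumes "canonical H \<sigma>" "z \<in> \<Z>"
  shows "\<sigma> z \<in> intertwiners \<A> \<sigma> \<sigma>"
proof -
  have "\<sigma> z * \<sigma> A = \<sigma> A * \<sigma> z" if "A \<in> \<A>" for A
    using that assms center_fixed by (metis canonical_times center_commute)
  thus ?thesis using assms by (simp add: intertwiners_def canonical_fixed center_fixed)
qed

text \<open>The matrix entries of an intertwiner lie in the centre. Expanding them in linearly
  independent central elements, the group acts on the scalar coefficients only.\<close>

lemma intertwiners_expand:
  assumes "canonical H \<sigma>" "canonical K \<tau>" "X \<in> intertwiners \<A> \<sigma> \<tau>"
  obtains B f where "finite B" "B \<subseteq> \<Z>" "\<And>e. e \<in> B \<Longrightarrow> f e \<in> hs_hom H K"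
    "X = (\<Sum>e\<in>B. f e * \<sigma> e)"
proof -
  obtain n \<Phi> where \<Phi>: "orthonormal_basis H n \<Phi>"
    using canonical_support[OF assms(1)] by (auto simp: has_support_def)
  obtain m \<Psi> where \<Psi>: "orthonormal_basis K m \<Psi>"
    using canonical_support[OF assms(2)] by (auto simp: has_support_def)
  have 1: "(\<Sum>j<n. \<Phi> j * (\<Phi> j)\<^sup>\<star>) = 1" "(\<Sum>i<m. \<Psi> i * (\<Psi> i)\<^sup>\<star>) = 1"
    using onb_support_one[OF canonical_support \<Phi>] onb_support_one[OF canonical_support \<Psi>] assms
    by auto
  define z where "z i j = (\<Psi> i)\<^sup>\<star> * X * \<Phi> j" for i j
  let ?S = "(\<lambda>(i, j). z i j) ` ({..<m} \<times> {..<n})"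
  have z: "z i j \<in> \<Z>" if "i < m" "j < n" for i j
    unfolding z_def using intertwiner_matrix_center[OF assms onb_mem[OF \<Phi>] onb_mem[OF \<Psi>]] that by blast
  \<comment> \<open>The independent elements are taken among the entries themselves, which keeps
    them central and finite in number.\<close>
  obtain B where B: "B \<subseteq> ?S" "complex_vector.independent B" "?S \<subseteq> cspan B"
    using complex_vector.maximal_independent_subset by blast
  have fin: "finite B" using B(1) by (rule finite_subset) auto
  have BZ: "B \<subseteq> \<Z>" using B(1) z by auto
  have "\<exists>u. z i j = (\<Sum>e\<in>B. u e *\<^sub>C e)" if "i < m" "j < n" for i j
  proof -
    have "z i j \<in> cspan B" using B(3) that by auto
    thus ?thesis using complex_vector.span_finite[OF fin] by auto
  qed
  then obtain u where u: "\<And>i j. i < m \<Longrightarrow> j < n \<Longrightarrow> z i j = (\<Sum>e\<in>B. u i j e *\<^sub>C e)" by metis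
  \<comment> \<open>The scalar matrix of the coefficients of \<open>e\<close>. The central factor
    \<open>e\<close> itself moves to the right past \<open>(\<Phi> j)\<^sup>\<star>\<close> and
    becomes \<open>\<sigma> e\<close>.\<close>
  define f where "f e = (\<Sum>i<m. \<Sum>j<n. u i j e *\<^sub>C (\<Psi> i * (\<Phi> j)\<^sup>\<star>))" for e
  have "X = (\<Sum>i<m. \<Psi> i * (\<Psi> i)\<^sup>\<star>) * X * (\<Sum>j<n. \<Phi> j * (\<Phi> j)\<^sup>\<star>)" by (simp add: 1)
  also have "\<dots> = (\<Sum>i<m. \<Sum>j<n. \<Psi> i * z i j * (\<Phi> j)\<^sup>\<star>)"
    by (subst sum.swap) (simp add: z_def sum_distrib_left sum_distrib_right mult.assoc)
  also have "\<dots> = (\<Sum>i<m. \<Sum>j<n. \<Sum>e\<in>B. u i j e *\<^sub>C (\<Psi> i * (\<Phi> j)\<^sup>\<star>) * \<sigma> e)"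
  proof (intro sum.cong refl)
    fix i j assume ij: "i \<in> {..<m}" "j \<in> {..<n}"
    have "\<Psi> i * z i j * (\<Phi> j)\<^sup>\<star> = (\<Sum>e\<in>B. u i j e *\<^sub>C (\<Psi> i * (e * (\<Phi> j)\<^sup>\<star>)))"
      using u ij by (simp add: sum_distrib_left sum_distrib_right scaleC_simps mult.assoc)
    also have "\<dots> = (\<Sum>e\<in>B. u i j e *\<^sub>C (\<Psi> i * (\<Phi> j)\<^sup>\<star>) * \<sigma> e)"
      using BZ ij canonical_star_mult[OF assms(1) center_fixed onb_mem[OF \<Phi>]]
      by (intro sum.cong refl) (auto simp: scaleC_simps mult.assoc)
    finally show "\<Psi> i * z i j * (\<Phi> j)\<^sup>\<star> = (\<Sum>e\<in>B. u i j e *\<^sub>C (\<Psi> i * (\<Phi> j)\<^sup>\<star>) * \<sigma> e)" .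
  qed
  also have "\<dots> = (\<Sum>e\<in>B. f e * \<sigma> e)"
    unfolding f_def sum_distrib_right
    by (simp add: sum.swap[of _ B])
  finally have X: "X = (\<Sum>e\<in>B. f e * \<sigma> e)" .
  have mem: "f e * x \<in> K" if "x \<in> H" for e x
  proof -
    have "f e * x = (\<Sum>i<m. \<Psi> i * (\<Sum>j<n. u i j e *\<^sub>C ((\<Phi> j)\<^sup>\<star> * x)))"
      unfolding f_def sum_distrib_right sum_distrib_left by (simp add: scaleC_simps mult.assoc)
    also have "\<dots> \<in> K"
      by (intro subspace_sum_mult_scalar onb_subspace[OF \<Psi>] scalars_sum scalars_scaleC)
         (use onb_coef[OF \<Phi> that] onb_mem[OF \<Psi>] in auto)
    finally show ?thesis .
  qed
  have "f e \<in> \<A>" if e: "e \<in> B" for e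
  proof (rule fixedI)
    fix g assume g: "g \<in> carrier G"
    \<comment> \<open>\<open>\<alpha> g (f e)\<close> again maps \<open>H\<close> into
      \<open>K\<close>, because both spaces are invariant; so its matrix entries are scalars
      too.\<close>
    have s: "y\<^sup>\<star> * (\<alpha> g (f e) - f e) * x \<in> scalars" if x: "x \<in> H" and y: "y \<in> K" for x y e
    proof -
      obtain x' where x': "x' \<in> H" "x = \<alpha> g x'"
        using invariant_image[OF canonical_invariant[OF assms(1)] g] x by auto
      have "\<alpha> g (f e) * x = \<alpha> g (f e * x')" by (simp add: x' act_mult[OF g])
      also have "\<dots> \<in> K"
        by (rule invariantD[OF canonical_invariant[OF assms(2)] g mem[OF x'(1)]])
      finally have "y\<^sup>\<star> * (\<alpha> g (f e) * x) - y\<^sup>\<star> * (f e * x) \<in> scalars"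
        using mem[OF x] y canonical_hilbert_subspace[OF assms(2)]
        by (intro scalars_diff hilbert_subspace_inner) auto
      thus ?thesis by (simp add: algebra_simps)
    qed
    have "\<alpha> g X = X" using intertwinersD(1)[OF assms(3)] g by (simp add: fixedD)
    \<comment> \<open>\<open>X\<close> and the \<open>\<sigma> e\<close> are fixed, so the changes
      of the \<open>f e\<close> cancel in the sum. Between vectors of \<open>H\<close> and
      \<open>K\<close> this is a linear relation among the elements of \<open>B\<close>, which
      independence makes trivial.\<close>
    hence "(\<Sum>e\<in>B. (\<alpha> g (f e) - f e) * \<sigma> e) = 0"
      using BZ g
      by (simp add: X act_sum[OF g] act_mult[OF g] left_diff_distrib sum_subtractf subset_iff
          fixedD canonical_fixed[OF assms(1)] center_fixed)
    hence "y\<^sup>\<star> * (\<Sum>e\<in>B. (\<alpha> g (f e) - f e) * \<sigma> e) * x = 0" for x y by simp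
    hence "(\<Sum>e\<in>B. y\<^sup>\<star> * (\<alpha> g (f e) - f e) * (\<sigma> e * x)) = 0" for x y
      by (simp add: sum_distrib_left sum_distrib_right mult.assoc)
    moreover have "(\<Sum>e\<in>B. y\<^sup>\<star> * (\<alpha> g (f e) - f e) * (\<sigma> e * x))
        = (\<Sum>e\<in>B. coef (y\<^sup>\<star> * (\<alpha> g (f e) - f e) * x) *\<^sub>C e)" if "x \<in> H" "y \<in> K" for x y
    proof (intro sum.cong refl)
      fix e assume "e \<in> B"
      hence "y\<^sup>\<star> * (\<alpha> g (f e) - f e) * (\<sigma> e * x) = y\<^sup>\<star> * (\<alpha> g (f e) - f e) * x * e"
        using BZ canonical_mult[OF assms(1) center_fixed that(1)] by (simp add: subset_iff mult.assoc)
      thus "y\<^sup>\<star> * (\<alpha> g (f e) - f e) * (\<sigma> e * x)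
          = coef (y\<^sup>\<star> * (\<alpha> g (f e) - f e) * x) *\<^sub>C e"
        by (simp only: scalars_mult_left[OF s[OF that]])
    qed
    ultimately have "(\<Sum>e\<in>B. coef (y\<^sup>\<star> * (\<alpha> g (f e) - f e) * x) *\<^sub>C e) = 0"
      if "x \<in> H" "y \<in> K" for x y using that by simp
    hence "coef (y\<^sup>\<star> * (\<alpha> g (f e) - f e) * x) = 0" if "x \<in> H" "y \<in> K" for x y
      by (rule complex_vector.independentD[OF B(2) fin order_refl _ e]) (rule that)+
    hence 0: "y\<^sup>\<star> * (\<alpha> g (f e) - f e) * x = 0" if "x \<in> H" "y \<in> K" for x y
      using scaleC_coef[OF s[OF that, of e]] that by (metis scaleC_zero_left)
    have "\<alpha> g (f e) * x = f e * x" if "x \<in> H" for x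
    proof -
      have "((\<alpha> g (f e) - f e) * x)\<^sup>\<star> * y = 0 * y" if "y \<in> K" for y
        using arg_cong[OF 0[OF \<open>x \<in> H\<close> that], of star]
        by (simp add: star_mult star_star mult.assoc)
      hence "((\<alpha> g (f e) - f e) * x)\<^sup>\<star> = 0" by (rule canonical_ext[OF assms(2)])
      thus ?thesis by (metis star_star star_zero left_diff_distrib right_minus_eq)
    qed
    thus "\<alpha> g (f e) = f e" by (rule canonical_ext[OF assms(1)])
  qed
  with mem have "f e \<in> hs_hom H K" if "e \<in> B" for e using that by (intro hs_homI) auto
  with fin BZ X show ?thesis using that by blast
qed

text \<open>A left factor \<open>\<tau> y\<close> passes through \<open>X\<close> and becomes
  \<open>\<sigma> y\<close>, so the two-sided products give nothing more than the one-sided ones;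
  \<open>y = 1\<close> gives the converse.\<close>

lemma intertwiners_span:
  assumes "canonical H \<sigma>" "canonical K \<tau>"
  shows "intertwiners \<A> \<sigma> \<tau> = cspan {X * \<sigma> z | X z. X \<in> hs_hom H K \<and> z \<in> \<Z>}" (is ?left)
    and "intertwiners \<A> \<sigma> \<tau>
      = cspan {\<tau> y * X * \<sigma> z | X y z. X \<in> hs_hom H K \<and> y \<in> \<Z> \<and> z \<in> \<Z>}" (is ?right)
proof -
  let ?L = "{X * \<sigma> z | X z. X \<in> hs_hom H K \<and> z \<in> \<Z>}"
  let ?R = "{\<tau> y * X * \<sigma> z | X y z. X \<in> hs_hom H K \<and> y \<in> \<Z> \<and> z \<in> \<Z>}"
  have "?R \<subseteq> ?L"
  proof safe
    fix X y z assume *: "X \<in> hs_hom H K" "y \<in> \<Z>" "z \<in> \<Z>"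
    have "\<tau> y * X = X * \<sigma> y"
      using intertwinersD(2)[OF hs_hom_intertwiners[OF assms *(1)] center_fixed[OF *(2)]] by simp
    hence "\<tau> y * X * \<sigma> z = X * \<sigma> (y * z)"
      using * by (simp add: mult.assoc canonical_times[OF assms(1)] center_fixed)
    thus "\<exists>X' z'. \<tau> y * X * \<sigma> z = X' * \<sigma> z' \<and> X' \<in> hs_hom H K \<and> z' \<in> \<Z>"
      using * center_mult by blast
  qed
  moreover have "?L \<subseteq> ?R"
    using center_one canonical_one[OF assms(2)] by force
  ultimately have "?L = ?R" by blast
  moreover show ?left
  proof (rule antisym)
    show "intertwiners \<A> \<sigma> \<tau> \<subseteq> cspan ?L"
    proof
      fix X assume "X \<in> intertwiners \<A> \<sigma> \<tau>"
      then obtain B f where "finite B" "B \<subseteq> \<Z>" "\<And>e. e \<in> B \<Longrightarrow> f e \<in> hs_hom H K"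
        "X = (\<Sum>e\<in>B. f e * \<sigma> e)"
        using intertwiners_expand[OF assms] by metis
      hence "f e * \<sigma> e \<in> cspan ?L" if "e \<in> B" for e
        using that by (intro complex_vector.span_base) blast
      thus "X \<in> cspan ?L"
        unfolding \<open>X = _\<close> by (rule complex_vector.span_sum)
    qed
    have "csubspace (intertwiners \<A> \<sigma> \<tau>)"
      using csubspace_fixed
      by (auto simp: complex_vector.subspace_def intertwiners_def distrib_left distrib_right scaleC_simps)
    moreover have "?L \<subseteq> intertwiners \<A> \<sigma> \<tau>"
      using intertwiners_mult canonical_center_intertwiner[OF assms(1)]
        hs_hom_intertwiners[OF assms] by blast
    ultimately show "cspan ?L \<subseteq> intertwiners \<A> \<sigma> \<tau>"
      by (rule complex_vector.span_minimal[rotated])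
  qed
  ultimately show ?right by simp
qed

end

section \<open>Uniqueness of the Hilbert space of a canonical endomorphism\<close>

context star_action
begin

text \<open>On the range of \<open>Y\<^sup>\<star> * Y\<close> a complex matrix supplies an
  eigenvector. Selfadjointness excludes the eigenvalue 0 on the range, and comparing the squared
  lengths of \<open>x\<close> and \<open>Y * x\<close> shows that the eigenvalue is real and
  positive.\<close>

lemma hs_hom_eigenvector:
  assumes H: "has_support H 1" and K: "hilbert_subspace K"
    and Y: "Y \<in> hs_hom H K" "Y \<noteq> 0"
  obtains r x where "r > 0" "x \<in> H" "x \<noteq> 0" "Y\<^sup>\<star> * Y * x = complex_of_real r *\<^sub>C x"
proof -
  define B where "B = Y\<^sup>\<star> * Y"
  have hH: "hilbert_subspace H" by (rule has_support_hilbert_subspace[OF H])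
  have B: "B \<in> hs_hom H H"
    unfolding B_def by (rule hs_hom_mult[OF Y(1) hs_hom_star[OF H K Y(1)]])
  have "B \<noteq> 0" using Y(2) by (simp add: B_def)
  have Bs: "B\<^sup>\<star> = B" by (simp add: B_def star_simps)
  define L where "L = (*) B ` H"
  have "csubspace L"
    unfolding complex_vector.subspace_def
  proof (safe)
    show "0 \<in> L"
      unfolding L_def using complex_vector.subspace_0[OF hilbert_subspace_csubspace[OF hH]]
      by (metis image_eqI mult_zero_right)
  next
    fix x y assume "x \<in> L" "y \<in> L"
    thus "x + y \<in> L"
      unfolding L_def using complex_vector.subspace_add[OF hilbert_subspace_csubspace[OF hH]]
      by (auto simp flip: distrib_left)
  next
    fix c x assume "x \<in> L"
    then obtain x' where "x' \<in> H" "x = B * x'" by (auto simp: L_def)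
    thus "c *\<^sub>C x \<in> L"
      unfolding L_def using complex_vector.subspace_scale[OF hilbert_subspace_csubspace[OF hH]]
      by (intro image_eqI[of _ _ "c *\<^sub>C x'"]) (auto simp: scaleC_simps)
  qed
  moreover have "L \<subseteq> H" unfolding L_def using hs_hom_mem[OF B] by auto
  ultimately have L: "hilbert_subspace L" by (rule hilbert_subspace_subset[OF hH])
  then obtain l w where w: "orthonormal_basis L l w" by (auto simp: hilbert_subspace_def)
  have "l > 0"
  proof (rule ccontr)
    assume "\<not> l > 0"
    hence "L = {0}" using w by (simp add: orthonormal_basis_iff)
    hence "B * x = 0 * x" if "x \<in> H" for x using that by (auto simp: L_def)
    hence "B = 0" by (rule support_one_cong[OF H])
    with \<open>B \<noteq> 0\<close> show False by simp
  qed
  define M where "M = mat l l (\<lambda>(i, j). coef ((w i)\<^sup>\<star> * (B * w j)))"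
  have M: "M \<in> carrier_mat l l" by (simp add: M_def)
  then obtain c where "c \<in> spectrum M" using spectrum_non_empty[OF M \<open>l > 0\<close>] by auto
  then obtain v where v: "v \<in> carrier_vec l" "v \<noteq> 0\<^sub>v l" "M *\<^sub>v v = c \<cdot>\<^sub>v v"
    using M by (auto simp: spectrum_def eigenvalue_def eigenvector_def)
  define x where "x = (\<Sum>j<l. v $ j *\<^sub>C w j)"
  have xL: "x \<in> L"
    unfolding x_def using onb_mem[OF w] \<open>csubspace L\<close>
    by (intro complex_vector.subspace_sum complex_vector.subspace_scale) auto
  have BL: "B * y \<in> L" if "y \<in> L" for y
    using that \<open>L \<subseteq> H\<close> by (auto simp: L_def)
  have "B * x = (\<Sum>j<l. v $ j *\<^sub>C (\<Sum>i<l. w i * ((w i)\<^sup>\<star> * (B * w j))))"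
    using onb_expand[OF w BL[OF onb_mem[OF w]]]
    by (simp add: x_def sum_distrib_left scaleC_simps)
  also have "\<dots> = (\<Sum>j<l. \<Sum>i<l. (M $$ (i, j) * v $ j) *\<^sub>C w i)"
    using onb_coef[OF w BL[OF onb_mem[OF w]]]
    by (simp add: M_def scalars_mult_right complex_vector.scale_sum_right scaleC_simps mult.commute)
  also have "\<dots> = (\<Sum>i<l. (\<Sum>j<l. M $$ (i, j) * v $ j) *\<^sub>C w i)"
    by (subst sum.swap) (simp add: complex_vector.scale_sum_left)
  also have "\<dots> = (\<Sum>i<l. (M *\<^sub>v v) $ i *\<^sub>C w i)"
    using M v(1) by (intro sum.cong refl) (simp add: scalar_prod_def atLeast0LessThan)
  also have "\<dots> = c *\<^sub>C x"
    using v M by (simp add: x_def complex_vector.scale_sum_right scaleC_simps)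
  finally have Bx: "B * x = c *\<^sub>C x" .
  have "x \<noteq> 0"
  proof
    assume "x = 0"
    hence "v $ j = 0" if "j < l" for j
      using orthonormal_scaleC_sum_eq_0[of "{..<l}" w "\<lambda>j. v $ j" j] w that
      by (simp add: x_def orthonormal_basis_iff)
    hence "v = 0\<^sub>v l" using v(1) by (intro eq_vecI) auto
    with v(2) show False by simp
  qed
  have "c \<noteq> 0"
  proof
    assume "c = 0"
    obtain y where y: "y \<in> H" "x = B * y" using xL by (auto simp: L_def)
    have "x\<^sup>\<star> * x = y\<^sup>\<star> * (B * x)"
      using Bs by (subst (1) y(2)) (simp add: star_mult mult.assoc)
    thus False using \<open>x \<noteq> 0\<close> Bx \<open>c = 0\<close> by simp
  qed
  have xH: "x \<in> H" using xL \<open>L \<subseteq> H\<close> by blast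
  obtain s where s: "s \<ge> 0" "x\<^sup>\<star> * x = complex_of_real s *\<^sub>C 1"
    using hilbert_subspace_star_self[OF hH xH] .
  obtain t where t: "t \<ge> 0" "(Y * x)\<^sup>\<star> * (Y * x) = complex_of_real t *\<^sub>C 1"
    using hilbert_subspace_star_self[OF K hs_hom_mem[OF Y(1) xH]] .
  have "s > 0" using s \<open>x \<noteq> 0\<close> star_mult_self_eq_0[of x] by (cases "s = 0") auto
  have "(Y * x)\<^sup>\<star> * (Y * x) = x\<^sup>\<star> * (B * x)" by (simp add: B_def star_mult mult.assoc)
  hence "complex_of_real t *\<^sub>C 1 = (c * complex_of_real s) *\<^sub>C (1 :: 'f)"
    by (simp add: t(2) Bx scaleC_simps s(2))
  hence "complex_of_real t = c * complex_of_real s" by simp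
  hence c: "c = complex_of_real (t / s)" using \<open>s > 0\<close> by (simp add: field_simps)
  hence "t / s > 0" using \<open>c \<noteq> 0\<close> t(1) \<open>s > 0\<close> by (cases "t = 0") auto
  thus ?thesis using that[OF _ xH \<open>x \<noteq> 0\<close>] Bx c B_def by blast
qed

definition partial_isometries :: "'f set \<Rightarrow> 'f set \<Rightarrow> 'f set"
  where "partial_isometries H K = {T \<in> hs_hom H K. T * T\<^sup>\<star> * T = T}"

text \<open>A nonzero arrow between the defects of a partial isometry enlarges it, by the
  isometric part of the arrow on an eigenspace.\<close>

lemma partial_isometry_enlarge:
  assumes H: "has_support H 1" "invariant H" and K: "has_support K 1"
    and T: "T \<in> partial_isometries H K" and X: "X \<in> hs_hom H K"
    and nz: "(1 - T * T\<^sup>\<star>) * X * (1 - T\<^sup>\<star> * T) \<noteq> 0"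
  obtains S where "S \<in> partial_isometries H K" "{x\<in>H. S * x = 0} \<subset> {x\<in>H. T * x = 0}"
proof -
  have hH: "hilbert_subspace H" and hK: "hilbert_subspace K"
    using H K by (auto intro: has_support_hilbert_subspace)
  note cH = hilbert_subspace_csubspace[OF hH] and cK = hilbert_subspace_csubspace[OF hK]
  have TK: "T \<in> hs_hom H K" and T3: "T * T\<^sup>\<star> * T = T" using T by (auto simp: partial_isometries_def)
  have Ts: "T\<^sup>\<star> \<in> hs_hom K H" by (rule hs_hom_star[OF H(1) hK TK])
  have T3': "T\<^sup>\<star> * (T * T\<^sup>\<star>) = T\<^sup>\<star>" using arg_cong[OF T3, of star] by (simp add: star_simps mult.assoc)
  define e where "e = 1 - T\<^sup>\<star> * T"
  define f where "f = 1 - T * T\<^sup>\<star>"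
  have e: "e * e = e" "e\<^sup>\<star> = e" "T * e = 0"
    using T3 T3' by (simp_all add: e_def algebra_simps star_simps)
  have f: "f * f = f" "f\<^sup>\<star> = f" "T\<^sup>\<star> * f = 0"
    using T3 T3' by (simp_all add: f_def algebra_simps star_simps)
  have eH: "e \<in> hs_hom H H" and fK: "f \<in> hs_hom K K"
    unfolding e_def f_def using hs_hom_one hs_hom_mult[OF TK Ts] hs_hom_mult[OF Ts TK]
    by (auto intro!: complex_vector.subspace_diff hs_hom_csubspace cH cK)
  define Y where "Y = f * X * e"
  have Y: "Y \<in> hs_hom H K"
    unfolding Y_def by (rule hs_hom_mult[OF eH hs_hom_mult[OF X fK]])
  have Ye: "Y * e = Y" and fY: "f * Y = Y" using e f by (simp_all add: Y_def mult.assoc flip: mult.assoc[of f f])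
  have "Y \<noteq> 0" using nz by (simp add: Y_def e_def f_def)
  then obtain r x where r: "r > 0" and x: "x \<in> H" "x \<noteq> 0" "Y\<^sup>\<star> * Y * x = complex_of_real r *\<^sub>C x"
    using hs_hom_eigenvector[OF H(1) hK Y] by metis
  \<comment> \<open>The whole eigenspace and not one vector: it is invariant, so that its support
    \<open>p\<close> is fixed by the group.\<close>
  define L where "L = {x\<in>H. Y\<^sup>\<star> * Y * x = complex_of_real r *\<^sub>C x}"
  have Yf: "Y\<^sup>\<star> * Y \<in> \<A>" using hs_hom_fixed[OF Y] by (simp add: fixed_mult fixed_star)
  have "csubspace L"
    using cH by (auto simp: L_def complex_vector.subspace_def distrib_left scaleC_simps
        complex_vector.scale_right_distrib mult.commute)
  hence "hilbert_subspace L" by (rule hilbert_subspace_subset[OF hH]) (auto simp: L_def)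
  then obtain p where p: "has_support L p" using has_support_exists by blast
  have "\<alpha> g y \<in> L" if "g \<in> carrier G" "y \<in> L" for g y
    using that invariantD[OF H(2)] act_mult[of g "Y\<^sup>\<star> * Y" y] fixedD[OF Yf]
    by (auto simp: L_def act_scaleC)
  hence "invariant L" by (auto simp: invariant_def)
  hence "p \<in> \<A>" using p by (rule has_support_fixed)
  hence pH: "p \<in> hs_hom H H"
    using has_support_range[OF p hH] by (intro hs_homI) (auto simp: L_def)
  have ps: "p\<^sup>\<star> = p" "p * p = p" using has_support_star[OF p] has_support_idem[OF p] .
  have Yp: "Y\<^sup>\<star> * Y * p = complex_of_real r *\<^sub>C p"
    using has_support_mult_cong[OF p, of "Y\<^sup>\<star> * Y" "complex_of_real r *\<^sub>C 1"]
    by (simp add: L_def scaleC_simps)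
  \<comment> \<open>The eigenspace lies in the initial defect of \<open>T\<close>:
    \<open>Y * e = Y\<close> makes \<open>e\<close> act as the identity on the range of
    \<open>Y\<^sup>\<star> * Y\<close>, and \<open>r\<close> is not 0.\<close>
  have ex: "e * y = y" if "y \<in> L" for y
  proof -
    have "complex_of_real r *\<^sub>C (e * y) = e * (Y\<^sup>\<star> * Y * y)" using that by (simp add: L_def scaleC_simps)
    also have "\<dots> = (Y * e)\<^sup>\<star> * Y * y" by (simp add: star_mult e mult.assoc)
    also have "\<dots> = complex_of_real r *\<^sub>C y" using that by (simp add: Ye L_def)
    finally show ?thesis using r by simp
  qed
  hence "e * p = p" using has_support_mult_cong[OF p, of e 1] by simp
  have "p * e = (e * p)\<^sup>\<star>" by (simp add: star_mult ps e)
  hence "p * e = p" by (simp add: \<open>e * p = p\<close> ps)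
  \<comment> \<open>The factor makes \<open>W\<close> a partial isometry with initial projection
    \<open>p\<close>. Its initial and final spaces are orthogonal to those of \<open>T\<close>, so
    \<open>T + W\<close> is again a partial isometry.\<close>
  define W where "W = complex_of_real (1 / sqrt r) *\<^sub>C (Y * p)"
  have W: "W \<in> hs_hom H K"
    unfolding W_def by (intro complex_vector.subspace_scale hs_hom_csubspace cK hs_hom_mult[OF pH Y])
  have fW: "f * W = W" by (simp add: W_def scaleC_simps fY flip: mult.assoc)
  have Wp: "W * p = W" by (simp add: W_def scaleC_simps ps mult.assoc)
  have We: "W * e = W" by (simp add: W_def scaleC_simps \<open>p * e = p\<close> mult.assoc)
  have TW: "T\<^sup>\<star> * W = 0" using fW f by (metis mult.assoc mult_zero_left)
  have WT: "W\<^sup>\<star> * T = 0" using arg_cong[OF TW, of star] by (simp add: star_simps)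
  have Tp: "T * p = 0" using \<open>e * p = p\<close> e by (metis mult.assoc mult_zero_left)
  have WTT: "W * (T\<^sup>\<star> * T) = 0" using We by (simp add: e_def algebra_simps)
  have "1 / sqrt r * (1 / sqrt r) * r = 1" using r by simp
  hence rr: "complex_of_real (1 / sqrt r) * complex_of_real (1 / sqrt r) * complex_of_real r = 1"
    by (metis of_real_1 of_real_mult)
  have "W\<^sup>\<star> * W = (complex_of_real (1 / sqrt r) * complex_of_real (1 / sqrt r)) *\<^sub>C (p * (Y\<^sup>\<star> * Y * p))"
    by (simp add: W_def star_simps scaleC_simps ps mult.assoc)
  also have "\<dots> = p" unfolding Yp by (simp add: scaleC_simps ps rr del: of_real_divide)
  finally have WW: "W\<^sup>\<star> * W = p" .
  define S where "S = T + W"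
  have SS: "S\<^sup>\<star> * S = T\<^sup>\<star> * T + p" by (simp add: S_def star_add algebra_simps TW WT WW)
  have "S * S\<^sup>\<star> * S = T * T\<^sup>\<star> * T + T * p + W * (T\<^sup>\<star> * T) + W * p"
    unfolding mult.assoc SS by (simp add: S_def algebra_simps)
  also have "\<dots> = S" by (simp add: T3 Tp WTT Wp S_def)
  finally have S: "S \<in> partial_isometries H K"
    using TK W by (auto simp: partial_isometries_def S_def intro!: complex_vector.subspace_add hs_hom_csubspace cK)
  have "T * y = 0" if "S * y = 0" for y
  proof -
    have "T\<^sup>\<star> * (S * y) = T\<^sup>\<star> * T * y" by (simp add: S_def algebra_simps TW flip: mult.assoc)
    hence "T * T\<^sup>\<star> * T * y = 0" using that by (simp add: mult.assoc)
    thus ?thesis by (simp add: T3)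
  qed
  moreover have "x \<in> L" using x by (simp add: L_def)
  have "T * x = 0"
    using ex[OF \<open>x \<in> L\<close>] e by (metis mult.assoc mult_zero_left)
  moreover have "S * x \<noteq> 0"
  proof
    assume "S * x = 0"
    hence "W\<^sup>\<star> * (S * x) = 0" by simp
    hence "p * x = 0" using \<open>T * x = 0\<close> by (simp add: S_def distrib_right WW flip: mult.assoc)
    thus False using has_support_fix[OF p \<open>x \<in> L\<close>] x by simp
  qed
  ultimately show ?thesis using that[OF S] x(1) by blast
qed

text \<open>Each enlargement strictly lowers the dimension of the kernel in \<open>H\<close>, so the
  process that starts from 0 must stop.\<close>

lemma maximal_partial_isometry_exists:
  assumes H: "has_support H 1" "invariant H" and K: "has_support K 1"
  obtains T where "T \<in> partial_isometries H K"
    "\<And>X. X \<in> hs_hom H K \<Longrightarrow> (1 - T * T\<^sup>\<star>) * X * (1 - T\<^sup>\<star> * T) = 0"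
proof -
  have hH: "hilbert_subspace H" and hK: "hilbert_subspace K"
    using H K by (auto intro: has_support_hilbert_subspace)
  have ker: "csubspace {x\<in>H. T * x = 0}" for T
    using hilbert_subspace_csubspace[OF hH]
    by (auto simp: complex_vector.subspace_def distrib_left scaleC_simps)
  have *: "\<exists>T\<in>partial_isometries H K.
      \<forall>X\<in>hs_hom H K. (1 - T * T\<^sup>\<star>) * X * (1 - T\<^sup>\<star> * T) = 0"
    if "T \<in> partial_isometries H K" "orthonormal_basis {x\<in>H. T * x = 0} n \<Phi>" for T n \<Phi>
    using that
  proof (induction n arbitrary: T \<Phi> rule: less_induct)
    case (less n)
    show ?case
    proof (cases "\<forall>X\<in>hs_hom H K. (1 - T * T\<^sup>\<star>) * X * (1 - T\<^sup>\<star> * T) = 0")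
      case False
      then obtain X where X: "X \<in> hs_hom H K" "(1 - T * T\<^sup>\<star>) * X * (1 - T\<^sup>\<star> * T) \<noteq> 0" by blast
      obtain S where S: "S \<in> partial_isometries H K" "{x\<in>H. S * x = 0} \<subset> {x\<in>H. T * x = 0}"
        using partial_isometry_enlarge[OF H K less.prems(1) X] .
      obtain m \<Psi> where m: "orthonormal_basis {x\<in>H. S * x = 0} m \<Psi>" "m < n"
        by (rule onb_subspace_exists[OF less.prems(2) ker psubset_imp_subset[OF S(2)]])
           (use S(2) in simp)
      show ?thesis by (rule less.IH[OF m(2) S(1) m(1)])
    qed (rule bexI[OF _ less.prems(1)])
  qed
  have 0: "0 \<in> partial_isometries H K"
    using hilbert_subspace_csubspace[OF hK]
    by (auto simp: partial_isometries_def hs_hom_def fixed_zero complex_vector.subspace_0)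
  have "hilbert_subspace {x\<in>H. 0 * x = 0}" using hH by simp
  then obtain n \<Phi> where \<Phi>: "orthonormal_basis {x\<in>H. 0 * x = 0} n \<Phi>"
    unfolding hilbert_subspace_def by blast
  from *[OF 0 \<Phi>] obtain T where "T \<in> partial_isometries H K"
    "\<forall>X\<in>hs_hom H K. (1 - T * T\<^sup>\<star>) * X * (1 - T\<^sup>\<star> * T) = 0" ..
  thus ?thesis using that by simp
qed

end

section \<open>The central trace and the comparison of two Hilbert spaces\<close>

context minimal_action
begin

text \<open>The usual computation for matrices, valid because the entries lie in the commutative
  algebra \<open>\<Z>\<close>.\<close>

lemma intertwiner_trace_commute:
  assumes "canonical H \<sigma>" "orthonormal_basis H n \<Phi>"
    and "X \<in> intertwiners \<A> \<sigma> \<sigma>" "Y \<in> intertwiners \<A> \<sigma> \<sigma>"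
  shows "(\<Sum>i<n. (\<Phi> i)\<^sup>\<star> * (X * Y) * \<Phi> i) = (\<Sum>i<n. (\<Phi> i)\<^sup>\<star> * (Y * X) * \<Phi> i)"
proof -
  let ?m = "\<lambda>X i j. (\<Phi> i)\<^sup>\<star> * X * \<Phi> j"
  have 1: "(\<Sum>j<n. \<Phi> j * (\<Phi> j)\<^sup>\<star>) = 1"
    by (rule onb_support_one[OF canonical_support[OF assms(1)] assms(2)])
  have *: "(\<Phi> i)\<^sup>\<star> * (X * Y) * \<Phi> i = (\<Sum>j<n. ?m X i j * ?m Y j i)" for X Y i
  proof -
    have "(\<Phi> i)\<^sup>\<star> * (X * Y) * \<Phi> i = (\<Phi> i)\<^sup>\<star> * X * (\<Sum>j<n. \<Phi> j * (\<Phi> j)\<^sup>\<star>) * Y * \<Phi> i"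
      by (simp add: 1 mult.assoc)
    thus ?thesis by (simp add: sum_distrib_left sum_distrib_right mult.assoc)
  qed
  have "(\<Sum>i<n. (\<Phi> i)\<^sup>\<star> * (X * Y) * \<Phi> i) = (\<Sum>i<n. \<Sum>j<n. ?m Y j i * ?m X i j)"
    unfolding * using onb_mem[OF assms(2)]
    by (intro sum.cong refl center_commute center_fixed
        intertwiner_matrix_center[OF assms(1,1,3)] intertwiner_matrix_center[OF assms(1,1,4)]) auto
  also have "\<dots> = (\<Sum>i<n. (\<Phi> i)\<^sup>\<star> * (Y * X) * \<Phi> i)"
    unfolding * by (rule sum.swap)
  finally show ?thesis .
qed

text \<open>The projection \<open>p\<close> below is the central support of the initial defect \<open>e\<close>. It is orthogonal to
  the final defect, so that \<open>p = T T\<^sup>\<star> p\<close>, and the trace of \<open>e = p - T\<^sup>\<star> p T\<close> vanishes.\<close>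

lemma maximal_partial_isometry_isometry:
  assumes H: "canonical H \<sigma>" and K: "canonical K \<sigma>"
    and T: "T \<in> partial_isometries H K"
    and max: "\<And>X. X \<in> hs_hom H K \<Longrightarrow> (1 - T * T\<^sup>\<star>) * X * (1 - T\<^sup>\<star> * T) = 0"
  shows "T\<^sup>\<star> * T = 1"
proof -
  let ?M = "intertwiners \<A> \<sigma> \<sigma>"
  note sH = canonical_support[OF H] and hH = canonical_hilbert_subspace[OF H]
    and hK = canonical_hilbert_subspace[OF K]
  have TK: "T \<in> hs_hom H K" and T3: "T * T\<^sup>\<star> * T = T" using T by (auto simp: partial_isometries_def)
  have Ts: "T\<^sup>\<star> \<in> hs_hom K H" by (rule hs_hom_star[OF sH hK TK])
  have T3': "T\<^sup>\<star> * (T * T\<^sup>\<star>) = T\<^sup>\<star>" using arg_cong[OF T3, of star] by (simp add: star_simps mult.assoc)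
  define e where "e = 1 - T\<^sup>\<star> * T"
  define f where "f = 1 - T * T\<^sup>\<star>"
  have e: "e * e = e" "e\<^sup>\<star> = e"
    using T3 T3' by (simp_all add: e_def algebra_simps star_simps)
  have eH: "e \<in> hs_hom H H"
    unfolding e_def using hs_hom_one hs_hom_mult[OF TK Ts] canonical_csubspace[OF H]
    by (auto intro!: complex_vector.subspace_diff hs_hom_csubspace)
  have eM: "e * \<sigma> A = \<sigma> A * e" if "A \<in> \<A>" for A
    using intertwinersD(2)[OF hs_hom_intertwiners[OF H H eH] that] .
  \<comment> \<open>Maximality speaks of arrows with scalar matrices only. The expansion over the
    centre extends it to all self-intertwiners, because \<open>\<sigma> b\<close> commutes with
    \<open>e\<close>.\<close>
  have fXe: "f * X * e = 0" if X: "X \<in> ?M" for X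
  proof -
    obtain B h where B: "finite B" "B \<subseteq> \<Z>" "\<And>b. b \<in> B \<Longrightarrow> h b \<in> hs_hom H K"
      "X = (\<Sum>b\<in>B. h b * \<sigma> b)"
      using intertwiners_expand[OF H K X] by metis
    have "f * (h b * \<sigma> b) * e = 0" if "b \<in> B" for b
    proof -
      have "f * (h b * \<sigma> b) * e = f * h b * e * \<sigma> b"
        using eM[OF center_fixed] B(2) that by (simp add: subset_iff mult.assoc)
      thus ?thesis using max[OF B(3)[OF that]] by (simp add: e_def f_def)
    qed
    thus ?thesis unfolding B(4) sum_distrib_left sum_distrib_right by simp
  qed
  \<comment> \<open>The subspace generated by the arrows from the range of \<open>e\<close>, so that
    its support \<open>p\<close> dominates \<open>e\<close> and commutes with the arrows.\<close>
  define L where "L = cspan {X * e * x | X x. X \<in> hs_hom H H \<and> x \<in> H}"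
  have LH: "L \<subseteq> H"
    unfolding L_def using hs_hom_mem eH canonical_csubspace[OF H]
    by (intro complex_vector.span_minimal) (auto simp: mult.assoc)
  have "hilbert_subspace L"
    by (rule hilbert_subspace_subset[OF hH _ LH]) (simp add: L_def)
  then obtain p where p: "has_support L p" using has_support_exists by blast
  have "invariant L"
    unfolding invariant_def L_def
  proof (intro ballI)
    fix g assume g: "g \<in> carrier G"
    show "\<alpha> g ` cspan {X * e * x | X x. X \<in> hs_hom H H \<and> x \<in> H}
        \<subseteq> cspan {X * e * x | X x. X \<in> hs_hom H H \<and> x \<in> H}"
      unfolding act_span[OF g]
    proof (intro complex_vector.span_mono, safe)
      fix X x assume *: "X \<in> hs_hom H H" "x \<in> H"
      hence "\<alpha> g (X * e * x) = X * e * \<alpha> g x"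
        using g hs_hom_fixed[OF eH] by (simp add: act_mult fixedD hs_hom_fixed)
      thus "\<exists>X' x'. \<alpha> g (X * e * x) = X' * e * x' \<and> X' \<in> hs_hom H H \<and> x' \<in> H"
        using * invariantD[OF canonical_invariant[OF H] g] by blast
    qed
  qed
  hence "p \<in> \<A>" using p by (rule has_support_fixed)
  hence pH: "p \<in> hs_hom H H"
    using has_support_range[OF p hH LH] LH by (intro hs_homI) auto
  have ps: "p\<^sup>\<star> = p" using has_support_star[OF p] .
  have XL: "X * y \<in> L" if X: "X \<in> hs_hom H H" and y: "y \<in> L" for X y
  proof -
    have "X * y * 1 \<in> L"
    proof (rule span_mult_mem[OF _ _ y[unfolded L_def]])
      fix z assume "z \<in> {X * e * x | X x. X \<in> hs_hom H H \<and> x \<in> H}"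
      then obtain X' x where X': "z = X' * e * x" "X' \<in> hs_hom H H" "x \<in> H" by blast
      hence "X * z * 1 = (X * X') * e * x" by (simp add: mult.assoc)
      thus "X * z * 1 \<in> L"
        unfolding L_def using X' hs_hom_mult[OF X'(2) X]
        by (intro complex_vector.span_base) blast
    qed (simp add: L_def)
    thus ?thesis by simp
  qed
  have Xp: "p * X * p = X * p" if "X \<in> hs_hom H H" for X
    using has_support_mult_cong[OF p, of "p * X" X] has_support_fix[OF p XL[OF that]]
    by (simp add: mult.assoc)
  \<comment> \<open>\<open>L\<close> is stable under \<open>X\<close> and under its adjoint; the
    adjoint of the relation \<open>Xp\<close> for \<open>X\<^sup>\<star>\<close> reads
    \<open>p * X * p = p * X\<close>.\<close>
  have pX: "p * X = X * p" if "X \<in> hs_hom H H" for X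
    using Xp[OF that] arg_cong[OF Xp[OF hs_hom_star[OF sH hH that]], of star]
    by (simp add: star_simps ps mult.assoc)
  have pM: "p * X = X * p" if X: "X \<in> ?M" for X
  proof -
    obtain B h where B: "finite B" "B \<subseteq> \<Z>" "\<And>b. b \<in> B \<Longrightarrow> h b \<in> hs_hom H H"
      "X = (\<Sum>b\<in>B. h b * \<sigma> b)"
      using intertwiners_expand[OF H H X] by metis
    have "p * (h b * \<sigma> b) = h b * \<sigma> b * p" if "b \<in> B" for b
      using pX[OF B(3)[OF that]] B(2) that
        intertwinersD(2)[OF hs_hom_intertwiners[OF H H pH] center_fixed]
      by (metis mult.assoc subset_iff)
    thus ?thesis by (simp add: B(4) sum_distrib_left sum_distrib_right)
  qed
  have "p * e = e"
  proof (rule canonical_ext[OF H])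
    fix x assume "x \<in> H"
    hence "1 * e * x \<in> L"
      unfolding L_def using hs_hom_one by (intro complex_vector.span_base) blast
    thus "p * e * x = e * x" using has_support_fix[OF p] by (simp add: mult.assoc)
  qed
  have "f * p = 0 * p"
  proof (rule has_support_mult_cong[OF p])
    fix y assume y: "y \<in> L"
    have "f * y * 1 \<in> {0}"
      by (rule span_mult_mem[OF _ _ y[unfolded L_def]])
         (auto simp: fXe[OF hs_hom_intertwiners[OF H H]] simp flip: mult.assoc)
    thus "f * y = 0 * y" by simp
  qed
  hence TTp: "T * (T\<^sup>\<star> * p) = p" by (simp add: f_def algebra_simps)
  \<comment> \<open>The common endomorphism makes \<open>T\<close>, an arrow from \<open>H\<close>
    to \<open>K\<close>, a self-intertwiner. So its matrix in a basis of \<open>H\<close> alone is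
    central, and the trace identity applies to it.\<close>
  have TM: "T \<in> ?M" "T\<^sup>\<star> * p \<in> ?M"
    using hs_hom_intertwiners[OF H K TK] hs_hom_intertwiners[OF K H Ts] hs_hom_intertwiners[OF H H pH]
    by (auto intro: intertwiners_mult)
  obtain n \<Phi> where \<Phi>: "orthonormal_basis H n \<Phi>"
    using canonical_support[OF H] by (auto simp: has_support_def)
  let ?tr = "\<lambda>X. \<Sum>i<n. (\<Phi> i)\<^sup>\<star> * X * \<Phi> i"
  have "T\<^sup>\<star> * p * T = T\<^sup>\<star> * T * p"
    using pM[OF TM(1)] by (simp add: mult.assoc)
  also have "\<dots> = p - e"
    using pX[OF eH] \<open>p * e = e\<close> by (simp add: e_def algebra_simps)
  finally have "?tr (T * (T\<^sup>\<star> * p)) = ?tr (p - e)"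
    using intertwiner_trace_commute[OF H \<Phi> TM] by simp
  hence tr0: "?tr e = 0"
    unfolding TTp by (simp add: right_diff_distrib left_diff_distrib sum_subtractf)
  \<comment> \<open>\<open>e\<close> maps \<open>H\<close> into itself, so its diagonal entries are
    nonnegative numbers and not merely central elements; if their sum is 0, each of them is.\<close>
  have "\<exists>r\<ge>0. (e * \<Phi> i)\<^sup>\<star> * (e * \<Phi> i) = complex_of_real r *\<^sub>C 1" if "i < n" for i
    using hilbert_subspace_star_self[OF hH hs_hom_mem[OF eH onb_mem[OF \<Phi> that]]] by metis
  then obtain r where r: "\<And>i. i < n \<Longrightarrow> r i \<ge> 0"
    "\<And>i. i < n \<Longrightarrow> (e * \<Phi> i)\<^sup>\<star> * (e * \<Phi> i) = complex_of_real (r i) *\<^sub>C 1" by metis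
  have ei: "(\<Phi> i)\<^sup>\<star> * e * \<Phi> i = (e * \<Phi> i)\<^sup>\<star> * (e * \<Phi> i)" for i
    using e by (simp add: star_mult mult.assoc flip: mult.assoc[of e e])
  have "complex_of_real (\<Sum>i<n. r i) *\<^sub>C (1::'f) = 0"
    using tr0 r(2) by (simp add: ei complex_vector.scale_sum_left)
  hence "(\<Sum>i<n. r i) = 0" by (simp del: of_real_sum)
  hence "r i = 0" if "i < n" for i
    using that sum_nonneg_eq_0_iff[of "{..<n}" r] r(1) by simp
  hence e\<Phi>: "e * \<Phi> i = 0" if "i < n" for i using r(2) that by fastforce
  have "e = e * (\<Sum>i<n. \<Phi> i * (\<Phi> i)\<^sup>\<star>)" using onb_support_one[OF sH \<Phi>] by simp
  also have "\<dots> = 0" by (simp add: sum_distrib_left e\<Phi> flip: mult.assoc)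
  finally show ?thesis by (simp add: e_def)
qed

text \<open>Taking adjoints exchanges the two defects, so \<open>T\<close> and its adjoint are both
  maximal and both defects vanish.\<close>

lemma canonical_unitary:
  assumes H: "canonical H \<sigma>" and K: "canonical K \<sigma>"
  obtains Y where "Y \<in> hs_hom H K" "is_unitary Y"
proof -
  note sH = canonical_support[OF H] and sK = canonical_support[OF K]
    and hH = canonical_hilbert_subspace[OF H] and hK = canonical_hilbert_subspace[OF K]
  obtain T where T: "T \<in> partial_isometries H K"
    "\<And>X. X \<in> hs_hom H K \<Longrightarrow> (1 - T * T\<^sup>\<star>) * X * (1 - T\<^sup>\<star> * T) = 0"
    using maximal_partial_isometry_exists[OF sH canonical_invariant[OF H] sK] by metis
  have "T\<^sup>\<star> * T = 1" by (rule maximal_partial_isometry_isometry[OF H K T])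
  moreover have "(T\<^sup>\<star>)\<^sup>\<star> * T\<^sup>\<star> = 1"
  proof (rule maximal_partial_isometry_isometry[OF K H])
    have "T\<^sup>\<star> * (T\<^sup>\<star>)\<^sup>\<star> * T\<^sup>\<star> = (T * T\<^sup>\<star> * T)\<^sup>\<star>" by (simp add: star_simps mult.assoc)
    thus "T\<^sup>\<star> \<in> partial_isometries K H"
      using T(1) hs_hom_star[OF sH hK] by (simp add: partial_isometries_def)
    fix X assume "X \<in> hs_hom K H"
    from T(2)[OF hs_hom_star[OF sK hH this]]
    have "((1 - T * T\<^sup>\<star>) * X\<^sup>\<star> * (1 - T\<^sup>\<star> * T))\<^sup>\<star> = 0" by simp
    thus "(1 - T\<^sup>\<star> * (T\<^sup>\<star>)\<^sup>\<star>) * X * (1 - (T\<^sup>\<star>)\<^sup>\<star> * T\<^sup>\<star>) = 0"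
      by (simp add: star_simps mult.assoc)
  qed
  ultimately show ?thesis
    using that T(1) by (simp add: partial_isometries_def is_unitary_def star_star)
qed

end

section \<open>Unitary representations on Hilbert subspaces\<close>

lemma dist_coef: "x \<in> scalars \<Longrightarrow> y \<in> scalars \<Longrightarrow> dist (coef x) (coef y) = dist x y"
  by (auto simp: scalars_iff dist_norm simp flip: complex_vector.scale_left_diff_distrib)

text \<open>\<open>coef\<close> is isometric on \<open>scalars\<close>, so convergence passes to the
  coefficients.\<close>

lemma continuous_map_coef:
  assumes f: "continuous_map X euclidean f" and s: "\<And>x. x \<in> topspace X \<Longrightarrow> f x \<in> scalars"
  shows "continuous_map X euclidean (\<lambda>x. coef (f x))"
proof -
  have "((\<lambda>y. coef (f y)) \<longlongrightarrow> coef (f x)) (atin X x)" if x: "x \<in> topspace X" for x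
  proof -
    have "(f \<longlongrightarrow> f x) (atin X x)" using f x by (simp add: continuous_map_atin)
    hence "((\<lambda>y. dist (f y) (f x)) \<longlongrightarrow> 0) (atin X x)" by (simp only: tendsto_dist_iff[of f])
    moreover have "\<forall>\<^sub>F y in atin X x. dist (f y) (f x) = dist (coef (f y)) (coef (f x))"
      unfolding eventually_atin using x s
      by (intro disjI2 exI[of _ "topspace X"]) (auto simp: dist_coef)
    ultimately have "((\<lambda>y. dist (coef (f y)) (coef (f x))) \<longlongrightarrow> 0) (atin X x)"
      by (rule Lim_transform_eventually)
    thus ?thesis by (simp only: tendsto_dist_iff[of "\<lambda>y. coef (f y)"])
  qed
  thus ?thesis by (simp add: continuous_map_atin)
qed

lemma mat_adjoint_index:
  "A \<in> carrier_mat n n \<Longrightarrow> i < n \<Longrightarrow> j < n \<Longrightarrow> mat_adjoint A $$ (i, j) = cnj (A $$ (j, i))"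
  by (simp add: mat_adjoint_def mat_of_rows_def)

lemma mat_adjoint_carrier: "A \<in> carrier_mat n n \<Longrightarrow> mat_adjoint A \<in> carrier_mat n n"
  by (intro carrier_matI) (simp_all add: mat_adjoint_def)

text \<open>Orthonormal columns suffice: a left inverse of a square matrix is also a right
  inverse.\<close>

lemma unitary_repI:
  assumes "\<And>g i j. g \<in> carrier G \<Longrightarrow> i < n \<Longrightarrow> j < n \<Longrightarrow>
      (\<Sum>k<n. cnj (p g k i) * p g k j) = (if i = j then 1 else 0)"
    and "\<And>g h i j. g \<in> carrier G \<Longrightarrow> h \<in> carrier G \<Longrightarrow> i < n \<Longrightarrow> j < n \<Longrightarrow>
      p (g \<otimes>\<^bsub>G\<^esub> h) i j = (\<Sum>k<n. p g i k * p h k j)"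
    and "\<And>i j. i < n \<Longrightarrow> j < n \<Longrightarrow> continuous_map T euclidean (\<lambda>g. p g i j)"
  shows "unitary_rep G T n (\<lambda>g. mat n n (\<lambda>(i, j). p g i j))"
proof -
  let ?\<pi> = "\<lambda>g. mat n n (\<lambda>(i, j). p g i j)"
  have c: "?\<pi> g \<in> carrier_mat n n" for g by simp
  have u: "mat_adjoint (?\<pi> g) * ?\<pi> g = 1\<^sub>m n" if "g \<in> carrier G" for g
    using assms(1)[OF that] mat_adjoint_carrier[OF c[of g]]
    by (intro eq_matI) (auto simp: scalar_prod_def mat_adjoint_index[OF c] atLeast0LessThan)
  moreover have "?\<pi> g * mat_adjoint (?\<pi> g) = 1\<^sub>m n" if "g \<in> carrier G" for g
    using mat_mult_left_right_inverse[OF mat_adjoint_carrier[OF c] c u[OF that]] .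
  moreover have "?\<pi> (g \<otimes>\<^bsub>G\<^esub> h) = ?\<pi> g * ?\<pi> h" if "g \<in> carrier G" "h \<in> carrier G" for g h
    using assms(2)[OF that] by (intro eq_matI) (auto simp: scalar_prod_def atLeast0LessThan)
  ultimately show ?thesis
    using assms(3) by (simp add: unitary_rep_def)
qed

lemma unitary_repD:
  assumes "unitary_rep G T n \<pi>"
  shows unitary_rep_orthonormal: "g \<in> carrier G \<Longrightarrow> i < n \<Longrightarrow> j < n \<Longrightarrow>
      (\<Sum>k<n. cnj (\<pi> g $$ (k, i)) * \<pi> g $$ (k, j)) = (if i = j then 1 else 0)"
    and unitary_rep_orthonormal_rows: "g \<in> carrier G \<Longrightarrow> i < n \<Longrightarrow> j < n \<Longrightarrow>
      (\<Sum>k<n. \<pi> g $$ (i, k) * cnj (\<pi> g $$ (j, k))) = (if i = j then 1 else 0)"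
    and unitary_rep_mult: "g \<in> carrier G \<Longrightarrow> h \<in> carrier G \<Longrightarrow> i < n \<Longrightarrow> j < n \<Longrightarrow>
      \<pi> (g \<otimes>\<^bsub>G\<^esub> h) $$ (i, j) = (\<Sum>k<n. \<pi> g $$ (i, k) * \<pi> h $$ (k, j))"
    and unitary_rep_continuous: "i < n \<Longrightarrow> j < n \<Longrightarrow> continuous_map T euclidean (\<lambda>g. \<pi> g $$ (i, j))"
proof -
  assume *: "g \<in> carrier G" "i < n" "j < n"
  hence c: "\<pi> g \<in> carrier_mat n n" using assms by (simp add: unitary_rep_def)
  have "(\<Sum>k<n. cnj (\<pi> g $$ (k, i)) * \<pi> g $$ (k, j)) = (mat_adjoint (\<pi> g) * \<pi> g) $$ (i, j)"
    using * c mat_adjoint_carrier[OF c]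
    by (simp add: scalar_prod_def mat_adjoint_index[OF c] atLeast0LessThan)
  thus "(\<Sum>k<n. cnj (\<pi> g $$ (k, i)) * \<pi> g $$ (k, j)) = (if i = j then 1 else 0)"
    using assms * by (simp add: unitary_rep_def)
next
  assume *: "g \<in> carrier G" "i < n" "j < n"
  hence c: "\<pi> g \<in> carrier_mat n n" using assms by (simp add: unitary_rep_def)
  have "(\<Sum>k<n. \<pi> g $$ (i, k) * cnj (\<pi> g $$ (j, k))) = (\<pi> g * mat_adjoint (\<pi> g)) $$ (i, j)"
    using * c mat_adjoint_carrier[OF c]
    by (simp add: scalar_prod_def mat_adjoint_index[OF c] atLeast0LessThan)
  thus "(\<Sum>k<n. \<pi> g $$ (i, k) * cnj (\<pi> g $$ (j, k))) = (if i = j then 1 else 0)"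
    using assms * by (simp add: unitary_rep_def)
next
  assume *: "g \<in> carrier G" "h \<in> carrier G" "i < n" "j < n"
  hence "\<pi> g \<in> carrier_mat n n" "\<pi> h \<in> carrier_mat n n" "\<pi> (g \<otimes>\<^bsub>G\<^esub> h) = \<pi> g * \<pi> h"
    using assms by (simp_all add: unitary_rep_def)
  thus "\<pi> (g \<otimes>\<^bsub>G\<^esub> h) $$ (i, j) = (\<Sum>k<n. \<pi> g $$ (i, k) * \<pi> h $$ (k, j))"
    using * by (simp add: scalar_prod_def atLeast0LessThan)
next
  assume "i < n" "j < n"
  thus "continuous_map T euclidean (\<lambda>g. \<pi> g $$ (i, j))" using assms by (simp add: unitary_rep_def)
qed

lemma unitary_rep_conjugate:
  assumes "unitary_rep G T n \<pi>"
  shows "unitary_rep G T n (\<lambda>g. mat n n (\<lambda>(i, j). cnj (\<pi> g $$ (i, j))))"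
proof (rule unitary_repI)
  fix g i j assume *: "g \<in> carrier G" "i < n" "j < n"
  have "(\<Sum>k<n. cnj (cnj (\<pi> g $$ (k, i))) * cnj (\<pi> g $$ (k, j)))
      = cnj (\<Sum>k<n. cnj (\<pi> g $$ (k, i)) * \<pi> g $$ (k, j))" by simp
  thus "(\<Sum>k<n. cnj (cnj (\<pi> g $$ (k, i))) * cnj (\<pi> g $$ (k, j))) = (if i = j then 1 else 0)"
    unfolding unitary_rep_orthonormal[OF assms *] by simp
next
  fix i j assume "i < n" "j < n"
  thus "continuous_map T euclidean (\<lambda>g. cnj (\<pi> g $$ (i, j)))"
    using unitary_rep_continuous[OF assms]
    by (simp add: continuous_map_atin tendsto_cnj)
qed (simp add: unitary_rep_mult[OF assms])

text \<open>The action is kept abstract to serve twice: for left multiplication by unitaries of the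
  fixed point algebra and for the automorphisms themselves.\<close>

lemma unitary_rep_of_action:
  assumes w: "orthonormal_basis L m w" and top: "topspace T = carrier G"
    and mem: "\<And>g x. g \<in> carrier G \<Longrightarrow> x \<in> L \<Longrightarrow> \<beta> g x \<in> L"
    and mult: "\<And>g h x. g \<in> carrier G \<Longrightarrow> h \<in> carrier G \<Longrightarrow> x \<in> L \<Longrightarrow> \<beta> (g \<otimes>\<^bsub>G\<^esub> h) x = \<beta> g (\<beta> h x)"
    and add: "\<And>g x y. g \<in> carrier G \<Longrightarrow> \<beta> g (x + y) = \<beta> g x + \<beta> g y"
    and scaleC: "\<And>g c x. g \<in> carrier G \<Longrightarrow> \<beta> g (c *\<^sub>C x) = c *\<^sub>C \<beta> g x"
    and inner: "\<And>g x y. g \<in> carrier G \<Longrightarrow> x \<in> L \<Longrightarrow> y \<in> L \<Longrightarrow> (\<beta> g x)\<^sup>\<star> * \<beta> g y = x\<^sup>\<star> * y"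
    and cont: "\<And>x. x \<in> L \<Longrightarrow> continuous_map T euclidean (\<lambda>g. \<beta> g x)"
  defines "\<pi> \<equiv> \<lambda>g. mat m m (\<lambda>(i, j). coef ((w i)\<^sup>\<star> * \<beta> g (w j)))"
  shows unitary_rep_of_action_rep: "unitary_rep G T m \<pi>"
    and unitary_rep_of_action_basis:
      "g \<in> carrier G \<Longrightarrow> j < m \<Longrightarrow> \<beta> g (w j) = (\<Sum>i<m. \<pi> g $$ (i, j) *\<^sub>C w i)"
    and unitary_rep_of_action_sum:
      "g \<in> carrier G \<Longrightarrow> \<beta> g (\<Sum>j<m. c j *\<^sub>C w j) = (\<Sum>i<m. (\<Sum>j<m. \<pi> g $$ (i, j) * c j) *\<^sub>C w i)"
proof -
  let ?p = "\<lambda>g i j. coef ((w i)\<^sup>\<star> * \<beta> g (w j))"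
  have s: "(w i)\<^sup>\<star> * \<beta> g (w j) \<in> scalars" if "g \<in> carrier G" "i < m" "j < m" for g i j
    using onb_coef[OF w mem[OF that(1) onb_mem[OF w that(3)]] that(2)] .
  have expand: "\<beta> g (w j) = (\<Sum>i<m. ?p g i j *\<^sub>C w i)" if g: "g \<in> carrier G" and j: "j < m" for g j
  proof -
    have "\<beta> g (w j) = (\<Sum>i<m. w i * ((w i)\<^sup>\<star> * \<beta> g (w j)))"
      using onb_expand[OF w mem[OF g onb_mem[OF w j]]] by simp
    also have "\<dots> = (\<Sum>i<m. ?p g i j *\<^sub>C w i)"
      using s[OF g _ j] by (intro sum.cong refl) (simp add: scalars_mult_right)
    finally show ?thesis .
  qed
  have zero: "\<beta> g 0 = 0" if "g \<in> carrier G" for g using add[OF that, of 0 0] by simp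
  have sum: "\<beta> g (\<Sum>k\<in>I. c k *\<^sub>C w k) = (\<Sum>k\<in>I. c k *\<^sub>C \<beta> g (w k))"
    if g: "g \<in> carrier G" for g c and I :: "nat set"
    by (induction I rule: infinite_finite_induct) (simp_all add: add[OF g] scaleC[OF g] zero[OF g])
  have sum': "\<beta> g (\<Sum>j<m. c j *\<^sub>C w j) = (\<Sum>i<m. (\<Sum>j<m. ?p g i j * c j) *\<^sub>C w i)"
    if g: "g \<in> carrier G" for g c
  proof -
    have "\<beta> g (\<Sum>j<m. c j *\<^sub>C w j) = (\<Sum>j<m. \<Sum>i<m. (?p g i j * c j) *\<^sub>C w i)"
      unfolding sum[OF g]
    proof (intro sum.cong refl)
      fix j assume "j \<in> {..<m}"
      hence "c j *\<^sub>C \<beta> g (w j) = c j *\<^sub>C (\<Sum>i<m. ?p g i j *\<^sub>C w i)"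
        using arg_cong[OF expand[OF g, of j], of "(*\<^sub>C) (c j)"] by blast
      also have "\<dots> = (\<Sum>i<m. (?p g i j * c j) *\<^sub>C w i)"
        by (simp add: complex_vector.scale_sum_right scaleC_simps mult.commute)
      finally show "c j *\<^sub>C \<beta> g (w j) = (\<Sum>i<m. (?p g i j * c j) *\<^sub>C w i)" .
    qed
    also have "\<dots> = (\<Sum>i<m. (\<Sum>j<m. ?p g i j * c j) *\<^sub>C w i)"
      by (subst sum.swap) (simp add: complex_vector.scale_sum_left)
    finally show ?thesis .
  qed
  have wcoef: "coef ((w i)\<^sup>\<star> * (\<Sum>k<m. c k *\<^sub>C w k)) = c i" if "i < m" for c i
  proof -
    have "(w i)\<^sup>\<star> * (\<Sum>k<m. c k *\<^sub>C w k) = (\<Sum>k<m. if i = k then c k *\<^sub>C 1 else 0)"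
      unfolding sum_distrib_left using that
      by (intro sum.cong refl) (simp add: scaleC_simps onb_delta[OF w])
    also have "\<dots> = c i *\<^sub>C 1" using that by simp
    finally show ?thesis by simp
  qed
  show "unitary_rep G T m \<pi>"
    unfolding \<pi>_def
  proof (rule unitary_repI)
    fix g i j assume *: "g \<in> carrier G" "i < m" "j < m"
    have "(\<Sum>k<m. cnj (?p g k i) * ?p g k j) *\<^sub>C 1
        = (\<Sum>k<m. ((w k)\<^sup>\<star> * \<beta> g (w i))\<^sup>\<star> * ((w k)\<^sup>\<star> * \<beta> g (w j)))"
      unfolding complex_vector.scale_sum_left
    proof (intro sum.cong refl)
      fix k assume k: "k \<in> {..<m}"
      have "((w k)\<^sup>\<star> * \<beta> g (w i))\<^sup>\<star> * ((w k)\<^sup>\<star> * \<beta> g (w j)) = (?p g k i *\<^sub>C 1)\<^sup>\<star> * (?p g k j *\<^sub>C 1)"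
        using scaleC_coef[OF s] * k by simp
      thus "(cnj (?p g k i) * ?p g k j) *\<^sub>C 1
          = ((w k)\<^sup>\<star> * \<beta> g (w i))\<^sup>\<star> * ((w k)\<^sup>\<star> * \<beta> g (w j))"
        by (simp only: star_scaleC star_one scaleC_simps mult_1_left mult.commute)
    qed
    also have "\<dots> = (\<beta> g (w i))\<^sup>\<star> * (\<Sum>k<m. w k * ((w k)\<^sup>\<star> * \<beta> g (w j)))"
      by (simp add: sum_distrib_left star_mult star_star mult.assoc)
    also have "\<dots> = (w i)\<^sup>\<star> * w j"
      using * onb_expand[OF w mem[OF _ onb_mem[OF w]]] inner onb_mem[OF w] by simp
    also have "\<dots> = (if i = j then 1 else 0) *\<^sub>C 1"
      using * onb_delta[OF w] by (simp add: scaleC_one)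
    finally show "(\<Sum>k<m. cnj (?p g k i) * ?p g k j) = (if i = j then 1 else 0)"
      by (simp only: scaleC_one_cancel)
  next
    fix g h i j assume *: "g \<in> carrier G" "h \<in> carrier G" "i < m" "j < m"
    have "\<beta> (g \<otimes>\<^bsub>G\<^esub> h) (w j) = \<beta> g (\<Sum>k<m. ?p h k j *\<^sub>C w k)"
      unfolding expand[OF *(2,4), symmetric] using * mult onb_mem[OF w] by simp
    also have "\<dots> = (\<Sum>i<m. (\<Sum>k<m. ?p g i k * ?p h k j) *\<^sub>C w i)"
      by (rule sum'[OF *(1)])
    finally show "?p (g \<otimes>\<^bsub>G\<^esub> h) i j = (\<Sum>k<m. ?p g i k * ?p h k j)"
      using wcoef *(3) by simp
  next
    fix i j assume ij: "i < m" "j < m"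
    have "continuous_map T euclidean (\<lambda>g. (w i)\<^sup>\<star> * \<beta> g (w j))"
      using cont[OF onb_mem[OF w ij(2)]] by (simp add: continuous_map_atin tendsto_mult_left)
    thus "continuous_map T euclidean (\<lambda>g. ?p g i j)"
      by (rule continuous_map_coef) (use s ij top in auto)
  qed
  show "g \<in> carrier G \<Longrightarrow> j < m \<Longrightarrow> \<beta> g (w j) = (\<Sum>i<m. \<pi> g $$ (i, j) *\<^sub>C w i)"
    using expand by (simp add: \<pi>_def)
  show "g \<in> carrier G \<Longrightarrow> \<beta> g (\<Sum>j<m. c j *\<^sub>C w j) = (\<Sum>i<m. (\<Sum>j<m. \<pi> g $$ (i, j) * c j) *\<^sub>C w i)"
    using sum' by (simp add: \<pi>_def)
qed

text \<open>Inserting the sum 1 between \<open>V\<^sup>\<star>\<close> and \<open>W\<close> shows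
  that \<open>V\<^sup>\<star> * W\<close> equals twice itself.\<close>

lemma property_B_orthogonal:
  assumes "V\<^sup>\<star> * V = 1" "W\<^sup>\<star> * W = (1::'a::cstar_algebra)" "V * V\<^sup>\<star> + W * W\<^sup>\<star> = 1"
  shows "V\<^sup>\<star> * W = 0" "W\<^sup>\<star> * V = 0"
proof -
  have "V\<^sup>\<star> * (V * V\<^sup>\<star> + W * W\<^sup>\<star>) * W = (V\<^sup>\<star> * V) * (V\<^sup>\<star> * W) + (V\<^sup>\<star> * W) * (W\<^sup>\<star> * W)"
    by (simp add: distrib_left distrib_right mult.assoc)
  thus VW: "V\<^sup>\<star> * W = 0" by (simp add: assms)
  have "W\<^sup>\<star> * V = (V\<^sup>\<star> * W)\<^sup>\<star>" by (simp add: star_simps)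
  thus "W\<^sup>\<star> * V = 0" by (simp add: VW)
qed

section \<open>Realizing representations by means of Property B\<close>

locale hilbert_action = star_action G \<alpha>
  for G :: "('g, 'b) monoid_scheme" and \<alpha> :: "'g \<Rightarrow> 'f::cstar_algebra \<Rightarrow> 'f" +
  fixes T :: "'g topology"
  assumes topspace_eq: "topspace T = carrier G"
    and continuous: "continuous_map T euclidean (\<lambda>g. \<alpha> g F)"
    and irreducible_carried: "irreducible_rep G T n \<pi> \<Longrightarrow>
      \<exists>H. invariant_hilbert_space G \<alpha> H \<and> carries_rep G \<alpha> H n \<pi>"
    and property_B: "property_B \<A>"
begin

lemma property_B_obtain:
  obtains V W where "V \<in> \<A>" "W \<in> \<A>" "V\<^sup>\<star> * V = 1" "W\<^sup>\<star> * W = 1" "V * V\<^sup>\<star> + W * W\<^sup>\<star> = 1"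
    "V\<^sup>\<star> * W = 0" "W\<^sup>\<star> * V = 0"
proof -
  obtain V W where "V \<in> \<A>" "W \<in> \<A>" "V\<^sup>\<star> * V = 1" "W\<^sup>\<star> * W = 1" "V * V\<^sup>\<star> + W * W\<^sup>\<star> = 1"
    using property_B by (auto simp: property_B_def is_isometry_def)
  with property_B_orthogonal[of V W] show ?thesis using that by metis
qed

text \<open>Cuntz isometries: the \<open>V * S i\<close> together with \<open>W\<close> form a
  family with one more member. Their span is a Hilbert space of invariant vectors of any prescribed
  dimension, on which \<open>unitary_rep_carried\<close> is built.\<close>

lemma fixed_orthonormal_exists:
  assumes "(n::nat) > 0"
  shows "\<exists>S. (\<forall>i<n. S i \<in> \<A>) \<and> orthonormal {..<n} S \<and> (\<Sum>i<n. S i * (S i)\<^sup>\<star>) = 1"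
  using assms
proof (induction n)
  case (Suc n)
  show ?case
  proof (cases "n = 0")
    case True
    thus ?thesis
      by (intro exI[of _ "\<lambda>_. 1"]) (auto simp: orthonormal_def fixed_one)
  next
    case False
    then obtain S where S: "\<forall>i<n. S i \<in> \<A>" "orthonormal {..<n} S" "(\<Sum>i<n. S i * (S i)\<^sup>\<star>) = 1"
      using Suc by blast
    obtain V W where VW: "V \<in> \<A>" "W \<in> \<A>" "V\<^sup>\<star> * V = 1" "W\<^sup>\<star> * W = 1" "V * V\<^sup>\<star> + W * W\<^sup>\<star> = 1"
      "V\<^sup>\<star> * W = 0" "W\<^sup>\<star> * V = 0" by (rule property_B_obtain)
    have z: "(V * x)\<^sup>\<star> * W = 0" "W\<^sup>\<star> * (V * x) = 0" "(V * x)\<^sup>\<star> * (V * y) = x\<^sup>\<star> * y" for x y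
    proof -
      have "(V * x)\<^sup>\<star> * W = x\<^sup>\<star> * (V\<^sup>\<star> * W)" "W\<^sup>\<star> * (V * x) = (W\<^sup>\<star> * V) * x"
        "(V * x)\<^sup>\<star> * (V * y) = x\<^sup>\<star> * (V\<^sup>\<star> * V) * y" by (simp_all add: star_mult mult.assoc)
      thus "(V * x)\<^sup>\<star> * W = 0" "W\<^sup>\<star> * (V * x) = 0" "(V * x)\<^sup>\<star> * (V * y) = x\<^sup>\<star> * y" by (simp_all add: VW)
    qed
    define R where "R i = (if i < n then V * S i else W)" for i
    have "\<forall>i<Suc n. R i \<in> \<A>" using S VW by (auto simp: R_def intro: fixed_mult)
    moreover have "orthonormal {..<Suc n} R"
      using S(2) VW by (auto simp: R_def orthonormal_def z less_Suc_eq)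
    moreover have "(\<Sum>i<n. R i * (R i)\<^sup>\<star>) = V * (\<Sum>i<n. S i * (S i)\<^sup>\<star>) * V\<^sup>\<star>"
      by (simp add: R_def star_mult sum_distrib_left sum_distrib_right mult.assoc)
    hence "(\<Sum>i<Suc n. R i * (R i)\<^sup>\<star>) = 1" using S(3) VW by (simp add: R_def)
    ultimately show ?thesis by blast
  qed
qed simp

text \<open>The induction is on the dimension of \<open>L\<close>: an irreducible \<open>L\<close> is carried by assumption, and
  a reducible one is put together by the isometries of Property B.\<close>

lemma carry_subspace:
  assumes E: "hilbert_subspace E" "E \<subseteq> \<A>"
    and UA: "\<And>g. g \<in> carrier G \<Longrightarrow> U g \<in> \<A>"
    and Umult: "\<And>g h. g \<in> carrier G \<Longrightarrow> h \<in> carrier G \<Longrightarrow> U (g \<otimes>\<^bsub>G\<^esub> h) = U g * U h"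
    and Uunitary: "\<And>g. g \<in> carrier G \<Longrightarrow> (U g)\<^sup>\<star> * U g = 1"
    and Ucont: "continuous_map T euclidean U"
  shows "L \<subseteq> E \<Longrightarrow> orthonormal_basis L m w \<Longrightarrow> m > 0 \<Longrightarrow>
    (\<And>g x. g \<in> carrier G \<Longrightarrow> x \<in> L \<Longrightarrow> U g * x \<in> L) \<Longrightarrow>
    \<exists>X. X\<^sup>\<star> * X = (\<Sum>i<m. w i * (w i)\<^sup>\<star>) \<and> X * X\<^sup>\<star> = 1 \<and> (\<forall>g\<in>carrier G. \<alpha> g X = X * U g)"
proof (induction m arbitrary: L w rule: less_induct)
  case (less m L w)
  interpret G: Group.group G by (rule group)
  note LE = less.prems(1) and w = less.prems(2) and UL = less.prems(4)
  have L: "hilbert_subspace L" using w by (auto simp: hilbert_subspace_def)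
  note cL = onb_subspace[OF w]
  have Ustar: "(U g)\<^sup>\<star> = U (inv\<^bsub>G\<^esub> g)" if g: "g \<in> carrier G" for g
  proof -
    have "U \<one>\<^bsub>G\<^esub> * U \<one>\<^bsub>G\<^esub> = U \<one>\<^bsub>G\<^esub>" using Umult[of "\<one>\<^bsub>G\<^esub>" "\<one>\<^bsub>G\<^esub>"] by simp
    hence "(U \<one>\<^bsub>G\<^esub>)\<^sup>\<star> * U \<one>\<^bsub>G\<^esub> * U \<one>\<^bsub>G\<^esub> = (U \<one>\<^bsub>G\<^esub>)\<^sup>\<star> * U \<one>\<^bsub>G\<^esub>" by (simp add: mult.assoc)
    hence U1: "U \<one>\<^bsub>G\<^esub> = 1" by (simp add: Uunitary)
    have "(U g)\<^sup>\<star> = (U g)\<^sup>\<star> * (U g * U (inv\<^bsub>G\<^esub> g))"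
      using Umult[of g "inv\<^bsub>G\<^esub> g"] g U1 by simp
    also have "\<dots> = U (inv\<^bsub>G\<^esub> g)" using Uunitary[OF g] by (simp flip: mult.assoc)
    finally show ?thesis .
  qed
  define P where "P = (\<Sum>i<m. w i * (w i)\<^sup>\<star>)"
  have P: "has_support L P" using w by (auto simp: has_support_def P_def)
  define \<pi> where "\<pi> = (\<lambda>g. mat m m (\<lambda>(i, j). coef ((w i)\<^sup>\<star> * (U g * w j))))"
  have inner: "(U g * x)\<^sup>\<star> * (U g * y) = x\<^sup>\<star> * y" if "g \<in> carrier G" for g x y
    using Uunitary[OF that] by (simp add: star_mult mult.assoc) (simp flip: mult.assoc)
  have cont: "continuous_map T euclidean (\<lambda>g. U g * x)" for x
    using Ucont by (simp add: continuous_map_atin tendsto_mult_right)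
  have Umult': "U (g \<otimes>\<^bsub>G\<^esub> h) * x = U g * (U h * x)" if "g \<in> carrier G" "h \<in> carrier G" for g h x
    using Umult[OF that] by (simp add: mult.assoc)
  note action = Umult' distrib_left mult_scaleC_right inner cont
  have rep: "unitary_rep G T m \<pi>"
    unfolding \<pi>_def by (rule unitary_rep_of_action_rep[where \<beta> = "\<lambda>g x. U g * x", OF w topspace_eq])
      (simp_all add: UL action)
  have basis: "U g * w j = (\<Sum>i<m. \<pi> g $$ (i, j) *\<^sub>C w i)" if "g \<in> carrier G" "j < m" for g j
    unfolding \<pi>_def by (rule unitary_rep_of_action_basis[where \<beta> = "\<lambda>g x. U g * x", OF w topspace_eq])
      (simp_all add: UL action that)
  have sum: "U g * (\<Sum>j<m. c j *\<^sub>C w j) = (\<Sum>i<m. (\<Sum>j<m. \<pi> g $$ (i, j) * c j) *\<^sub>C w i)"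
    if "g \<in> carrier G" for g c
    unfolding \<pi>_def by (rule unitary_rep_of_action_sum[where \<beta> = "\<lambda>g x. U g * x", OF w topspace_eq])
      (simp_all add: UL action that)
  show ?case
  proof (cases "irreducible_rep G T m \<pi>")
    case True
    then obtain H \<Phi> where H: "invariant_hilbert_space G \<alpha> H" and \<Phi>: "orthonormal_basis H m \<Phi>"
      "\<And>g j. g \<in> carrier G \<Longrightarrow> j < m \<Longrightarrow> \<alpha> g (\<Phi> j) = (\<Sum>i<m. \<pi> g $$ (i, j) *\<^sub>C \<Phi> i)"
      using irreducible_carried[OF True] unfolding carries_rep_def by blast
    have \<Phi>1: "(\<Sum>i<m. \<Phi> i * (\<Phi> i)\<^sup>\<star>) = 1"
      using H \<Phi>(1) onb_support_one by (auto simp: invariant_hilbert_space_iff)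
    have collapse: "(\<Sum>k<m. \<Phi> k * (w k)\<^sup>\<star>) * w j = \<Phi> j" "(\<Sum>k<m. w k * (\<Phi> k)\<^sup>\<star>) * \<Phi> j = w j"
      if "j < m" for j
    proof -
      have "(\<Sum>k<m. \<Phi> k * (w k)\<^sup>\<star>) * w j = (\<Sum>k<m. if k = j then \<Phi> k else 0)"
        unfolding sum_distrib_right using that
        by (intro sum.cong refl) (simp add: mult.assoc onb_delta[OF w])
      thus "(\<Sum>k<m. \<Phi> k * (w k)\<^sup>\<star>) * w j = \<Phi> j" using that by simp
      have "(\<Sum>k<m. w k * (\<Phi> k)\<^sup>\<star>) * \<Phi> j = (\<Sum>k<m. if k = j then w k else 0)"
        unfolding sum_distrib_right using that
        by (intro sum.cong refl) (simp add: mult.assoc onb_delta[OF \<Phi>(1)])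
      thus "(\<Sum>k<m. w k * (\<Phi> k)\<^sup>\<star>) * \<Phi> j = w j" using that by simp
    qed
    \<comment> \<open>Matches the basis of \<open>L\<close> with the basis of \<open>H\<close> that
      has the same matrices. The \<open>w k\<close> are fixed by the automorphisms, so acting on
      \<open>X\<close> affects the \<open>\<Phi> k\<close> only and amounts to right multiplication
      by \<open>U g\<close>.\<close>
    define X where "X = (\<Sum>k<m. \<Phi> k * (w k)\<^sup>\<star>)"
    have Xs: "X\<^sup>\<star> = (\<Sum>k<m. w k * (\<Phi> k)\<^sup>\<star>)" by (simp add: X_def star_simps)
    have "X\<^sup>\<star> * X = P"
      unfolding P_def by (subst X_def) (simp add: sum_distrib_left Xs collapse flip: mult.assoc)
    moreover have XX: "X * X\<^sup>\<star> = 1"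
      unfolding \<Phi>1[symmetric] Xs by (simp add: X_def sum_distrib_left collapse flip: mult.assoc)
    moreover have "\<alpha> g X = X * U g" if g: "g \<in> carrier G" for g
    proof -
      have wA: "w k \<in> \<A>" if "k < m" for k using onb_mem[OF w that] LE E by auto
      have "\<alpha> g X = (\<Sum>k<m. (\<Sum>i<m. \<pi> g $$ (i, k) *\<^sub>C \<Phi> i) * (w k)\<^sup>\<star>)"
        by (simp add: X_def act_sum[OF g] act_mult[OF g] act_star[OF g] \<Phi>(2)[OF g] fixedD[OF wA g])
      also have "\<dots> = (\<Sum>k<m. X * (U g * w k) * (w k)\<^sup>\<star>)"
      proof (intro sum.cong refl)
        fix k assume k: "k \<in> {..<m}"
        have "X * (U g * w k) = (\<Sum>i<m. \<pi> g $$ (i, k) *\<^sub>C (X * w i))"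
          using basis[OF g] k by (simp add: sum_distrib_left scaleC_simps)
        also have "\<dots> = (\<Sum>i<m. \<pi> g $$ (i, k) *\<^sub>C \<Phi> i)" by (simp add: X_def collapse)
        finally show "(\<Sum>i<m. \<pi> g $$ (i, k) *\<^sub>C \<Phi> i) * (w k)\<^sup>\<star> = X * (U g * w k) * (w k)\<^sup>\<star>" by simp
      qed
      also have "\<dots> = X * (U g * P)"
        by (simp add: P_def sum_distrib_left mult.assoc)
      also have "\<dots> = X * (P * U g)"
      proof -
        \<comment> \<open>\<open>L\<close> is stable under \<open>U g\<close> and, through the
          inverse group element, under its adjoint; hence the projection \<open>P\<close> commutes
          with \<open>U g\<close>.\<close>
        have PUP: "P * (U h * P) = U h * P" if "h \<in> carrier G" for h
          using has_support_mult_cong[OF P, of "P * U h" "U h"] has_support_fix[OF P UL[OF that]]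
          by (simp add: mult.assoc)
        have "P * U g = ((U g)\<^sup>\<star> * P)\<^sup>\<star>" by (simp add: star_simps has_support_star[OF P])
        also have "\<dots> = (P * ((U g)\<^sup>\<star> * P))\<^sup>\<star>" using PUP g by (simp add: Ustar)
        also have "\<dots> = U g * P"
          using PUP[OF g] by (simp add: star_simps has_support_star[OF P] mult.assoc)
        finally show ?thesis by simp
      qed
      also have "X * (P * U g) = X * U g"
      proof -
        have "X * P = X" using \<open>X\<^sup>\<star> * X = P\<close> XX by (metis mult.assoc mult_1_left)
        thus ?thesis by (simp flip: mult.assoc)
      qed
      finally show ?thesis .
    qed
    ultimately show ?thesis unfolding P_def by blast
  next
    case False
    then obtain W where W': "W \<subseteq> carrier_vec m"
      "0\<^sub>v m \<in> W \<and> (\<forall>v\<in>W. \<forall>w\<in>W. v + w \<in> W) \<and> (\<forall>c. \<forall>v\<in>W. c \<cdot>\<^sub>v v \<in> W) \<and>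
        (\<forall>g\<in>carrier G. \<forall>v\<in>W. \<pi> g *\<^sub>v v \<in> W)"
      "\<not> (W = {0\<^sub>v m} \<or> W = carrier_vec m)"
      using rep less.prems(3) unfolding irreducible_rep_def by blast
    hence W: "W \<subseteq> carrier_vec m" "0\<^sub>v m \<in> W"
      "\<And>v u. v \<in> W \<Longrightarrow> u \<in> W \<Longrightarrow> v + u \<in> W" "\<And>c v. v \<in> W \<Longrightarrow> c \<cdot>\<^sub>v v \<in> W"
      "\<And>g v. g \<in> carrier G \<Longrightarrow> v \<in> W \<Longrightarrow> \<pi> g *\<^sub>v v \<in> W" "W \<noteq> {0\<^sub>v m}" "W \<noteq> carrier_vec m"
      by blast+
    define f where "f v = (\<Sum>j<m. v $ j *\<^sub>C w j)" for v
    have fL: "f v \<in> L" for v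
      unfolding f_def using onb_mem[OF w] cL
      by (intro complex_vector.subspace_sum complex_vector.subspace_scale) auto
    have f_add: "f (v + u) = f v + f u" if "v \<in> carrier_vec m" "u \<in> carrier_vec m" for v u
      using that by (simp add: f_def scaleC_add_left sum.distrib)
    have f_scale: "f (c \<cdot>\<^sub>v v) = c *\<^sub>C f v" if "v \<in> carrier_vec m" for c v
      using that by (simp add: f_def complex_vector.scale_sum_right scaleC_simps)
    have f_inj: "v = u" if "f v = f u" "v \<in> carrier_vec m" "u \<in> carrier_vec m" for v u
    proof (rule eq_vecI)
      have "(\<Sum>j<m. (v $ j - u $ j) *\<^sub>C w j) = 0"
        using that(1) by (simp add: f_def complex_vector.scale_left_diff_distrib sum_subtractf)
      hence "v $ j - u $ j = 0" if "j < m" for j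
        using orthonormal_scaleC_sum_eq_0[of "{..<m}" w "\<lambda>j. v $ j - u $ j" j] w that
        by (simp add: orthonormal_basis_iff)
      thus "v $ j = u $ j" if "j < dim_vec u" for j using that \<open>u \<in> _\<close> by simp
    qed (use that in simp)
    define L1 where "L1 = f ` W"
    have cL1: "csubspace L1"
      unfolding complex_vector.subspace_def
    proof (intro conjI ballI allI)
      show "0 \<in> L1" unfolding L1_def using W(2) by (intro image_eqI[of _ _ "0\<^sub>v m"]) (simp_all add: f_def)
    next
      fix x y assume "x \<in> L1" "y \<in> L1"
      then obtain v u where "v \<in> W" "u \<in> W" "x = f v" "y = f u" by (auto simp: L1_def)
      thus "x + y \<in> L1"
        unfolding L1_def using W(1,3) f_add[of v u]
        by (intro image_eqI[of _ _ "v + u"]) (auto simp: subset_iff)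
    next
      fix c x assume "x \<in> L1"
      then obtain v where "v \<in> W" "x = f v" by (auto simp: L1_def)
      thus "c *\<^sub>C x \<in> L1"
        unfolding L1_def using W(1,4) f_scale[of v c]
        by (intro image_eqI[of _ _ "c \<cdot>\<^sub>v v"]) (auto simp: subset_iff)
    qed
    have L1L: "L1 \<subseteq> L" using fL by (auto simp: L1_def)
    have L1U: "U g * x \<in> L1" if g: "g \<in> carrier G" and x: "x \<in> L1" for g x
    proof -
      obtain v where v: "v \<in> W" "x = f v" using x by (auto simp: L1_def)
      have vm: "v \<in> carrier_vec m" using v W(1) by auto
      have \<pi>m: "\<pi> g \<in> carrier_mat m m" by (simp add: \<pi>_def)
      have "U g * x = f (\<pi> g *\<^sub>v v)"
        unfolding v(2) f_def sum[OF g] using vm \<pi>m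
        by (intro sum.cong refl) (simp add: scalar_prod_def atLeast0LessThan)
      thus ?thesis using W(5)[OF g v(1)] by (simp add: L1_def)
    qed
    have L1_ne: "L1 \<noteq> {0}"
    proof
      assume "L1 = {0}"
      hence "f v = 0" if "v \<in> W" for v using that by (auto simp: L1_def)
      hence "f v = f (0\<^sub>v m)" if "v \<in> W" for v using that W(2) by simp
      hence "v = 0\<^sub>v m" if "v \<in> W" for v using f_inj that W(1,2) by blast
      with W(2,6) show False by blast
    qed
    have L1_ne': "L1 \<noteq> L"
    proof
      assume "L1 = L"
      have "v \<in> W" if v: "v \<in> carrier_vec m" for v
      proof -
        have "f v \<in> f ` W" using fL \<open>L1 = L\<close> by (auto simp: L1_def)
        then obtain u where "u \<in> W" "f v = f u" by auto
        thus ?thesis using f_inj[of v u] v W(1) by auto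
      qed
      with W(1,7) show False by blast
    qed
    \<comment> \<open>The orthogonal complement of \<open>L1\<close> in \<open>L\<close>. It is
      stable because the adjoint of \<open>U g\<close> is \<open>U\<close> at the inverse of
      \<open>g\<close>, which preserves \<open>L1\<close>.\<close>
    define L2 where "L2 = {x\<in>L. \<forall>y\<in>L1. y\<^sup>\<star> * x = 0}"
    have cL2: "csubspace L2"
      using cL by (auto simp: L2_def complex_vector.subspace_def distrib_left scaleC_simps)
    have L2L: "L2 \<subseteq> L" by (auto simp: L2_def)
    have L2U: "U g * x \<in> L2" if g: "g \<in> carrier G" and x: "x \<in> L2" for g x
    proof -
      have "y\<^sup>\<star> * (U g * x) = 0" if y: "y \<in> L1" for y
      proof -
        have "y\<^sup>\<star> * (U g * x) = ((U g)\<^sup>\<star> * y)\<^sup>\<star> * x" by (simp add: star_simps mult.assoc)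
        also have "(U g)\<^sup>\<star> * y \<in> L1" using L1U y g by (simp add: Ustar)
        hence "((U g)\<^sup>\<star> * y)\<^sup>\<star> * x = 0" using x by (simp add: L2_def)
        finally show ?thesis .
      qed
      thus ?thesis using x UL[OF g] by (auto simp: L2_def)
    qed
    have L2_ne': "L2 \<noteq> L"
    proof
      assume "L2 = L"
      obtain y where "y \<in> L1" "y \<noteq> 0" using L1_ne complex_vector.subspace_0[OF cL1] by auto
      moreover have "y \<in> L2" using \<open>L2 = L\<close> \<open>y \<in> L1\<close> L1L by blast
      hence "y\<^sup>\<star> * y = 0" using \<open>y \<in> L1\<close> unfolding L2_def by blast
      ultimately show False by simp
    qed
    obtain m1 w1 where w1: "orthonormal_basis L1 m1 w1" "m1 < m"
      by (rule onb_subspace_exists[OF w cL1 L1L]) (use L1_ne' in simp)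
    obtain m2 w2 where w2: "orthonormal_basis L2 m2 w2" "m2 < m"
      by (rule onb_subspace_exists[OF w cL2 L2L]) (use L2_ne' in simp)
    define P1 where "P1 = (\<Sum>i<m1. w1 i * (w1 i)\<^sup>\<star>)"
    define P2 where "P2 = (\<Sum>i<m2. w2 i * (w2 i)\<^sup>\<star>)"
    have P1: "has_support L1 P1" and P2: "has_support L2 P2"
      using w1 w2 by (auto simp: has_support_def P1_def P2_def)
    have P1L2: "P1 * x = 0" if "x \<in> L2" for x
      using that onb_mem[OF w1(1)] by (simp add: P1_def sum_distrib_right mult.assoc L2_def)
    have P12: "P1 * P2 = 0"
      using has_support_mult_cong[OF P2, of P1 0] P1L2 by simp
    have split: "x - P1 * x \<in> L2" if x: "x \<in> L" for x
    proof -
      have "P1 * x \<in> L1" by (rule has_support_range[OF P1 L L1L x])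
      moreover have "y\<^sup>\<star> * (x - P1 * x) = 0" if "y \<in> L1" for y
      proof -
        have "y\<^sup>\<star> * (x - P1 * x) = (y - P1 * y)\<^sup>\<star> * x"
          by (simp add: star_simps has_support_star[OF P1] algebra_simps)
        thus ?thesis using has_support_fix[OF P1 that] by simp
      qed
      ultimately show ?thesis
        using x L1L complex_vector.subspace_diff[OF cL] by (auto simp: L2_def)
    qed
    have "m1 > 0" using L1_ne w1 by (auto simp: orthonormal_basis_iff intro!: Nat.gr0I)
    moreover have "m2 > 0"
    proof (rule Nat.gr0I)
      assume "m2 = 0"
      hence "L2 = {0}" using w2 by (auto simp: orthonormal_basis_iff)
      hence "x = P1 * x" if "x \<in> L" for x using split[OF that] by simp
      hence "L \<subseteq> L1" using has_support_range[OF P1 L L1L] by fastforce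
      with L1_ne' L1L show False by blast
    qed
    ultimately obtain X1 X2 where X1: "X1\<^sup>\<star> * X1 = P1" "X1 * X1\<^sup>\<star> = 1" "\<And>g. g \<in> carrier G \<Longrightarrow> \<alpha> g X1 = X1 * U g"
      and X2: "X2\<^sup>\<star> * X2 = P2" "X2 * X2\<^sup>\<star> = 1" "\<And>g. g \<in> carrier G \<Longrightarrow> \<alpha> g X2 = X2 * U g"
      using less.IH[OF w1(2) subset_trans[OF L1L LE] w1(1) _ L1U]
        less.IH[OF w2(2) subset_trans[OF L2L LE] w2(1) _ L2U] unfolding P1_def P2_def by blast
    have X12: "X1 * X2\<^sup>\<star> = 0"
    proof -
      have "X1 = X1 * P1" using X1 by (metis mult.assoc mult_1_left)
      moreover have "X2\<^sup>\<star> = P2 * X2\<^sup>\<star>" using X2 by (metis mult.assoc mult_1_right)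
      ultimately have "X1 * X2\<^sup>\<star> = X1 * (P1 * P2) * X2\<^sup>\<star>" by (metis mult.assoc)
      thus ?thesis by (simp add: P12)
    qed
    have X21: "X2 * X1\<^sup>\<star> = 0" using arg_cong[OF X12, of star] by (simp add: star_simps)
    obtain V W where VW: "V \<in> \<A>" "W \<in> \<A>" "V\<^sup>\<star> * V = 1" "W\<^sup>\<star> * W = 1" "V * V\<^sup>\<star> + W * W\<^sup>\<star> = 1"
      "V\<^sup>\<star> * W = 0" "W\<^sup>\<star> * V = 0" by (rule property_B_obtain)
    \<comment> \<open>\<open>X1\<close> and \<open>X2\<close> have orthogonal initial projections,
      but both have final projection 1. \<open>V\<close> and \<open>W\<close> place the two ranges
      side by side, so that the final projection is again 1; being fixed, they leave the
      transformation law intact.\<close>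
    define X where "X = V * X1 + W * X2"
    have "X\<^sup>\<star> * X = X1\<^sup>\<star> * (V\<^sup>\<star> * V) * X1 + X1\<^sup>\<star> * (V\<^sup>\<star> * W) * X2
        + X2\<^sup>\<star> * (W\<^sup>\<star> * V) * X1 + X2\<^sup>\<star> * (W\<^sup>\<star> * W) * X2"
      by (simp add: X_def star_simps algebra_simps)
    hence XX: "X\<^sup>\<star> * X = P1 + P2" by (simp add: VW X1 X2)
    have "X * X\<^sup>\<star> = V * (X1 * X1\<^sup>\<star>) * V\<^sup>\<star> + V * (X1 * X2\<^sup>\<star>) * W\<^sup>\<star>
        + W * (X2 * X1\<^sup>\<star>) * V\<^sup>\<star> + W * (X2 * X2\<^sup>\<star>) * W\<^sup>\<star>"
      by (simp add: X_def star_simps algebra_simps)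
    hence "X * X\<^sup>\<star> = 1" by (simp add: X1 X2 X12 X21 VW)
    moreover have "\<alpha> g X = X * U g" if g: "g \<in> carrier G" for g
      using VW by (simp add: X_def act_add[OF g] act_mult[OF g] fixedD[OF _ g] X1(3)[OF g] X2(3)[OF g]
          distrib_right mult.assoc)
    moreover have "P1 + P2 = P"
    proof -
      have "(P1 + P2) * x = 1 * x" if "x \<in> L" for x
      proof -
        have "P2 * x = P2 * (x - P1 * x) + (P1 * P2)\<^sup>\<star> * x"
          by (simp add: algebra_simps star_simps has_support_star[OF P1] has_support_star[OF P2])
        also have "\<dots> = x - P1 * x" using has_support_fix[OF P2 split[OF that]] P12 by simp
        finally show ?thesis by (simp add: distrib_right)
      qed
      hence 1: "(P1 + P2) * P = P" using has_support_mult_cong[OF P, of "P1 + P2" 1] by simp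
      have "P * P1 = P1"
        using has_support_mult_cong[OF P1, of P 1] has_support_fix[OF P] L1L by (auto simp: subset_iff)
      moreover have "P * P2 = P2"
        using has_support_mult_cong[OF P2, of P 1] has_support_fix[OF P] L2L by (auto simp: subset_iff)
      ultimately have "P * (P1 + P2) = P1 + P2" by (simp add: distrib_left)
      hence "(P * (P1 + P2))\<^sup>\<star> = (P1 + P2)\<^sup>\<star>" by simp
      hence "(P1 + P2) * P = P1 + P2"
        by (simp add: star_simps has_support_star[OF P] has_support_star[OF P1] has_support_star[OF P2])
      with 1 show ?thesis by simp
    qed
    ultimately show ?thesis using XX unfolding P_def by metis
  qed
qed

text \<open>The matrices of \<open>\<pi>\<close> are copied to unitaries \<open>U g\<close> of
  \<open>\<A>\<close> that act on a space of invariant vectors \<open>S j\<close>. For this whole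
  space \<open>carry_subspace\<close> gives a unitary \<open>X\<close> with
  \<open>\<alpha> g X = X * U g\<close>, so the vectors \<open>X * S j\<close> transform by
  \<open>\<pi>\<close>.\<close>

lemma unitary_rep_carried:
  assumes rep: "unitary_rep G T n \<pi>" and n: "n > 0"
  shows "\<exists>\<Theta> H. orthonormal_basis H n \<Theta> \<and> has_support H 1 \<and> invariant H \<and>
    (\<forall>g\<in>carrier G. \<forall>j<n. \<alpha> g (\<Theta> j) = (\<Sum>i<n. \<pi> g $$ (i, j) *\<^sub>C \<Theta> i))"
proof -
  obtain S where S: "\<And>i. i < n \<Longrightarrow> S i \<in> \<A>" "orthonormal {..<n} S" "(\<Sum>i<n. S i * (S i)\<^sup>\<star>) = 1"
    using fixed_orthonormal_exists[OF n] by blast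
  define E where "E = cspan (S ` {..<n})"
  have onb: "orthonormal_basis E n S" using S(2) by (simp add: orthonormal_basis_iff E_def)
  have sE: "has_support E 1" using onb S(3) by (auto simp: has_support_def)
  have EA: "E \<subseteq> \<A>"
    unfolding E_def using S(1) by (intro complex_vector.span_minimal csubspace_fixed) auto
  define U where "U g = (\<Sum>j<n. (\<Sum>i<n. \<pi> g $$ (i, j) *\<^sub>C S i) * (S j)\<^sup>\<star>)" for g
  have US: "U g * S j = (\<Sum>i<n. \<pi> g $$ (i, j) *\<^sub>C S i)" if "j < n" for g j
  proof -
    have "U g * S j = (\<Sum>k<n. if k = j then (\<Sum>i<n. \<pi> g $$ (i, k) *\<^sub>C S i) else 0)"
      unfolding U_def sum_distrib_right[of _ _ "S j"] mult.assoc using that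
      by (intro sum.cong refl) (simp add: onb_delta[OF onb])
    thus ?thesis using that by simp
  qed
  have ext: "Y = Z" if "\<And>j. j < n \<Longrightarrow> Y * S j = Z * S j" for Y Z
  proof -
    have "Y * (\<Sum>i<n. S i * (S i)\<^sup>\<star>) = Z * (\<Sum>i<n. S i * (S i)\<^sup>\<star>)"
      unfolding sum_distrib_left mult.assoc[symmetric] using that by simp
    thus ?thesis by (simp add: S(3))
  qed
  have UA: "U g \<in> \<A>" for g
    unfolding U_def by (intro fixed_sum fixed_mult fixed_scaleC fixed_star S(1)) auto
  have Umult: "U (g \<otimes>\<^bsub>G\<^esub> h) = U g * U h" if "g \<in> carrier G" "h \<in> carrier G" for g h
  proof (rule ext)
    fix j assume j: "j < n"
    have "U g * U h * S j = (\<Sum>k<n. \<pi> h $$ (k, j) *\<^sub>C (\<Sum>i<n. \<pi> g $$ (i, k) *\<^sub>C S i))"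
      using j by (simp add: mult.assoc US sum_distrib_left scaleC_simps)
    also have "\<dots> = (\<Sum>k<n. \<Sum>i<n. (\<pi> g $$ (i, k) * \<pi> h $$ (k, j)) *\<^sub>C S i)"
      by (simp add: complex_vector.scale_sum_right scaleC_simps mult.commute)
    also have "\<dots> = U (g \<otimes>\<^bsub>G\<^esub> h) * S j"
      by (subst sum.swap) (simp add: US j unitary_rep_mult[OF rep that _ j] complex_vector.scale_sum_left)
    finally show "U (g \<otimes>\<^bsub>G\<^esub> h) * S j = U g * U h * S j" ..
  qed
  have Uunitary: "(U g)\<^sup>\<star> * U g = 1" if g: "g \<in> carrier G" for g
  proof (rule ext)
    fix j assume j: "j < n"
    have *: "(S i)\<^sup>\<star> * ((U g)\<^sup>\<star> * U g * S j) = (S i)\<^sup>\<star> * S j" if i: "i < n" for i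
    proof -
      have "(S i)\<^sup>\<star> * ((U g)\<^sup>\<star> * U g * S j) = (U g * S i)\<^sup>\<star> * (U g * S j)"
        by (simp add: star_mult mult.assoc)
      also have "\<dots> = (\<Sum>k<n. \<Sum>l<n. (cnj (\<pi> g $$ (k, i)) * \<pi> g $$ (l, j)) *\<^sub>C ((S k)\<^sup>\<star> * S l))"
        by (simp add: US i j star_sum star_scaleC sum_product scaleC_simps mult.commute)
      also have "\<dots> = (\<Sum>k<n. \<Sum>l<n. if k = l then (cnj (\<pi> g $$ (k, i)) * \<pi> g $$ (l, j)) *\<^sub>C 1 else 0)"
        by (intro sum.cong refl) (simp add: onb_delta[OF onb])
      also have "\<dots> = (\<Sum>k<n. cnj (\<pi> g $$ (k, i)) * \<pi> g $$ (k, j)) *\<^sub>C 1"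
        by (simp add: complex_vector.scale_sum_left)
      also have "\<dots> = (S i)\<^sup>\<star> * S j"
        unfolding unitary_rep_orthonormal[OF rep g i j] using i j by (simp add: onb_delta[OF onb] scaleC_one)
      finally show ?thesis .
    qed
    have "(\<Sum>i<n. S i * (S i)\<^sup>\<star>) * ((U g)\<^sup>\<star> * U g * S j) = (\<Sum>i<n. S i * (S i)\<^sup>\<star>) * S j"
      unfolding sum_distrib_right mult.assoc[of _ "(S _)\<^sup>\<star>"] using * by simp
    thus "(U g)\<^sup>\<star> * U g * S j = 1 * S j" by (simp add: S(3))
  qed
  have UE: "U g * x \<in> E" if "x \<in> E" for g x
  proof -
    have "U g * x * 1 \<in> E"
    proof (rule span_mult_mem[OF _ _ that[unfolded E_def]])
      fix y assume "y \<in> S ` {..<n}"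
      thus "U g * y * 1 \<in> E"
        using onb_subspace[OF onb] onb_mem[OF onb]
        by (auto simp: US intro!: complex_vector.subspace_sum complex_vector.subspace_scale)
    qed (rule onb_subspace[OF onb])
    thus ?thesis by simp
  qed
  have "continuous_map T euclidean (\<lambda>g. \<pi> g $$ (i, j) *\<^sub>C x)" if ij: "i < n" "j < n" for i j and x :: 'f
  proof -
    have "bounded_linear (\<lambda>c. c *\<^sub>C x)"
      by (rule bounded_linear_intro[of _ "norm x"])
         (simp_all add: scaleC_add_left norm_scaleC scaleC_scaleC scaleR_conv_of_real[where 'a = complex]
           flip: scaleC_of_real)
    thus ?thesis
      using unitary_rep_continuous[OF rep ij] by (auto simp: continuous_map_atin intro: bounded_linear.tendsto)
  qed
  hence Ucont: "continuous_map T euclidean U"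
    unfolding U_def[abs_def] sum_distrib_right
    by (intro continuous_map_sum) (simp_all add: scaleC_simps)
  obtain X where X: "X\<^sup>\<star> * X = 1" "X * X\<^sup>\<star> = 1" "\<And>g. g \<in> carrier G \<Longrightarrow> \<alpha> g X = X * U g"
    using carry_subspace[OF has_support_hilbert_subspace[OF sE] EA UA Umult Uunitary Ucont order_refl onb n UE]
      S(3) by auto
  define \<Theta> where "\<Theta> j = X * S j" for j
  have on: "orthonormal {..<n} \<Theta>"
  proof -
    have "(\<Theta> i)\<^sup>\<star> * \<Theta> j = (S i)\<^sup>\<star> * (X\<^sup>\<star> * X) * S j" for i j by (simp add: \<Theta>_def star_mult mult.assoc)
    thus ?thesis using S(2) by (simp add: orthonormal_def X)
  qed
  have "(\<Sum>j<n. \<Theta> j * (\<Theta> j)\<^sup>\<star>) = X * (\<Sum>i<n. S i * (S i)\<^sup>\<star>) * X\<^sup>\<star>"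
    by (simp add: \<Theta>_def star_mult sum_distrib_left sum_distrib_right mult.assoc)
  hence 1: "(\<Sum>j<n. \<Theta> j * (\<Theta> j)\<^sup>\<star>) = 1" by (simp add: S(3) X)
  have act: "\<alpha> g (\<Theta> j) = (\<Sum>i<n. \<pi> g $$ (i, j) *\<^sub>C \<Theta> i)" if "g \<in> carrier G" "j < n" for g j
    using that S(1) by (simp add: \<Theta>_def act_mult X fixedD mult.assoc US sum_distrib_left scaleC_simps)
  define H where "H = cspan (\<Theta> ` {..<n})"
  have onb\<Theta>: "orthonormal_basis H n \<Theta>" using on by (simp add: orthonormal_basis_iff H_def)
  moreover have "has_support H 1" using onb\<Theta> 1 by (auto simp: has_support_def)
  moreover have "invariant H"
    unfolding invariant_def H_def
  proof (intro ballI)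
    fix g assume g: "g \<in> carrier G"
    have "\<alpha> g (\<Theta> j) \<in> cspan (\<Theta> ` {..<n})" if "j < n" for j
      unfolding act[OF g that]
      by (intro complex_vector.span_sum complex_vector.span_scale, rule complex_vector.span_base) simp
    thus "\<alpha> g ` cspan (\<Theta> ` {..<n}) \<subseteq> cspan (\<Theta> ` {..<n})"
      unfolding act_span[OF g] by (intro complex_vector.span_minimal complex_vector.subspace_span) auto
  qed
  ultimately show ?thesis using act by blast
qed

end

section \<open>The permutation symmetry\<close>

context star_action
begin

lemma canonical_star_ext:
  assumes "canonical H \<sigma>" "\<And>x. x \<in> H \<Longrightarrow> x\<^sup>\<star> * a = x\<^sup>\<star> * b"
  shows "a = b"
proof -
  have "a\<^sup>\<star> = b\<^sup>\<star>"
  proof (rule canonical_ext[OF assms(1)])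
    fix x assume "x \<in> H"
    from arg_cong[OF assms(2)[OF this], of star] show "a\<^sup>\<star> * x = b\<^sup>\<star> * x" by (simp add: star_simps)
  qed
  thus ?thesis by (metis star_star)
qed

text \<open>Defined from the spaces and not from bases. For spaces of canonical endomorphisms the
  products \<open>x * y\<close> separate, so the element is unique and its identities can be checked
  on such products.\<close>

definition flip :: "'f set \<Rightarrow> 'f set \<Rightarrow> 'f"
  where "flip H K = (SOME X. X \<in> \<A> \<and> (\<forall>x\<in>H. \<forall>y\<in>K. X * (x * y) = y * x))"

context
  fixes H K \<sigma> \<tau>
  assumes H: "canonical H \<sigma>" and K: "canonical K \<tau>"
begin

lemma canonical_ext2:
  assumes "\<And>x y. x \<in> H \<Longrightarrow> y \<in> K \<Longrightarrow> X * (x * y) = Y * (x * y)"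
  shows "X = Y"
  by (rule canonical_ext[OF H], rule canonical_ext[OF K]) (simp add: assms mult.assoc)

lemma flip_exists: "\<exists>X. X \<in> \<A> \<and> (\<forall>x\<in>H. \<forall>y\<in>K. X * (x * y) = y * x)"
proof -
  obtain n \<Phi> where \<Phi>: "orthonormal_basis H n \<Phi>"
    using canonical_support[OF H] by (auto simp: has_support_def)
  obtain m \<Psi> where \<Psi>: "orthonormal_basis K m \<Psi>"
    using canonical_support[OF K] by (auto simp: has_support_def)
  \<comment> \<open>The sum of all
    \<open>(\<Psi> j * \<Phi> i) * (\<Phi> i * \<Psi> j)\<^sup>\<star>\<close>, which sends each
    product of basis vectors to the product in the opposite order.\<close>
  define X where "X = (\<Sum>j<m. \<Psi> j * (\<Sum>i<n. \<Phi> i * (\<Psi> j)\<^sup>\<star> * (\<Phi> i)\<^sup>\<star>))"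
  have X: "X * (x * y) = y * x" if x: "x \<in> H" and y: "y \<in> K" for x y
  proof -
    have "X * (x * y) = (\<Sum>j<m. \<Psi> j * ((\<Psi> j)\<^sup>\<star> * y) * x)"
      unfolding X_def sum_distrib_right
    proof (intro sum.cong refl)
      fix j assume j: "j \<in> {..<m}"
      have s: "(\<Psi> j)\<^sup>\<star> * y \<in> scalars" using onb_coef[OF \<Psi> y] j by simp
      have "(\<Sum>i<n. \<Phi> i * (\<Psi> j)\<^sup>\<star> * (\<Phi> i)\<^sup>\<star>) * (x * y)
          = (\<Sum>i<n. \<Phi> i * ((\<Phi> i)\<^sup>\<star> * x)) * ((\<Psi> j)\<^sup>\<star> * y)"
        unfolding sum_distrib_right
      proof (intro sum.cong refl)
        fix i assume "i \<in> {..<n}"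
        hence "(\<Phi> i)\<^sup>\<star> * x * (\<Psi> j)\<^sup>\<star> = (\<Psi> j)\<^sup>\<star> * ((\<Phi> i)\<^sup>\<star> * x)"
          using onb_coef[OF \<Phi> x] scalars_commute by blast
        hence "\<Phi> i * ((\<Psi> j)\<^sup>\<star> * ((\<Phi> i)\<^sup>\<star> * x)) * y = \<Phi> i * ((\<Phi> i)\<^sup>\<star> * x * (\<Psi> j)\<^sup>\<star>) * y" by simp
        thus "\<Phi> i * (\<Psi> j)\<^sup>\<star> * (\<Phi> i)\<^sup>\<star> * (x * y) = \<Phi> i * ((\<Phi> i)\<^sup>\<star> * x) * ((\<Psi> j)\<^sup>\<star> * y)"
          by (simp add: mult.assoc)
      qed
      also have "\<dots> = (\<Psi> j)\<^sup>\<star> * y * x"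
        using onb_expand[OF \<Phi> x] scalars_commute[OF s] by simp
      finally show "\<Psi> j * (\<Sum>i<n. \<Phi> i * (\<Psi> j)\<^sup>\<star> * (\<Phi> i)\<^sup>\<star>) * (x * y) = \<Psi> j * ((\<Psi> j)\<^sup>\<star> * y) * x"
        by (simp add: mult.assoc)
    qed
    thus ?thesis using onb_expand[OF \<Psi> y] by (simp flip: sum_distrib_right)
  qed
  have "X \<in> \<A>"
  proof (rule fixedI)
    fix g assume g: "g \<in> carrier G"
    show "\<alpha> g X = X"
    proof (rule canonical_ext2)
      fix x y assume "x \<in> H" "y \<in> K"
      hence "x \<in> \<alpha> g ` H" "y \<in> \<alpha> g ` K"
        using invariant_image[OF canonical_invariant[OF H] g] invariant_image[OF canonical_invariant[OF K] g]
        by blast+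
      then obtain x' y' where xy: "x' \<in> H" "x = \<alpha> g x'" "y' \<in> K" "y = \<alpha> g y'" by blast
      have "\<alpha> g X * (x * y) = \<alpha> g (X * (x' * y'))" by (simp add: xy act_mult[OF g])
      also have "\<dots> = y * x" by (simp add: X xy act_mult[OF g])
      finally show "\<alpha> g X * (x * y) = X * (x * y)" using X \<open>x \<in> H\<close> \<open>y \<in> K\<close> by simp
    qed
  qed
  with X show ?thesis by blast
qed

lemma flip_fixed: "flip H K \<in> \<A>"
  and flip_mult: "x \<in> H \<Longrightarrow> y \<in> K \<Longrightarrow> flip H K * (x * y) = y * x"
  using someI_ex[OF flip_exists] by (auto simp: flip_def)

lemma flip_unique: "(\<And>x y. x \<in> H \<Longrightarrow> y \<in> K \<Longrightarrow> Y * (x * y) = y * x) \<Longrightarrow> flip H K = Y"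
  by (rule canonical_ext2) (simp add: flip_mult)

lemma flip_hs_hom: "flip H K \<in> hs_hom (hs_product H K) (hs_product K H)"
proof (rule hs_homI[OF flip_fixed])
  fix x assume x: "x \<in> hs_product H K"
  have "hs_product H K \<subseteq> {x. flip H K * x * 1 \<in> hs_product K H}"
    by (intro hs_product_minimal csubspace_vimage_mult)
       (simp_all add: flip_mult hs_product_mult, simp add: hs_product_def)
  thus "flip H K * x \<in> hs_product K H" using x by auto
qed

text \<open>The inner product of two products of vectors is the product of two scalars, which
  commute, so it does not change when the factors are exchanged in both.\<close>

lemma flip_isometry: "(flip H K)\<^sup>\<star> * flip H K = 1"
proof (rule canonical_ext2)
  fix x y assume xy: "x \<in> H" "y \<in> K"
  let ?F = "flip H K"
  show "?F\<^sup>\<star> * ?F * (x * y) = 1 * (x * y)"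
  proof (rule canonical_star_ext[OF H], rule canonical_star_ext[OF K])
    fix x' y' assume xy': "x' \<in> H" "y' \<in> K"
    have s: "x'\<^sup>\<star> * x \<in> scalars" "y'\<^sup>\<star> * y \<in> scalars"
      using hilbert_subspace_inner[OF canonical_hilbert_subspace[OF H]]
        hilbert_subspace_inner[OF canonical_hilbert_subspace[OF K]] xy xy' by auto
    have "y'\<^sup>\<star> * (x'\<^sup>\<star> * (?F\<^sup>\<star> * ?F * (x * y))) = (?F * (x' * y'))\<^sup>\<star> * (?F * (x * y))"
      by (simp add: star_mult mult.assoc)
    also have "\<dots> = x'\<^sup>\<star> * (y'\<^sup>\<star> * y) * x"
      by (simp add: flip_mult xy xy' star_mult mult.assoc)
    also have "\<dots> = y'\<^sup>\<star> * y * (x'\<^sup>\<star> * x)"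
      using arg_cong[OF scalars_commute[OF s(2), of "x'\<^sup>\<star>"], of "\<lambda>z. z * x"] by (simp add: mult.assoc)
    also have "\<dots> = y'\<^sup>\<star> * (x'\<^sup>\<star> * x * y)"
      using scalars_commute[OF s(1), of y] by (simp add: mult.assoc)
    finally show "y'\<^sup>\<star> * (x'\<^sup>\<star> * (?F\<^sup>\<star> * ?F * (x * y))) = y'\<^sup>\<star> * (x'\<^sup>\<star> * (1 * (x * y)))"
      by (simp add: mult.assoc)
  qed
qed

end

lemma flip_flip:
  assumes "canonical H \<sigma>" "canonical K \<tau>"
  shows "flip H K * flip K H = 1"
  by (rule canonical_ext2[OF assms(2,1)]) (simp add: flip_mult[OF assms] flip_mult[OF assms(2,1)] mult.assoc)

lemma flip_unitary:
  assumes "canonical H \<sigma>" "canonical K \<tau>"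
  shows "is_unitary (flip H K)"
proof -
  have "(flip H K)\<^sup>\<star> = (flip H K)\<^sup>\<star> * (flip H K * flip K H)" by (simp add: flip_flip[OF assms])
  also have "\<dots> = flip K H" by (simp add: flip_isometry[OF assms] flip: mult.assoc)
  finally show ?thesis using flip_isometry[OF assms] flip_flip[OF assms] by (simp add: is_unitary_def)
qed

lemma flip_scalars:
  assumes "canonical H \<sigma>"
  shows "flip scalars H = 1" "flip H scalars = 1"
  by (rule flip_unique[OF canonical_scalars assms] flip_unique[OF assms canonical_scalars];
      metis scalars_commute mult_1_left)+

text \<open>\<open>\<sigma> (flip K L)\<close> moves \<open>z\<close> past \<open>y\<close> behind
  an untouched \<open>x\<close>; then \<open>flip H L\<close> moves it past
  \<open>x\<close>.\<close>

lemma flip_product: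
  assumes H: "canonical H \<sigma>" and K: "canonical K \<tau>" and L: "canonical L \<upsilon>"
  shows "flip (hs_product H K) L = flip H L * \<sigma> (flip K L)"
proof (rule canonical_ext[OF H], rule canonical_ext2[OF K L])
  fix x y z assume xyz: "x \<in> H" "y \<in> K" "z \<in> L"
  have "flip (hs_product H K) L * x * (y * z) = flip (hs_product H K) L * ((x * y) * z)"
    by (simp add: mult.assoc)
  also have "\<dots> = z * (x * y)"
    by (rule flip_mult[OF canonical_product[OF H K] L hs_product_mult[OF xyz(1,2)] xyz(3)])
  finally have 1: "flip (hs_product H K) L * x * (y * z) = z * (x * y)" .
  have "flip H L * \<sigma> (flip K L) * x * (y * z) = flip H L * (x * flip K L) * (y * z)"
    by (simp add: mult.assoc canonical_mult[OF H flip_fixed[OF K L] xyz(1), symmetric])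
  also have "\<dots> = flip H L * (x * (z * y))" by (simp add: mult.assoc flip_mult[OF K L xyz(2,3)])
  also have "\<dots> = z * (x * y)"
    using flip_mult[OF H L xyz(1,3)] by (simp flip: mult.assoc)
  finally show "flip (hs_product H K) L * x * (y * z) = flip H L * \<sigma> (flip K L) * x * (y * z)"
    using 1 by simp
qed

text \<open>Both sides send \<open>x * y\<close> to \<open>(B * y) * (A * x)\<close>.\<close>

lemma flip_natural:
  assumes H: "canonical H \<sigma>" and K: "canonical K \<tau>"
    and H': "canonical H' \<sigma>'" and K': "canonical K' \<tau>'"
    and A: "A \<in> hs_hom H H'" and B: "B \<in> hs_hom K K'"
  shows "flip H' K' * (A * \<sigma> B) = (B * \<tau> A) * flip H K"
proof (rule canonical_ext2[OF H K])
  fix x y assume xy: "x \<in> H" "y \<in> K"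
  have "flip H' K' * (A * \<sigma> B) * (x * y) = flip H' K' * (A * (\<sigma> B * x) * y)"
    by (simp add: mult.assoc)
  also have "\<dots> = flip H' K' * ((A * x) * (B * y))"
    by (simp add: canonical_mult[OF H hs_hom_fixed[OF B] xy(1)] mult.assoc)
  also have "\<dots> = (B * y) * (A * x)"
    by (rule flip_mult[OF H' K' hs_hom_mem[OF A xy(1)] hs_hom_mem[OF B xy(2)]])
  also have "\<dots> = B * (\<tau> A * y) * x"
    by (simp add: canonical_mult[OF K hs_hom_fixed[OF A] xy(2)] mult.assoc)
  also have "\<dots> = (B * \<tau> A) * flip H K * (x * y)"
    by (simp add: mult.assoc flip_mult[OF H K xy])
  finally show "flip H' K' * (A * \<sigma> B) * (x * y) = (B * \<tau> A) * flip H K * (x * y)" .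
qed

text \<open>Completeness replaces a count of dimensions: if the projections sum to 1, every vector
  of \<open>H\<close> is expanded in the family.\<close>

lemma onbI:
  assumes "hilbert_subspace H" "orthonormal {..<n} \<Theta>" "\<And>j. j < n \<Longrightarrow> \<Theta> j \<in> H"
    "(\<Sum>j<n. \<Theta> j * (\<Theta> j)\<^sup>\<star>) = 1"
  shows "orthonormal_basis H n \<Theta>"
  unfolding orthonormal_basis_iff
proof (intro conjI antisym subsetI)
  fix x assume x: "x \<in> H"
  have "x = (\<Sum>j<n. \<Theta> j * (\<Theta> j)\<^sup>\<star>) * x" by (simp add: assms(4))
  also have "\<dots> = (\<Sum>j<n. \<Theta> j * ((\<Theta> j)\<^sup>\<star> * x))" by (simp add: sum_distrib_right mult.assoc)
  also have "\<dots> \<in> cspan (\<Theta> ` {..<n})"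
    using hilbert_subspace_inner[OF assms(1,3) x]
    by (intro subspace_sum_mult_scalar complex_vector.subspace_span complex_vector.span_base) auto
  finally show "x \<in> cspan (\<Theta> ` {..<n})" .
next
  fix x assume "x \<in> cspan (\<Theta> ` {..<n})"
  thus "x \<in> H"
    using complex_vector.span_minimal[OF _ hilbert_subspace_csubspace[OF assms(1)], of "\<Theta> ` {..<n}"] assms(3)
    by blast
qed (rule assms(2))

text \<open>A representation tensored with its conjugate has a canonical invariant vector, by
  orthonormality of the rows. It yields the elements \<open>R\<close> of the conjugation and, with
  adjoints as second family, the isometries of subobjects.\<close>

lemma fixed_pairing:
  assumes rep: "unitary_rep G T n \<pi>"
    and x: "\<And>g j. g \<in> carrier G \<Longrightarrow> j < n \<Longrightarrow> \<alpha> g (x j) = (\<Sum>i<n. \<pi> g $$ (i, j) *\<^sub>C x i)"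
    and y: "\<And>g j. g \<in> carrier G \<Longrightarrow> j < n \<Longrightarrow> \<alpha> g (y j) = (\<Sum>i<n. cnj (\<pi> g $$ (i, j)) *\<^sub>C y i)"
  shows "(\<Sum>j<n. x j * y j) \<in> \<A>"
proof (rule fixedI)
  fix g assume g: "g \<in> carrier G"
  have "\<alpha> g (\<Sum>j<n. x j * y j)
      = (\<Sum>j<n. \<Sum>i<n. \<Sum>k<n. (\<pi> g $$ (i, j) * cnj (\<pi> g $$ (k, j))) *\<^sub>C (x i * y k))"
    by (simp add: act_sum[OF g] act_mult[OF g] x[OF g] y[OF g] sum_product scaleC_simps mult.commute)
  also have "\<dots> = (\<Sum>i<n. \<Sum>j<n. \<Sum>k<n. (\<pi> g $$ (i, j) * cnj (\<pi> g $$ (k, j))) *\<^sub>C (x i * y k))"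
    by (rule sum.swap)
  also have "\<dots> = (\<Sum>i<n. \<Sum>k<n. (\<Sum>j<n. \<pi> g $$ (i, j) * cnj (\<pi> g $$ (k, j))) *\<^sub>C (x i * y k))"
    by (rule sum.cong[OF refl], subst sum.swap) (simp add: complex_vector.scale_sum_left)
  also have "\<dots> = (\<Sum>i<n. \<Sum>k<n. if i = k then x i * y k else 0)"
    by (intro sum.cong refl) (simp add: unitary_rep_orthonormal_rows[OF rep g] scaleC_one)
  finally show "\<alpha> g (\<Sum>j<n. x j * y j) = (\<Sum>j<n. x j * y j)" by simp
qed

end

section \<open>The DR-subcategory\<close>

locale regular_action = minimal_action G \<alpha> + hilbert_action G \<alpha> T
  for G :: "('g, 'b) monoid_scheme" and \<alpha> :: "'g \<Rightarrow> 'f::cstar_algebra \<Rightarrow> 'f"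
    and T :: "'g topology" +
  fixes S :: "('f \<Rightarrow> 'f) \<Rightarrow> 'f set"
  assumes canonical_space: "\<sigma> \<in> canonical_endos G \<alpha> \<Longrightarrow> canonical (S \<sigma>) \<sigma>"
    and space_compose: "\<sigma> \<in> canonical_endos G \<alpha> \<Longrightarrow> \<tau> \<in> canonical_endos G \<alpha> \<Longrightarrow>
      S (compose (fixed_algebra G \<alpha>) \<sigma> \<tau>) = hs_product (S \<sigma>) (S \<tau>)"
begin

abbreviation Ob :: "('f \<Rightarrow> 'f) set" where "Ob \<equiv> canonical_endos G \<alpha>"
abbreviation \<iota> :: "'f \<Rightarrow> 'f" where "\<iota> \<equiv> restrict id \<A>"
abbreviation Hom :: "('f \<Rightarrow> 'f) \<Rightarrow> ('f \<Rightarrow> 'f) \<Rightarrow> 'f set" where "Hom \<sigma> \<tau> \<equiv> hs_hom (S \<sigma>) (S \<tau>)"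

lemma unit_Ob: "\<iota> \<in> Ob"
  using canonical_scalars canonical_endos_iff by blast

lemma compose_Ob: "\<sigma> \<in> Ob \<Longrightarrow> \<tau> \<in> Ob \<Longrightarrow> compose \<A> \<sigma> \<tau> \<in> Ob"
  using canonical_product canonical_endos_iff by blast

text \<open>The Hilbert space of the unit is central, hence one-dimensional, and closed under products.\<close>

lemma space_unit: "S \<iota> = scalars"
proof -
  note c = canonical_space[OF unit_Ob]
  obtain n \<Phi> where \<Phi>: "orthonormal_basis (S \<iota>) n \<Phi>"
    using canonical_support[OF c] by (auto simp: has_support_def)
  \<comment> \<open>As \<open>\<iota>\<close> is the identity on \<open>\<A>\<close>, the relation
    \<open>canonical_mult\<close> says that the vectors commute with \<open>\<A>\<close>.\<close>
  have Z: "x \<in> \<Z>" if "x \<in> S \<iota>" for x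
    by (rule centerI) (use canonical_mult[OF c _ that] in simp)
  have "n \<noteq> 0" using onb_support_one[OF canonical_support[OF c] \<Phi>] by (intro notI) simp
  moreover have "\<not> 1 < n"
  proof
    assume "1 < n"
    hence d: "(\<Phi> 0)\<^sup>\<star> * \<Phi> 1 = 0" "(\<Phi> 0)\<^sup>\<star> * \<Phi> 0 = 1" "(\<Phi> 1)\<^sup>\<star> * \<Phi> 1 = 1"
      using onb_delta[OF \<Phi>] by auto
    \<comment> \<open>Commuting turns orthogonality of two basis vectors into
      \<open>\<Phi> 1 * (\<Phi> 0)\<^sup>\<star> = 0\<close>, which is impossible for
      isometries.\<close>
    have "\<Phi> 1 * (\<Phi> 0)\<^sup>\<star> = (\<Phi> 0)\<^sup>\<star> * \<Phi> 1"
      using onb_mem[OF \<Phi>] \<open>1 < n\<close> by (intro center_commute Z fixed_star center_fixed) auto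
    hence "\<Phi> 1 * ((\<Phi> 0)\<^sup>\<star> * \<Phi> 0) = 0" by (simp only: d(1) mult.assoc[symmetric] mult_zero_left)
    hence "\<Phi> 1 = 0" by (simp only: d(2) mult_1_right)
    with d(3) show False by (simp only: mult_zero_right zero_neq_one)
  qed
  ultimately have "n = 1" by simp
  hence "\<Phi> ` {..<n} = {\<Phi> 0}" by auto
  hence span: "S \<iota> = cspan {\<Phi> 0}" using \<Phi> by (simp add: orthonormal_basis_iff)
  have u: "(\<Phi> 0)\<^sup>\<star> * \<Phi> 0 = 1" "\<Phi> 0 \<in> S \<iota>"
    using onb_delta[OF \<Phi>] onb_mem[OF \<Phi>] \<open>n = 1\<close> by auto
  \<comment> \<open>So far the space could be spanned by any central unitary. The product rule makes
    the square of the basis vector a multiple of the vector, and cancelling one factor leaves a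
    scalar.\<close>
  have "compose \<A> \<iota> \<iota> = \<iota>" by (auto simp: compose_def restrict_def)
  hence "S \<iota> = hs_product (S \<iota>) (S \<iota>)" using space_compose[OF unit_Ob unit_Ob] by simp
  hence "\<Phi> 0 * \<Phi> 0 \<in> cspan {\<Phi> 0}" using hs_product_mult[OF u(2) u(2)] span by simp
  then obtain k where "\<Phi> 0 * \<Phi> 0 = k *\<^sub>C \<Phi> 0" by (auto simp: complex_vector.span_singleton)
  hence "(\<Phi> 0)\<^sup>\<star> * (\<Phi> 0 * \<Phi> 0) = (\<Phi> 0)\<^sup>\<star> * (k *\<^sub>C \<Phi> 0)" by simp
  hence k: "\<Phi> 0 = k *\<^sub>C 1" by (simp add: u scaleC_simps flip: mult.assoc)
  hence "k \<noteq> 0" using u(1) by auto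
  have "x \<in> cspan {\<Phi> 0} \<longleftrightarrow> x \<in> scalars" for x
  proof
    assume "x \<in> scalars"
    then obtain a where "x = a *\<^sub>C 1" by (auto simp: scalars_iff)
    hence "x = (a / k) *\<^sub>C \<Phi> 0" using \<open>k \<noteq> 0\<close> by (simp add: k scaleC_simps)
    thus "x \<in> cspan {\<Phi> 0}" by (auto simp: complex_vector.span_singleton)
  qed (auto simp: complex_vector.span_singleton k scaleC_simps)
  thus ?thesis using span by blast
qed

lemma tensor_category: "tensor_cstar_category \<A> Ob Hom"
  unfolding tensor_cstar_category_def
proof (intro conjI ballI)
  fix \<sigma> assume \<sigma>: "\<sigma> \<in> Ob"
  show "star_endomorphism \<A> \<sigma>" by (rule canonical_star_endomorphism[OF canonical_space[OF \<sigma>]])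
  show "1 \<in> Hom \<sigma> \<sigma>" by (rule hs_hom_one)
  fix \<tau> assume \<tau>: "\<tau> \<in> Ob"
  show "compose \<A> \<sigma> \<tau> \<in> Ob" by (rule compose_Ob[OF \<sigma> \<tau>])
  show "Hom \<sigma> \<tau> \<subseteq> intertwiners \<A> \<sigma> \<tau>"
    using hs_hom_intertwiners[OF canonical_space[OF \<sigma>] canonical_space[OF \<tau>]] by blast
  show "csubspace (Hom \<sigma> \<tau>)"
    by (rule hs_hom_csubspace[OF canonical_csubspace[OF canonical_space[OF \<tau>]]])
  show "closed (Hom \<sigma> \<tau>)"
    by (rule closed_hs_hom[OF canonical_space[OF \<sigma>] canonical_space[OF \<tau>]])
  show "X\<^sup>\<star> \<in> Hom \<tau> \<sigma>" if "X \<in> Hom \<sigma> \<tau>" for X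
    using that hs_hom_star[OF canonical_support[OF canonical_space[OF \<sigma>]]
        canonical_hilbert_subspace[OF canonical_space[OF \<tau>]]] by blast
  fix \<upsilon> assume "\<upsilon> \<in> Ob"
  show "Y * X \<in> Hom \<sigma> \<upsilon>" if "X \<in> Hom \<sigma> \<tau>" "Y \<in> Hom \<tau> \<upsilon>" for X Y
    using that by (rule hs_hom_mult)
next
  fix \<sigma> \<sigma>' \<tau> \<tau>' A B
  assume *: "\<sigma> \<in> Ob" "\<sigma>' \<in> Ob" "\<tau> \<in> Ob" "\<tau>' \<in> Ob" "A \<in> Hom \<sigma> \<sigma>'" "B \<in> Hom \<tau> \<tau>'"
  show "A * \<sigma> B \<in> Hom (compose \<A> \<sigma> \<tau>) (compose \<A> \<sigma>' \<tau>')"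
    using hs_hom_tensor[OF canonical_space canonical_space canonical_space *(5,6)] *
    by (simp add: space_compose)
qed (rule unit_Ob)

lemma Hom_unit: "Hom \<iota> \<iota> = range (\<lambda>c. c *\<^sub>C 1)"
  unfolding space_unit
proof (rule Set.set_eqI)
  fix X
  have "X * 1 \<in> scalars" if "X \<in> hs_hom scalars scalars"
    using that by (rule hs_hom_mem) simp
  moreover have "X \<in> hs_hom scalars scalars" if "X \<in> scalars"
    using that by (intro hs_homI fixed_scalars scalars_mult)
  ultimately show "X \<in> hs_hom scalars scalars \<longleftrightarrow> X \<in> range (\<lambda>c. c *\<^sub>C 1)"
    by (auto simp: scalars_def)
qed

lemma permutation: "permutation_structure \<A> Ob Hom (\<lambda>\<sigma> \<tau>. flip (S \<sigma>) (S \<tau>))"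
  unfolding permutation_structure_def
proof (intro conjI ballI)
  fix \<sigma> assume \<sigma>: "\<sigma> \<in> Ob"
  note c\<sigma> = canonical_space[OF \<sigma>]
  show "flip (S \<iota>) (S \<sigma>) = 1" "flip (S \<sigma>) (S \<iota>) = 1"
    using flip_scalars[OF c\<sigma>] by (simp_all add: space_unit)
  fix \<tau> assume \<tau>: "\<tau> \<in> Ob"
  note c\<tau> = canonical_space[OF \<tau>]
  show "is_unitary (flip (S \<sigma>) (S \<tau>))" "flip (S \<sigma>) (S \<tau>) * flip (S \<tau>) (S \<sigma>) = 1"
    by (rule flip_unitary[OF c\<sigma> c\<tau>] flip_flip[OF c\<sigma> c\<tau>])+
  show "flip (S \<sigma>) (S \<tau>) \<in> Hom (compose \<A> \<sigma> \<tau>) (compose \<A> \<tau> \<sigma>)"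
    using flip_hs_hom[OF c\<sigma> c\<tau>] by (simp add: space_compose \<sigma> \<tau>)
  fix \<upsilon> assume \<upsilon>: "\<upsilon> \<in> Ob"
  show "flip (S (compose \<A> \<sigma> \<tau>)) (S \<upsilon>) = flip (S \<sigma>) (S \<upsilon>) * \<sigma> (flip (S \<tau>) (S \<upsilon>))"
    unfolding space_compose[OF \<sigma> \<tau>] by (rule flip_product[OF c\<sigma> c\<tau> canonical_space[OF \<upsilon>]])
next
  fix \<sigma> \<sigma>' \<tau> \<tau>' A B
  assume *: "\<sigma> \<in> Ob" "\<sigma>' \<in> Ob" "\<tau> \<in> Ob" "\<tau>' \<in> Ob" "A \<in> Hom \<sigma> \<sigma>'" "B \<in> Hom \<tau> \<tau>'"
  show "flip (S \<sigma>') (S \<tau>') * (A * \<sigma> B) = (B * \<tau> A) * flip (S \<sigma>) (S \<tau>)"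
    by (rule flip_natural) (use * canonical_space in auto)
qed

text \<open>The assigned space of the canonical endomorphism of \<open>K\<close> may differ from \<open>K\<close>, but carries the
  same representation.\<close>

lemma canonical_transport:
  assumes K: "canonical K \<tau>"
  obtains Y where "\<tau> \<in> Ob" "Y \<in> hs_hom K (S \<tau>)" "Y\<^sup>\<star> * Y = 1" "Y * Y\<^sup>\<star> = 1"
proof -
  have \<tau>: "\<tau> \<in> Ob" using K canonical_endos_iff by blast
  obtain Y where "Y \<in> hs_hom K (S \<tau>)" "is_unitary Y"
    using canonical_unitary[OF K canonical_space[OF \<tau>]] .
  thus ?thesis using that \<tau> by (simp add: is_unitary_def)
qed

text \<open>The invariant unitary of \<open>canonical_transport\<close> moves the carried basis into
  the assigned space without changing the matrices of the action.\<close>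

lemma unitary_rep_object:
  assumes rep: "unitary_rep G T n \<pi>" and n: "n > 0"
  shows "\<exists>\<tau>\<in>Ob. \<exists>\<Theta>. orthonormal_basis (S \<tau>) n \<Theta> \<and>
    (\<forall>g\<in>carrier G. \<forall>j<n. \<alpha> g (\<Theta> j) = (\<Sum>i<n. \<pi> g $$ (i, j) *\<^sub>C \<Theta> i))"
proof -
  obtain \<Theta> K where K: "orthonormal_basis K n \<Theta>" "has_support K 1" "invariant K"
    and act: "\<forall>g\<in>carrier G. \<forall>j<n. \<alpha> g (\<Theta> j) = (\<Sum>i<n. \<pi> g $$ (i, j) *\<^sub>C \<Theta> i)"
    using unitary_rep_carried[OF rep n] by blast
  obtain \<tau> where \<tau>: "canonical K \<tau>" using canonical_exists[OF K(2,3)] by blast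
  obtain Y where Y: "\<tau> \<in> Ob" "Y \<in> hs_hom K (S \<tau>)" "Y\<^sup>\<star> * Y = 1" "Y * Y\<^sup>\<star> = 1"
    by (rule canonical_transport[OF \<tau>])
  have "orthonormal_basis (S \<tau>) n (\<lambda>j. Y * \<Theta> j)"
  proof (rule onbI)
    show "hilbert_subspace (S \<tau>)" by (rule canonical_hilbert_subspace[OF canonical_space[OF Y(1)]])
    have "(Y * \<Theta> i)\<^sup>\<star> * (Y * \<Theta> j) = (\<Theta> i)\<^sup>\<star> * (Y\<^sup>\<star> * Y) * \<Theta> j" for i j
      by (simp add: star_mult mult.assoc)
    thus "orthonormal {..<n} (\<lambda>j. Y * \<Theta> j)"
      using K(1) Y(3) by (simp add: orthonormal_basis_iff orthonormal_def)
    show "Y * \<Theta> j \<in> S \<tau>" if "j < n" for j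
      by (rule hs_hom_mem[OF Y(2) onb_mem[OF K(1) that]])
    have "(\<Sum>j<n. Y * \<Theta> j * (Y * \<Theta> j)\<^sup>\<star>) = Y * (\<Sum>j<n. \<Theta> j * (\<Theta> j)\<^sup>\<star>) * Y\<^sup>\<star>"
      by (simp add: star_mult sum_distrib_left sum_distrib_right mult.assoc)
    thus "(\<Sum>j<n. Y * \<Theta> j * (Y * \<Theta> j)\<^sup>\<star>) = 1"
      using onb_support_one[OF K(2,1)] Y(4) by simp
  qed
  moreover have "\<alpha> g (Y * \<Theta> j) = (\<Sum>i<n. \<pi> g $$ (i, j) *\<^sub>C (Y * \<Theta> i))"
    if "g \<in> carrier G" "j < n" for g j
    using that by (simp add: act_mult fixedD[OF hs_hom_fixed[OF Y(2)]] act sum_distrib_left scaleC_simps)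
  ultimately show ?thesis using Y(1) by blast
qed

text \<open>Inner products in \<open>L\<close> are scalars, which the automorphisms fix, so the
  action on \<open>L\<close> is unitary.\<close>

lemma invariant_subspace_rep:
  assumes "invariant L" "orthonormal_basis L m w"
  shows "\<exists>\<pi>. unitary_rep G T m \<pi> \<and>
    (\<forall>g\<in>carrier G. \<forall>j<m. \<alpha> g (w j) = (\<Sum>i<m. \<pi> g $$ (i, j) *\<^sub>C w i))"
proof -
  have L: "hilbert_subspace L" using assms(2) by (auto simp: hilbert_subspace_def)
  have inner: "(\<alpha> g x)\<^sup>\<star> * \<alpha> g y = x\<^sup>\<star> * y" if "g \<in> carrier G" "x \<in> L" "y \<in> L" for g x y
    using act_scalar[OF that(1) hilbert_subspace_inner[OF L that(2,3)]] that(1)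
    by (simp add: act_mult act_star)
  note facts = invariantD[OF assms(1)] act_hom act_add act_scaleC inner continuous
  show ?thesis
  proof (intro exI conjI ballI allI impI)
    show "unitary_rep G T m (\<lambda>g. mat m m (\<lambda>(i, j). coef ((w i)\<^sup>\<star> * \<alpha> g (w j))))"
      by (rule unitary_rep_of_action_rep[where \<beta> = \<alpha>, OF assms(2) topspace_eq]) (simp_all add: facts)
    show "\<alpha> g (w j) = (\<Sum>i<m. mat m m (\<lambda>(i, j). coef ((w i)\<^sup>\<star> * \<alpha> g (w j))) $$ (i, j) *\<^sub>C w i)"
      if "g \<in> carrier G" "j < m" for g j
      by (rule unitary_rep_of_action_basis[where \<beta> = \<alpha>, OF assms(2) topspace_eq]) (simp_all add: facts that)
  qed
qed

text \<open>The conjugate object carries the complex conjugate matrices in a basis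
  \<open>\<Theta>\<close>, and \<open>R\<close> is the invariant sum of the
  \<open>\<Theta> j * \<Phi> j\<close>. The flip turns it into the sum of the
  \<open>\<Phi> j * \<Theta> j\<close>. Contracting either sum with an adjoint basis vector returns
  a basis vector, so both conjugate equations reduce to support 1.\<close>

lemma conjugate_exists:
  assumes \<sigma>: "\<sigma> \<in> Ob"
  shows "\<exists>\<tau> R. \<tau> \<in> Ob \<and> R \<in> Hom \<iota> (compose \<A> \<tau> \<sigma>) \<and>
    (flip (S \<tau>) (S \<sigma>) * R)\<^sup>\<star> * \<sigma> R = 1 \<and> R\<^sup>\<star> * \<tau> (flip (S \<tau>) (S \<sigma>) * R) = 1"
proof -
  note c\<sigma> = canonical_space[OF \<sigma>]
  obtain n \<Phi> where \<Phi>: "orthonormal_basis (S \<sigma>) n \<Phi>"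
    using canonical_support[OF c\<sigma>] by (auto simp: has_support_def)
  have \<Phi>1: "(\<Sum>j<n. \<Phi> j * (\<Phi> j)\<^sup>\<star>) = 1" by (rule onb_support_one[OF canonical_support[OF c\<sigma>] \<Phi>])
  hence "n > 0" by (intro Nat.gr0I) simp
  obtain \<pi> where rep: "unitary_rep G T n \<pi>"
    and act: "\<forall>g\<in>carrier G. \<forall>j<n. \<alpha> g (\<Phi> j) = (\<Sum>i<n. \<pi> g $$ (i, j) *\<^sub>C \<Phi> i)"
    using invariant_subspace_rep[OF canonical_invariant[OF c\<sigma>] \<Phi>] by blast
  let ?c = "\<lambda>g. mat n n (\<lambda>(i, j). cnj (\<pi> g $$ (i, j)))"
  have crep: "unitary_rep G T n ?c" by (rule unitary_rep_conjugate[OF rep])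
  obtain \<tau> \<Theta> where \<tau>: "\<tau> \<in> Ob" and \<Theta>: "orthonormal_basis (S \<tau>) n \<Theta>"
    and cact: "\<forall>g\<in>carrier G. \<forall>j<n. \<alpha> g (\<Theta> j) = (\<Sum>i<n. ?c g $$ (i, j) *\<^sub>C \<Theta> i)"
    using unitary_rep_object[OF crep \<open>n > 0\<close>] by blast
  note c\<tau> = canonical_space[OF \<tau>]
  have \<Theta>1: "(\<Sum>j<n. \<Theta> j * (\<Theta> j)\<^sup>\<star>) = 1" by (rule onb_support_one[OF canonical_support[OF c\<tau>] \<Theta>])
  define R where "R = (\<Sum>j<n. \<Theta> j * \<Phi> j)"
  have RA: "R \<in> \<A>"
    unfolding R_def by (rule fixed_pairing[OF crep]) (simp_all add: act cact)
  have Rp: "R \<in> hs_product (S \<tau>) (S \<sigma>)"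
    unfolding R_def hs_product_def using onb_mem[OF \<Theta>] onb_mem[OF \<Phi>]
    by (intro complex_vector.span_sum complex_vector.span_base) blast
  have RHom: "R \<in> Hom \<iota> (compose \<A> \<tau> \<sigma>)"
    unfolding space_unit space_compose[OF \<tau> \<sigma>]
    using RA Rp by (intro hs_homI subspace_mult_scalar) (simp_all add: hs_product_def)
  define Q where "Q = flip (S \<tau>) (S \<sigma>) * R"
  have Q: "Q = (\<Sum>j<n. \<Phi> j * \<Theta> j)"
    unfolding Q_def R_def sum_distrib_left using onb_mem[OF \<Theta>] onb_mem[OF \<Phi>]
    by (intro sum.cong refl) (simp add: flip_mult[OF c\<tau> c\<sigma>])
  have QA: "Q \<in> \<A>" unfolding Q_def by (intro fixed_mult RA flip_fixed[OF c\<tau> c\<sigma>])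
  have \<Theta>R: "(\<Theta> j)\<^sup>\<star> * R = \<Phi> j" if "j < n" for j
  proof -
    have "(\<Theta> j)\<^sup>\<star> * R = (\<Sum>k<n. if k = j then \<Phi> k else 0)"
      unfolding R_def sum_distrib_left mult.assoc[symmetric] using that
      by (intro sum.cong refl) (simp add: onb_delta[OF \<Theta>])
    thus ?thesis using that by simp
  qed
  have \<Phi>Q: "(\<Phi> j)\<^sup>\<star> * Q = \<Theta> j" if "j < n" for j
  proof -
    have "(\<Phi> j)\<^sup>\<star> * Q = (\<Sum>k<n. if k = j then \<Theta> k else 0)"
      unfolding Q sum_distrib_left mult.assoc[symmetric] using that
      by (intro sum.cong refl) (simp add: onb_delta[OF \<Phi>])
    thus ?thesis using that by simp
  qed
  have "Q\<^sup>\<star> * \<sigma> R = (\<Sum>j<n. (\<Theta> j)\<^sup>\<star> * ((\<Phi> j)\<^sup>\<star> * \<sigma> R))"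
    unfolding Q by (simp add: star_simps sum_distrib_right mult.assoc)
  also have "\<dots> = (\<Sum>j<n. (\<Theta> j)\<^sup>\<star> * R * (\<Phi> j)\<^sup>\<star>)"
    using canonical_star_mult[OF c\<sigma> RA onb_mem[OF \<Phi>]] by (simp add: mult.assoc)
  also have "\<dots> = 1" using \<Phi>1 by (simp add: \<Theta>R)
  finally have QR: "Q\<^sup>\<star> * \<sigma> R = 1" .
  have "R\<^sup>\<star> * \<tau> Q = (\<Sum>j<n. (\<Phi> j)\<^sup>\<star> * ((\<Theta> j)\<^sup>\<star> * \<tau> Q))"
    unfolding R_def by (simp add: star_simps sum_distrib_right mult.assoc)
  hence "R\<^sup>\<star> * \<tau> Q = (\<Sum>j<n. (\<Phi> j)\<^sup>\<star> * Q * (\<Theta> j)\<^sup>\<star>)"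
    using canonical_star_mult[OF c\<tau> QA onb_mem[OF \<Theta>]] by (simp add: mult.assoc)
  hence RQ: "R\<^sup>\<star> * \<tau> Q = 1" using \<Theta>1 by (simp add: \<Phi>Q)
  from \<tau> RHom QR RQ show ?thesis unfolding Q_def by blast
qed

lemma conjugation: "\<exists>bar R. conjugation_structure \<A> Ob Hom (\<lambda>\<sigma> \<tau>. flip (S \<sigma>) (S \<tau>)) bar R"
proof -
  have "\<forall>\<sigma>. \<exists>p. \<sigma> \<in> Ob \<longrightarrow> fst p \<in> Ob \<and> snd p \<in> Hom \<iota> (compose \<A> (fst p) \<sigma>) \<and>
    (flip (S (fst p)) (S \<sigma>) * snd p)\<^sup>\<star> * \<sigma> (snd p) = 1 \<and>
    (snd p)\<^sup>\<star> * fst p (flip (S (fst p)) (S \<sigma>) * snd p) = 1"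
    using conjugate_exists by (metis fst_conv snd_conv)
  then obtain p where "\<forall>\<sigma>. \<sigma> \<in> Ob \<longrightarrow> fst (p \<sigma>) \<in> Ob \<and> snd (p \<sigma>) \<in> Hom \<iota> (compose \<A> (fst (p \<sigma>)) \<sigma>) \<and>
    (flip (S (fst (p \<sigma>))) (S \<sigma>) * snd (p \<sigma>))\<^sup>\<star> * \<sigma> (snd (p \<sigma>)) = 1 \<and>
    (snd (p \<sigma>))\<^sup>\<star> * fst (p \<sigma>) (flip (S (fst (p \<sigma>))) (S \<sigma>) * snd (p \<sigma>)) = 1"
    by (rule choice[THEN exE])
  thus ?thesis
    unfolding conjugation_structure_def Let_def
    by (intro exI[of _ "\<lambda>\<sigma>. fst (p \<sigma>)"] exI[of _ "\<lambda>\<sigma>. snd (p \<sigma>)"]) simp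
qed

text \<open>\<open>V\<close> and \<open>W\<close> embed the two assigned spaces orthogonally, and
  the sum of the images has support 1. Its canonical endomorphism may have a different assigned
  space, which the unitary \<open>Y\<close> reaches.\<close>

lemma direct_sums: "has_direct_sums Ob Hom"
  unfolding has_direct_sums_def
proof (intro ballI)
  fix \<sigma> \<tau> assume \<sigma>: "\<sigma> \<in> Ob" and \<tau>: "\<tau> \<in> Ob"
  note c\<sigma> = canonical_space[OF \<sigma>] and c\<tau> = canonical_space[OF \<tau>]
  obtain V W where VW: "V \<in> \<A>" "W \<in> \<A>" "V\<^sup>\<star> * V = 1" "W\<^sup>\<star> * W = 1" "V * V\<^sup>\<star> + W * W\<^sup>\<star> = 1"
    "V\<^sup>\<star> * W = 0" "W\<^sup>\<star> * V = 0" by (rule property_B_obtain)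
  obtain n \<Phi> where \<Phi>: "orthonormal_basis (S \<sigma>) n \<Phi>"
    using canonical_support[OF c\<sigma>] by (auto simp: has_support_def)
  obtain m \<Psi> where \<Psi>: "orthonormal_basis (S \<tau>) m \<Psi>"
    using canonical_support[OF c\<tau>] by (auto simp: has_support_def)
  let ?I = "{..<n} <+> {..<m}" and ?\<xi> = "case_sum (\<lambda>i. V * \<Phi> i) (\<lambda>j. W * \<Psi> j)"
  define L where "L = cspan (?\<xi> ` ?I)"
  have inner: "(V * x)\<^sup>\<star> * (V * y) = x\<^sup>\<star> * y" "(W * x)\<^sup>\<star> * (W * y) = x\<^sup>\<star> * y"
    "(V * x)\<^sup>\<star> * (W * y) = 0" "(W * x)\<^sup>\<star> * (V * y) = 0" for x y
  proof -
    have "(A * x)\<^sup>\<star> * (B * y) = x\<^sup>\<star> * (A\<^sup>\<star> * B) * y" for A B by (simp add: star_mult mult.assoc)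
    thus "(V * x)\<^sup>\<star> * (V * y) = x\<^sup>\<star> * y" "(W * x)\<^sup>\<star> * (W * y) = x\<^sup>\<star> * y"
      "(V * x)\<^sup>\<star> * (W * y) = 0" "(W * x)\<^sup>\<star> * (V * y) = 0" by (simp_all add: VW)
  qed
  have "orthonormal ?I ?\<xi>"
    using onb_delta[OF \<Phi>] onb_delta[OF \<Psi>] by (auto simp: orthonormal_def inner split: if_splits)
  then obtain \<xi> where \<xi>: "orthonormal_basis L (card ?I) \<xi>"
    "\<And>F. (\<Sum>k<card ?I. \<xi> k * F * (\<xi> k)\<^sup>\<star>) = (\<Sum>i\<in>?I. ?\<xi> i * F * (?\<xi> i)\<^sup>\<star>)"
    using orthonormal_reindex[OF finite_Plus[OF finite_lessThan finite_lessThan], of n m ?\<xi>]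
    unfolding L_def by blast
  have "(\<Sum>i\<in>?I. ?\<xi> i * 1 * (?\<xi> i)\<^sup>\<star>)
      = V * (\<Sum>i<n. \<Phi> i * (\<Phi> i)\<^sup>\<star>) * V\<^sup>\<star> + W * (\<Sum>j<m. \<Psi> j * (\<Psi> j)\<^sup>\<star>) * W\<^sup>\<star>"
    by (simp add: sum.Plus star_mult sum_distrib_left sum_distrib_right mult.assoc)
  also have "\<dots> = 1"
    using onb_support_one[OF canonical_support[OF c\<sigma>] \<Phi>] onb_support_one[OF canonical_support[OF c\<tau>] \<Psi>] VW
    by simp
  finally have "has_support L 1"
    unfolding has_support_def using \<xi>(1) \<xi>(2)[of 1] by (auto simp del: card_Plus)
  have VL: "V * x \<in> L" if "x \<in> S \<sigma>" for x
  proof -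
    have "V * x * 1 \<in> L"
    proof (rule span_mult_mem[where B = "\<Phi> ` {..<n}"])
      fix y assume "y \<in> \<Phi> ` {..<n}"
      then obtain i where "i < n" "y = \<Phi> i" by auto
      moreover from this have "?\<xi> (Inl i) \<in> L"
        unfolding L_def by (intro complex_vector.span_base imageI) auto
      ultimately show "V * y * 1 \<in> L" by simp
    qed (use \<Phi> that in \<open>auto simp: orthonormal_basis_iff L_def\<close>)
    thus ?thesis by simp
  qed
  have WL: "W * x \<in> L" if "x \<in> S \<tau>" for x
  proof -
    have "W * x * 1 \<in> L"
    proof (rule span_mult_mem[where B = "\<Psi> ` {..<m}"])
      fix y assume "y \<in> \<Psi> ` {..<m}"
      then obtain i where "i < m" "y = \<Psi> i" by auto
      moreover from this have "?\<xi> (Inr i) \<in> L"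
        unfolding L_def by (intro complex_vector.span_base imageI) auto
      ultimately show "W * y * 1 \<in> L" by simp
    qed (use \<Psi> that in \<open>auto simp: orthonormal_basis_iff L_def\<close>)
    thus ?thesis by simp
  qed
  have "invariant L"
    unfolding invariant_def
  proof (intro ballI)
    fix g assume g: "g \<in> carrier G"
    have "\<alpha> g (V * \<Phi> i) \<in> L" if "i < n" for i
      using VL[OF invariantD[OF canonical_invariant[OF c\<sigma>] g onb_mem[OF \<Phi> that]]]
      by (simp add: act_mult[OF g] fixedD[OF VW(1) g])
    moreover have "\<alpha> g (W * \<Psi> i) \<in> L" if "i < m" for i
      using WL[OF invariantD[OF canonical_invariant[OF c\<tau>] g onb_mem[OF \<Psi> that]]]
      by (simp add: act_mult[OF g] fixedD[OF VW(2) g])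
    ultimately show "\<alpha> g ` L \<subseteq> L"
      by (subst L_def, unfold act_span[OF g], intro complex_vector.span_minimal onb_subspace[OF \<xi>(1)]) auto
  qed
  then obtain \<rho> where \<rho>: "canonical L \<rho>"
    using canonical_exists[OF \<open>has_support L 1\<close>] by blast
  obtain Y where Y: "\<rho> \<in> Ob" "Y \<in> hs_hom L (S \<rho>)" "Y\<^sup>\<star> * Y = 1" "Y * Y\<^sup>\<star> = 1"
    by (rule canonical_transport[OF \<rho>])
  have "Y * V \<in> Hom \<sigma> \<rho>" "Y * W \<in> Hom \<tau> \<rho>"
    by (rule hs_hom_mult[OF _ Y(2)], rule hs_homI, use VW VL WL in auto)+
  moreover have "is_isometry (Y * V)" "is_isometry (Y * W)"
  proof -
    have "(Y * A)\<^sup>\<star> * (Y * A) = A\<^sup>\<star> * (Y\<^sup>\<star> * Y) * A" for A by (simp add: star_mult mult.assoc)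
    thus "is_isometry (Y * V)" "is_isometry (Y * W)" by (simp_all add: is_isometry_def Y VW)
  qed
  moreover have "(Y * V) * (Y * V)\<^sup>\<star> + (Y * W) * (Y * W)\<^sup>\<star> = 1"
  proof -
    have "(Y * V) * (Y * V)\<^sup>\<star> + (Y * W) * (Y * W)\<^sup>\<star> = Y * (V * V\<^sup>\<star> + W * W\<^sup>\<star>) * Y\<^sup>\<star>"
      by (simp add: star_mult algebra_simps)
    thus ?thesis by (simp add: VW Y)
  qed
  ultimately show "\<exists>\<rho>\<in>Ob. \<exists>V\<in>Hom \<sigma> \<rho>. \<exists>W\<in>Hom \<tau> \<rho>.
      is_isometry V \<and> is_isometry W \<and> V * V\<^sup>\<star> + W * W\<^sup>\<star> = 1"
    using Y(1) by blast
qed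

text \<open>The range of \<open>E\<close> in the space of \<open>\<sigma>\<close> has support
  \<open>E\<close>, which in general is not 1, so it need not be the space of an object. Its
  representation is realized on the assigned space of some object, and \<open>V\<close> matches the
  two bases.\<close>

lemma subobjects: "has_subobjects Ob Hom"
  unfolding has_subobjects_def
proof (intro ballI impI)
  fix \<sigma> E assume \<sigma>: "\<sigma> \<in> Ob" and E: "E \<in> Hom \<sigma> \<sigma>" and "is_projection E \<and> E \<noteq> 0"
  hence Es: "E\<^sup>\<star> = E" "E * E = E" "E \<noteq> 0" by (auto simp: is_projection_def)
  note c\<sigma> = canonical_space[OF \<sigma>]
  define L where "L = {x\<in>S \<sigma>. E * x = x}"
  have LS: "L \<subseteq> S \<sigma>" by (auto simp: L_def)
  have cL: "csubspace L"
    using canonical_csubspace[OF c\<sigma>]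
    by (auto simp: L_def complex_vector.subspace_def distrib_left scaleC_simps)
  have "hilbert_subspace L" by (rule hilbert_subspace_subset[OF canonical_hilbert_subspace[OF c\<sigma>] cL LS])
  then obtain m w where w: "orthonormal_basis L m w" by (auto simp: hilbert_subspace_def)
  have EL: "E * x \<in> L" if "x \<in> S \<sigma>" for x
    using hs_hom_mem[OF E that] Es by (simp add: L_def flip: mult.assoc)
  define P where "P = (\<Sum>j<m. w j * (w j)\<^sup>\<star>)"
  have P: "has_support L P" using w by (auto simp: has_support_def P_def)
  have "P = E"
  proof -
    have "P * E = E"
      by (rule canonical_ext[OF c\<sigma>]) (simp add: has_support_fix[OF P EL] mult.assoc)
    moreover have "E * P = 1 * P" by (rule has_support_mult_cong[OF P]) (simp add: L_def)
    hence "(E * P)\<^sup>\<star> = P\<^sup>\<star>" by simp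
    ultimately show ?thesis by (simp add: star_mult Es has_support_star[OF P])
  qed
  \<comment> \<open>A space of support 1 is not zero, so the zero-dimensional representation belongs
    to no object; \<open>E \<noteq> 0\<close> excludes it.\<close>
  have "m > 0" using Es(3) \<open>P = E\<close> by (intro Nat.gr0I) (simp add: P_def)
  have "invariant L"
    unfolding invariant_def
  proof safe
    fix g x assume g: "g \<in> carrier G" and x: "x \<in> L"
    have "E * \<alpha> g x = \<alpha> g (E * x)" by (simp add: act_mult[OF g] fixedD[OF hs_hom_fixed[OF E] g])
    thus "\<alpha> g x \<in> L" using x invariantD[OF canonical_invariant[OF c\<sigma>] g] by (simp add: L_def)
  qed
  obtain \<pi> where rep: "unitary_rep G T m \<pi>"
    and act: "\<forall>g\<in>carrier G. \<forall>j<m. \<alpha> g (w j) = (\<Sum>i<m. \<pi> g $$ (i, j) *\<^sub>C w i)"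
    using invariant_subspace_rep[OF \<open>invariant L\<close> w] by blast
  obtain \<tau> \<Theta> where \<tau>: "\<tau> \<in> Ob" and \<Theta>: "orthonormal_basis (S \<tau>) m \<Theta>"
    and act': "\<forall>g\<in>carrier G. \<forall>j<m. \<alpha> g (\<Theta> j) = (\<Sum>i<m. \<pi> g $$ (i, j) *\<^sub>C \<Theta> i)"
    using unitary_rep_object[OF rep \<open>m > 0\<close>] by blast
  note c\<tau> = canonical_space[OF \<tau>]
  define V where "V = (\<Sum>j<m. w j * (\<Theta> j)\<^sup>\<star>)"
  have Vs: "V\<^sup>\<star> = (\<Sum>j<m. \<Theta> j * (w j)\<^sup>\<star>)" by (simp add: V_def star_simps)
  have "V \<in> \<A>"
    unfolding V_def by (rule fixed_pairing[OF rep]) (simp_all add: act act' act_star star_simps)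
  moreover have "V * x \<in> S \<sigma>" if "x \<in> S \<tau>" for x
  proof -
    have "V * x = (\<Sum>j<m. w j * ((\<Theta> j)\<^sup>\<star> * x))" by (simp add: V_def sum_distrib_right mult.assoc)
    also have "\<dots> \<in> S \<sigma>"
      by (intro subspace_sum_mult_scalar canonical_csubspace[OF c\<sigma>])
         (use onb_mem[OF w] LS onb_coef[OF \<Theta> that] in auto)
    finally show ?thesis .
  qed
  ultimately have "V \<in> Hom \<tau> \<sigma>" by (rule hs_homI)
  moreover have V\<Theta>: "V * \<Theta> j = w j" if "j < m" for j
  proof -
    have "V * \<Theta> j = (\<Sum>k<m. if k = j then w k else 0)"
      unfolding V_def sum_distrib_right mult.assoc using that
      by (intro sum.cong refl) (simp add: onb_delta[OF \<Theta>])
    thus ?thesis using that by simp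
  qed
  have Vw: "V\<^sup>\<star> * w j = \<Theta> j" if "j < m" for j
  proof -
    have "V\<^sup>\<star> * w j = (\<Sum>k<m. if k = j then \<Theta> k else 0)"
      unfolding Vs sum_distrib_right mult.assoc using that
      by (intro sum.cong refl) (simp add: onb_delta[OF w])
    thus ?thesis using that by simp
  qed
  have "V * V\<^sup>\<star> = E"
    unfolding \<open>P = E\<close>[symmetric] P_def Vs
    by (simp add: sum_distrib_left V\<Theta> flip: mult.assoc)
  moreover have "V\<^sup>\<star> * V = 1"
    unfolding onb_support_one[OF canonical_support[OF c\<tau>] \<Theta>, symmetric]
    by (subst V_def) (simp add: sum_distrib_left Vw flip: mult.assoc)
  ultimately show "\<exists>\<tau>\<in>Ob. \<exists>V\<in>Hom \<tau> \<sigma>. is_isometry V \<and> V * V\<^sup>\<star> = E"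
    using \<tau> by (auto simp: is_isometry_def)
qed

lemma DR_category: "DR_category \<A> Ob Hom"
  unfolding DR_category_def
  using tensor_category Hom_unit direct_sums subobjects permutation conjugation by blast

end

lemma hilbert_cstar_system_action:
  assumes "hilbert_cstar_system G T \<mu> \<alpha>" "property_B (fixed_algebra G \<alpha>)"
  shows "hilbert_action G \<alpha> T"
proof (intro hilbert_action.intro star_action.intro hilbert_action_axioms.intro)
  show "Group.group G" "topspace T = carrier G"
    using assms by (auto simp: hilbert_cstar_system_def compact_group_def)
  show "star_automorphism (\<alpha> g)" if "g \<in> carrier G" for g
    using assms that by (auto simp: hilbert_cstar_system_def)
  show "\<alpha> (g \<otimes>\<^bsub>G\<^esub> h) = \<alpha> g \<circ> \<alpha> h" if "g \<in> carrier G" "h \<in> carrier G" for g h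
    using assms that by (auto simp: hilbert_cstar_system_def)
  show "continuous_map T euclidean (\<lambda>g. \<alpha> g F)" for F
    using assms by (auto simp: hilbert_cstar_system_def)
  show "\<exists>H. invariant_hilbert_space G \<alpha> H \<and> carries_rep G \<alpha> H n \<pi>" if "irreducible_rep G T n \<pi>" for n \<pi>
    using assms(1) that unfolding hilbert_cstar_system_def by blast
qed (rule assms(2))

theorem theorem4p11:
  fixes G :: "('g, 'b) monoid_scheme" and T :: "'g topology" and \<mu> :: "'g measure"
    and \<alpha> :: "'g \<Rightarrow> 'f::cstar_algebra \<Rightarrow> 'f"
  assumes "hilbert_cstar_system G T \<mu> \<alpha>"
    and "minimal_system G \<alpha>"
    and "regular_system G \<alpha>"
    and "property_B (fixed_algebra G \<alpha>)"
  shows "\<exists>Hom\<^sub>C :: ('f \<Rightarrow> 'f) \<Rightarrow> ('f \<Rightarrow> 'f) \<Rightarrow> 'f set.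
    DR_category (fixed_algebra G \<alpha>) (canonical_endos G \<alpha>) Hom\<^sub>C \<and>
    (\<forall>\<sigma>\<in>canonical_endos G \<alpha>. \<forall>\<tau>\<in>canonical_endos G \<alpha>.
       Hom\<^sub>C \<sigma> \<tau> \<subseteq> intertwiners (fixed_algebra G \<alpha>) \<sigma> \<tau> \<and>
       intertwiners (fixed_algebra G \<alpha>) \<sigma> \<tau> =
         cspan {X * \<sigma> z | X z. X \<in> Hom\<^sub>C \<sigma> \<tau> \<and> z \<in> center (fixed_algebra G \<alpha>)} \<and>
       intertwiners (fixed_algebra G \<alpha>) \<sigma> \<tau> =
         cspan {\<tau> y * X * \<sigma> z | X y z. X \<in> Hom\<^sub>C \<sigma> \<tau> \<and>
           y \<in> center (fixed_algebra G \<alpha>) \<and> z \<in> center (fixed_algebra G \<alpha>)})"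
proof -
  interpret hilbert_action G \<alpha> T by (rule hilbert_cstar_system_action[OF assms(1,4)])
  obtain S where S: "\<forall>\<sigma>\<in>canonical_endos G \<alpha>. canonical (S \<sigma>) \<sigma>"
    "\<forall>\<sigma>\<in>canonical_endos G \<alpha>. \<forall>\<tau>\<in>canonical_endos G \<alpha>.
      S (compose (fixed_algebra G \<alpha>) \<sigma> \<tau>) = hs_product (S \<sigma>) (S \<tau>)"
    using assms(3) unfolding regular_system_def canonical_def by blast
  interpret regular_action G \<alpha> T S
    by unfold_locales (use assms(2) S in auto)
  show ?thesis
  proof (intro exI conjI ballI)
    show "DR_category \<A> Ob Hom" by (rule DR_category)
    fix \<sigma> \<tau> assume *: "\<sigma> \<in> Ob" "\<tau> \<in> Ob"
    note c = canonical_space[OF *(1)] canonical_space[OF *(2)]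
    show "Hom \<sigma> \<tau> \<subseteq> intertwiners \<A> \<sigma> \<tau>" using hs_hom_intertwiners[OF c] by blast
    show "intertwiners \<A> \<sigma> \<tau> = cspan {X * \<sigma> z | X z. X \<in> Hom \<sigma> \<tau> \<and> z \<in> \<Z>}"
      "intertwiners \<A> \<sigma> \<tau> = cspan {\<tau> y * X * \<sigma> z | X y z. X \<in> Hom \<sigma> \<tau> \<and> y \<in> \<Z> \<and> z \<in> \<Z>}"
      using intertwiners_span[OF c] .
  qed
qed

end
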